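(* Let $0<\alpha<n$, let $K_\alpha$ be a standard fractional Calderón–Zygmund kernel (SFCZK), let $P(x,y)$ be any real-valued polynomial on $\mathbb{R}^n\times\mathbb{R}^n$, and let $$S_\alpha f(x)=\int_{\mathbb{R}^n}e^{iP(x,y)}K_\alpha(x,y)f(y)\,dy .$$ (i) Let $1<p<\frac n\alpha$, $\frac1q=\frac1p-\frac\alpha n$, $0<k<\frac pq$ and $w\in A_{(p,q)}$. Then there exists a constant $C>0$ such that for all $f\in M_{p,k}(w^p,w^q)$, $$\|S_\alpha f\|_{M_{q,\frac{qk}{p}}(w^q)}\le C\,\|f\|_{M_{p,k}(w^p,w^q)},$$ where $C$ depends on $P$ only through the total degree of $P$, and not on the coefficients of $P$. (ii) Let $p=1$, $q=\frac{n}{n-\alpha}$, $0<k<\frac1q$ and $w\in A_{(1,q)}$. Then there exists a constant $C>0$ such that for all $\lambda>0$, all $f\in M_{1,k}(w,w^q)$ and all balls $B\subset\mathbb{R}^n$, $$w^q\left(\{x\in B:|S_\alpha f(x)|>\lambda\}\right)\le\frac{C}{\lambda^q}\,\|f\|_{M_{1,k}(w,w^q)}^q\,\left(w^q(B)\right)^{kq}.$$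
   Context: A weight is a locally integrable function on $\mathbb{R}^n$ taking values in $(0,\infty)$ almost everywhere; for a weight $v$, $v(E)=\int_E v(x)\,dx$, so $w^q(E)=\int_E w(x)^q\,dx$. For $1<p,q<\infty$, $w\in A_{(p,q)}$ means $$\sup_B\left(\frac1{|B|}\int_Bw(x)^q\,dx\right)^{1/q}\left(\frac1{|B|}\int_Bw(x)^{-p'}dx\right)^{1/p'}<\infty,\qquad \tfrac1p+\tfrac1{p'}=1,$$ and for $p=1$, $w\in A_{(1,q)}$ means $$\sup_B\left(\frac1{|B|}\int_Bw(x)^q\,dx\right)^{1/q}\operatorname{ess\,sup}_{x\in B}\frac1{w(x)}<\infty,$$ suprema over all balls $B\subset\mathbb{R}^n$. A kernel $K_\alpha$ on $\mathbb{R}^n\times\mathbb{R}^n$ is a standard fractional Calderón–Zygmund kernel (SFCZK) if for some constant $C$ and all $x\neq y$: $|K_\alpha(x,y)|\le C|x-y|^{-(n-\alpha)}$ and $|\nabla_xK_\alpha(x,y)|+|\nabla_yK_\alpha(x,y)|\le C|x-y|^{-(n+1-\alpha)}$. Weighted Morrey spaces: for $1\le p<\infty$, $0<k<1$ and weights $w_1,w_2$, $M_{p,k}(w_1,w_2)$ is the space of $f$ with $$\|f\|_{M_{p,k}(w_1,w_2)}=\sup_B\left(\frac1{w_2(B)^k}\int_B|f(x)|^pw_1(x)\,dx\right)^{1/p}<\infty,$$ supremum over all balls $B\subset\mathbb{R}^n$; and $M_{p,k}(w)=M_{p,k}(w,w)$. *)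

theory Defs
  imports
    "HOL-Analysis.Analysis"
    "HOL-Probability.Essential_Supremum"
    "HOL-Library.Poly_Mapping"
begin

text \<open>A power of an extended nonnegative real; only used with positive exponents \<open>a\<close>.\<close>

definition epowr :: "ennreal \<Rightarrow> real \<Rightarrow> ennreal" (infixr \<open>epowr\<close> 80) where
  "x epowr a = (if x = top then top else ennreal (enn2real x powr a))"

definition balls :: "'a::metric_space set set" where
  "balls = {ball c r | c r. 0 < r}"

definition weight :: "('a::euclidean_space \<Rightarrow> real) \<Rightarrow> bool" where
  "weight v \<longleftrightarrow> (\<forall>S. compact S \<longrightarrow> set_integrable lebesgue S v) \<and> (AE x in lebesgue. 0 < v x)"

definition wmeasure :: "('a::euclidean_space \<Rightarrow> real) \<Rightarrow> 'a set \<Rightarrow> ennreal" where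
  "wmeasure v E = (\<integral>\<^sup>+ x\<in>E. ennreal (v x) \<partial>lebesgue)"

definition avg :: "'a::euclidean_space set \<Rightarrow> ('a \<Rightarrow> real) \<Rightarrow> ennreal" where
  "avg B g = (\<integral>\<^sup>+ x\<in>B. ennreal (g x) \<partial>lebesgue) / emeasure lebesgue B"

text \<open>The class \<open>A\<^sub>(\<^sub>p\<^sub>,\<^sub>q\<^sub>)\<close>; the conjugate exponent of \<open>p > 1\<close> is \<open>p / (p - 1)\<close>.
  A weight is positive almost everywhere, so the first factor under each supremum is nonzero and
  the convention \<open>0 * top = 0\<close> of \<open>ennreal\<close> plays no role.\<close>

definition A_class :: "real \<Rightarrow> real \<Rightarrow> ('a::euclidean_space \<Rightarrow> real) set" where
  "A_class p q = {w. weight w \<and>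
     (if p = 1
      then (SUP B\<in>balls. (avg B (\<lambda>x. w x powr q)) epowr (1 / q)
              * esssup (lebesgue_on B) (\<lambda>x. 1 / ennreal (w x))) < top
      else (let p' = p / (p - 1) in
            (SUP B\<in>balls. (avg B (\<lambda>x. w x powr q)) epowr (1 / q)
              * (avg B (\<lambda>x. w x powr (- p'))) epowr (1 / p')) < top))}"

definition morrey_norm ::
  "real \<Rightarrow> real \<Rightarrow> ('a::euclidean_space \<Rightarrow> real) \<Rightarrow> ('a \<Rightarrow> real) \<Rightarrow> ('a \<Rightarrow> complex) \<Rightarrow> ennreal" where
  "morrey_norm p k w1 w2 f =
     (SUP B\<in>balls. ((\<integral>\<^sup>+ x\<in>B. ennreal (cmod (f x) powr p * w1 x) \<partial>lebesgue)
                     / (wmeasure w2 B) epowr k) epowr (1 / p))"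

definition morrey_space ::
  "real \<Rightarrow> real \<Rightarrow> ('a::euclidean_space \<Rightarrow> real) \<Rightarrow> ('a \<Rightarrow> real) \<Rightarrow> ('a \<Rightarrow> complex) set" where
  "morrey_space p k w1 w2 = {f \<in> borel_measurable lebesgue. morrey_norm p k w1 w2 f < top}"

definition gradient :: "(real ^ 'n \<Rightarrow> complex) \<Rightarrow> real ^ 'n \<Rightarrow> complex ^ 'n::finite" where
  "gradient g x = (\<chi> i. frechet_derivative g (at x) (axis i 1))"

text \<open>The values of \<open>K\<close> on the diagonal are irrelevant and left unconstrained.\<close>

definition SFCZK :: "real \<Rightarrow> (real ^ 'n \<Rightarrow> real ^ 'n \<Rightarrow> complex) \<Rightarrow> bool" where
  "SFCZK \<alpha> K \<longleftrightarrow> (\<exists>C. \<forall>x y. x \<noteq> y \<longrightarrow>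
     cmod (K x y) \<le> C * norm (x - y) powr (- (real CARD('n) - \<alpha>)) \<and>
     (\<lambda>u. K u y) differentiable (at x) \<and> (\<lambda>v. K x v) differentiable (at y) \<and>
     norm (gradient (\<lambda>u. K u y) x) + norm (gradient (\<lambda>v. K x v) y)
       \<le> C * norm (x - y) powr (- (real CARD('n) + 1 - \<alpha>)))"

text \<open>A monomial is a finitely supported exponent function on the \<open>2n\<close> variables
  \<open>x\<^sub>i\<close> (index \<open>Inl i\<close>) and \<open>y\<^sub>i\<close> (index \<open>Inr i\<close>);
  a polynomial is a finitely supported family of real coefficients of monomials.\<close>

type_synonym 'n poly2 = "('n + 'n \<Rightarrow>\<^sub>0 nat) \<Rightarrow>\<^sub>0 real"

definition poly2_eval :: "'n::finite poly2 \<Rightarrow> real ^ 'n \<Rightarrow> real ^ 'n \<Rightarrow> real" where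
  "poly2_eval P x y = (\<Sum>m\<in>Poly_Mapping.keys P. Poly_Mapping.lookup P m *
     (\<Prod>i\<in>UNIV. (x $ i) ^ Poly_Mapping.lookup m (Inl i)) *
     (\<Prod>i\<in>UNIV. (y $ i) ^ Poly_Mapping.lookup m (Inr i)))"

text \<open>The zero polynomial is given total degree \<open>0\<close>.\<close>

definition total_degree :: "'n::finite poly2 \<Rightarrow> nat" where
  "total_degree P = Max (insert 0 ((\<lambda>m. \<Sum>v\<in>UNIV. Poly_Mapping.lookup m v) ` Poly_Mapping.keys P))"

definition osc_integrand ::
  "'n::finite poly2 \<Rightarrow> (real ^ 'n \<Rightarrow> real ^ 'n \<Rightarrow> complex) \<Rightarrow> (real ^ 'n \<Rightarrow> complex)
    \<Rightarrow> real ^ 'n \<Rightarrow> real ^ 'n \<Rightarrow> complex" where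
  "osc_integrand P K f x y = exp (\<i> * complex_of_real (poly2_eval P x y)) * K x y * f y"

text \<open>The library integral is \<open>0\<close> where the integrand is not integrable, so statements about
  \<open>osc_op\<close> are only meaningful together with \<open>osc_defined\<close>.\<close>

definition osc_op ::
  "'n::finite poly2 \<Rightarrow> (real ^ 'n \<Rightarrow> real ^ 'n \<Rightarrow> complex) \<Rightarrow> (real ^ 'n \<Rightarrow> complex)
    \<Rightarrow> real ^ 'n \<Rightarrow> complex" where
  "osc_op P K f x = (LINT y|lebesgue. osc_integrand P K f x y)"

definition osc_defined ::
  "'n::finite poly2 \<Rightarrow> (real ^ 'n \<Rightarrow> real ^ 'n \<Rightarrow> complex) \<Rightarrow> (real ^ 'n \<Rightarrow> complex) \<Rightarrow> bool" where
  "osc_defined P K f \<longleftrightarrow> (AE x in lebesgue. integrable lebesgue (osc_integrand P K f x))"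

end

theory Submission
  imports Defs
begin

text \<open>Since the oscillating factor has modulus one, \<open>S\<^sub>\<alpha> f\<close> is dominated by the Riesz potential of
  \<open>|f|\<close>, so no constant ever depends on the polynomial. Put \<open>u = w\<^sup>q\<close>, \<open>s = w\<^sup>-\<^sup>p\<^sup>'\<close>,
  \<open>a = 1/q\<close>, \<open>b = 1/p'\<close>; then \<open>u\<^sup>a s\<^sup>b = 1\<close> and the class condition says that
  \<open>u(B)\<^sup>a s(B)\<^sup>b\<close> is at most a constant times \<open>|B|\<close> to the power \<open>a + b = 1 - \<alpha>/n\<close>. With
  Hoelder's inequality this makes both weights doubling and reverse doubling.

  Strong type: the Riesz kernel is a superposition, over all dyadic scales and all centres, of
  normalised indicators of \<open>B \<times> B\<close>, so the bilinear form of the potential is bounded by a sum over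
  balls of \<open>u(B)\<close> to the power \<open>1 - a\<close> times \<open>s(B)\<close> to the power \<open>1 - b\<close> times the averages of the two functions.
  As \<open>(1 - a) + (1 - b) > 1\<close>, Hoelder's inequality separates the two families of averages.
  Each is an off-diagonal embedding of \<open>L\<^sup>p\<close> of the weight into a weighted \<open>\<ell>\<^sup>r\<close> with \<open>r > p\<close>,
  which follows by Marcinkiewicz interpolation from a weak type \<open>(1, \<rho>)\<close> bound with \<open>\<rho> > 1\<close>;
  the latter only needs reverse doubling, because weak \<open>L\<^sup>\<rho>\<close> is normable. No covering lemma or
  maximal function is required. The endpoint \<open>p = 1\<close> is again the normability of weak \<open>L\<^sup>q\<close>.

  Morrey bounds: split \<open>f\<close> at \<open>2B\<close>; the far part is summed over the dilates \<open>2\<^sup>j B\<close> by reverse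
  doubling.\<close>

section \<open>Powers of extended nonnegative reals\<close>

text \<open>In the strong case \<open>a + b = 1 - \<alpha> / n\<close>, so the exponent
  \<open>T = 2 - a - b\<close> of the bilinear step is \<open>1 + \<alpha> / n\<close>: the
  off-diagonal gain comes entirely from \<alpha> > 0. All centres are used instead of a dyadic grid
  because a kernel that depends on ball and point only through membership makes each step an
  application of Tonelli's theorem; doubling pays for moving the centre. In the Morrey bounds
  \<open>k < p / q\<close> is what makes the far part summable: its pieces decay like the masses of
  the dilates to the power \<open>- (1 / q - k / p)\<close>, with \<open>p = 1\<close> at the
  endpoint. Two technical obstacles shape the rest. Weights are positive only almost everywhere and
  functions only Lebesgue measurable, while Tonelli arguments want Borel functions; so weights,
  functions and kernel are replaced by Borel versions and the results transferred back. Moreover an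
  integral is 0 when its integrand is not integrable, so no norm bound shows that
  \<open>osc_op P K f\<close> is meaningful; existence is derived from the finiteness of the
  potential almost everywhere.\<close>

lemma epowr_ennreal [simp]: "0 \<le> x \<Longrightarrow> ennreal x epowr a = ennreal (x powr a)"
  by (simp add: epowr_def)

lemma epowr_zero [simp]: "0 epowr a = 0"
  by (simp add: epowr_def)

lemma epowr_top [simp]: "top epowr a = top"
  by (simp add: epowr_def)

lemma epowr_one_right [simp]: "x epowr 1 = x"
  by (cases x rule: ennreal_cases) auto

lemma epowr_eq_top_iff [simp]: "x epowr a = top \<longleftrightarrow> x = top"
  by (simp add: epowr_def)

lemma epowr_less_top_iff: "x epowr a < top \<longleftrightarrow> x < top"
  by (simp add: less_top[symmetric])

lemma epowr_eq_0_iff [simp]: "x epowr a = 0 \<longleftrightarrow> x = 0"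
  by (cases x rule: ennreal_cases) auto

lemma epowr_mono: "x \<le> y \<Longrightarrow> 0 \<le> a \<Longrightarrow> x epowr a \<le> y epowr a"
  by (cases x rule: ennreal_cases; cases y rule: ennreal_cases)
     (auto simp: top_unique intro!: ennreal_leI powr_mono2)

lemma epowr_mult: "(x * y) epowr a = x epowr a * y epowr a"
  by (cases x rule: ennreal_cases; cases y rule: ennreal_cases)
     (auto simp: ennreal_mult[symmetric] powr_mult ennreal_mult_top ennreal_top_mult)

lemma epowr_epowr: "(x epowr a) epowr b = x epowr (a * b)"
  by (cases x rule: ennreal_cases) (auto simp: powr_powr)

lemma epowr_add: "x epowr (a + b) = x epowr a * x epowr b"
  by (cases x rule: ennreal_cases) (auto simp: powr_add ennreal_mult[symmetric])

lemma epowr_measurable [measurable (raw)]: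
  assumes [measurable]: "f \<in> borel_measurable M"
  shows "(\<lambda>x. f x epowr a) \<in> borel_measurable M"
  unfolding epowr_def by measurable

lemma epowr_divide:
  assumes "0 < y"
  shows "(x / ennreal y) epowr a = x epowr a / ennreal (y powr a)"
proof -
  have "x / ennreal y = x * ennreal (1 / y)"
    using assms by (simp add: divide_ennreal_def inverse_ennreal inverse_eq_divide)
  moreover have "x epowr a / ennreal (y powr a) = x epowr a * ennreal (1 / y powr a)"
    using assms by (simp add: divide_ennreal_def inverse_ennreal inverse_eq_divide)
  ultimately show ?thesis
    using assms by (simp add: epowr_mult powr_divide)
qed

lemma Young_epowr:
  assumes "0 < \<theta>" "\<theta> < 1"
  shows "x epowr \<theta> * y epowr (1 - \<theta>) \<le> ennreal \<theta> * x + ennreal (1 - \<theta>) * y"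
proof (cases "x = 0 \<or> y = 0 \<or> x = top \<or> y = top")
  case True
  then show ?thesis
    using assms by (auto simp: ennreal_mult_top)
next
  case False
  then obtain a b where ab: "x = ennreal a" "0 < a" "y = ennreal b" "0 < b"
    by (cases x rule: ennreal_cases; cases y rule: ennreal_cases)
       (auto simp: order.order_iff_strict)
  have "a powr \<theta> * b powr (1 - \<theta>) \<le> \<theta> * a + (1 - \<theta>) * b"
    using assms ab by (intro Youngs_inequality_0) auto
  then show ?thesis
    using ab assms by (simp add: ennreal_mult[symmetric] ennreal_plus[symmetric] del: ennreal_plus)
qed

lemma nn_integral_Hoelder:
  assumes [measurable]: "f \<in> borel_measurable M" "g \<in> borel_measurable M"
    and \<theta>: "0 < \<theta>" "\<theta> < 1"
  shows "(\<integral>\<^sup>+x. f x epowr \<theta> * g x epowr (1 - \<theta>) \<partial>M)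
           \<le> (\<integral>\<^sup>+x. f x \<partial>M) epowr \<theta> * (\<integral>\<^sup>+x. g x \<partial>M) epowr (1 - \<theta>)"
    (is "?L \<le> ?X epowr \<theta> * ?Y epowr (1 - \<theta>)")
\<comment> \<open>Normalising divides by both integrals. A zero integral kills the integrand almost
  everywhere; if neither is zero and one is infinite, the right-hand side is
  \<open>top\<close>.\<close>
proof (cases "?X = 0 \<or> ?Y = 0 \<or> ?X = top \<or> ?Y = top")
  case True
  then consider "?X = 0 \<or> ?Y = 0" | "?X \<noteq> 0" "?Y \<noteq> 0" "?X = top \<or> ?Y = top"
    by auto
  then show ?thesis
  proof cases
    case 1
    then have "(AE x in M. f x = 0) \<or> (AE x in M. g x = 0)"
      by (simp add: nn_integral_0_iff_AE)
    then have "?L = 0"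
      by (subst nn_integral_0_iff_AE) (auto elim: eventually_mono)
    then show ?thesis by simp
  next
    case 2
    then show ?thesis
      by (auto simp: ennreal_mult_top ennreal_top_mult)
  qed
next
  case False
  then obtain X Y where XY: "?X = ennreal X" "0 < X" "?Y = ennreal Y" "0 < Y"
    by (cases ?X rule: ennreal_cases; cases ?Y rule: ennreal_cases)
       (auto simp: order.order_iff_strict)
  have "?L = (\<integral>\<^sup>+x. ennreal (X powr \<theta> * Y powr (1 - \<theta>)) *
               ((f x * ennreal (1 / X)) epowr \<theta> * (g x * ennreal (1 / Y)) epowr (1 - \<theta>)) \<partial>M)"
  proof (intro nn_integral_cong, goal_cases)
    case (1 x)
    have "ennreal (X powr \<theta>) * ennreal ((1 / X) powr \<theta>) = 1"
         "ennreal (Y powr (1 - \<theta>)) * ennreal ((1 / Y) powr (1 - \<theta>)) = 1"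
      using XY by (simp_all add: ennreal_mult[symmetric] powr_mult[symmetric])
    then have "f x epowr \<theta> * g x epowr (1 - \<theta>) = 
      (ennreal (X powr \<theta>) * ennreal ((1 / X) powr \<theta>)) *
      (ennreal (Y powr (1 - \<theta>)) * ennreal ((1 / Y) powr (1 - \<theta>))) *
       (f x epowr \<theta> * g x epowr (1 - \<theta>))" by simp
    also have "\<dots> = ennreal (X powr \<theta> * Y powr (1 - \<theta>)) *
               ((f x * ennreal (1 / X)) epowr \<theta> * (g x * ennreal (1 / Y)) epowr (1 - \<theta>))"
      using XY by (simp add: epowr_mult ennreal_mult ac_simps)
    finally show ?case .
  qed
  also have "\<dots> = ennreal (X powr \<theta> * Y powr (1 - \<theta>)) *
     (\<integral>\<^sup>+x. (f x * ennreal (1 / X)) epowr \<theta> * (g x * ennreal (1 / Y)) epowr (1 - \<theta>) \<partial>M)"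
    by (intro nn_integral_cmult) measurable
  also have "(\<integral>\<^sup>+x. (f x * ennreal (1 / X)) epowr \<theta> * (g x * ennreal (1 / Y)) epowr (1 - \<theta>) \<partial>M)
     \<le> (\<integral>\<^sup>+x. ennreal \<theta> * (f x * ennreal (1 / X)) + ennreal (1 - \<theta>) * (g x * ennreal (1 / Y)) \<partial>M)"
    by (intro nn_integral_mono Young_epowr \<theta>)
  also have "\<dots> = ennreal \<theta> * (?X * ennreal (1 / X)) + ennreal (1 - \<theta>) * (?Y * ennreal (1 / Y))"
    by (simp add: nn_integral_add nn_integral_cmult nn_integral_multc)
  also have "\<dots> = 1"
    using XY \<theta> by (simp add: ennreal_mult[symmetric] ennreal_plus[symmetric] del: ennreal_plus)
  finally show ?thesis
    using XY by (simp add: ennreal_mult mult_left_mono)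
qed

section \<open>Layer cake formula for powers\<close>

lemma nn_integral_powr_from_0:
  fixes a x :: real
  assumes "0 < a" "0 \<le> x"
  shows "(\<integral>\<^sup>+t. indicator {0<..<x} t * ennreal (a * t powr (a - 1)) \<partial>lborel) = ennreal (x powr a)"
proof -
  have "((\<lambda>t. a * t powr (a - 1)) has_integral (a * (x powr (a - 1 + 1) / (a - 1 + 1)))) {0..x}"
    using assms by (intro has_integral_mult_right has_integral_powr_from_0) auto
  then have "((\<lambda>t. a * t powr (a - 1)) has_integral x powr a) {0..x}"
    using assms by simp
  then have "((\<lambda>t. a * t powr (a - 1)) has_integral x powr a) {0<..<x}"
    using has_integral_spike_set_eq[of "{0..x}" "{0<..<x}"]
    by (metis (no_types, lifting) box_real(1) cbox_interval has_integral_open_interval box_real(2))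
  then have "(\<integral>\<^sup>+t. indicator {0<..<x} t * (a * t powr (a - 1)) \<partial>lborel) = ennreal (x powr a)"
    using assms by (intro nn_integral_has_integral_lebesgue) auto
  moreover have "(\<integral>\<^sup>+t. indicator {0<..<x} t * (a * t powr (a - 1)) \<partial>lborel)
     = (\<integral>\<^sup>+t. indicator {0<..<x} t * ennreal (a * t powr (a - 1)) \<partial>lborel)"
    using assms by (intro nn_integral_cong) (auto split: split_indicator)
  ultimately show ?thesis by simp
qed

text \<open>The layer cake formula at a single value: inserting a function for \<open>x\<close> and
  exchanging integrals turns integrals of powers into measures of level sets. For
  \<open>x = top\<close> the integral dominates \<open>N powr a\<close> for every
  \<open>N\<close>.\<close>

lemma epowr_eq_nn_integral:
  fixes x :: ennreal
  assumes "0 < a"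
  shows "x epowr a = (\<integral>\<^sup>+t. indicator {t. 0 < t \<and> ennreal t < x} t * ennreal (a * t powr (a - 1)) \<partial>lborel)"
proof (cases x rule: ennreal_cases)
  case (real r)
  then have "{t. 0 < t \<and> ennreal t < x} = {0<..<r}"
    by (auto simp: ennreal_less_iff)
  then show ?thesis
    using nn_integral_powr_from_0[of a r] assms real by simp
next
  case top
  have *: "ennreal (N powr a) \<le> (\<integral>\<^sup>+t. indicator {t. 0 < t \<and> ennreal t < top} t * ennreal (a * t powr (a - 1)) \<partial>lborel)"
    if "0 \<le> N" for N :: real
    unfolding nn_integral_powr_from_0[OF assms that, symmetric]
    by (intro nn_integral_mono) (auto split: split_indicator)
  have "of_nat n \<le> (\<integral>\<^sup>+t. indicator {t. 0 < t \<and> ennreal t < top} t * ennreal (a * t powr (a - 1)) \<partial>lborel)" for n :: nat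
    using *[of "real n powr (1 / a)"] assms by (simp add: powr_powr ennreal_of_nat_eq_real_of_nat)
  then have "(\<integral>\<^sup>+t. indicator {t. 0 < t \<and> ennreal t < top} t * ennreal (a * t powr (a - 1)) \<partial>lborel) = top"
    by (metis ennreal_Ex_less_of_nat linorder_not_le top.not_eq_extremum)
  with top show ?thesis by simp
qed

lemma nn_integral_powr_to_inf:
  fixes a x :: real
  assumes "1 < a" "0 < x"
  shows "(\<integral>\<^sup>+t. indicator {x..} t * ennreal (t powr (- a)) \<partial>lborel) = ennreal (x powr (1 - a) / (a - 1))"
proof -
  have "((\<lambda>t. t powr (- a)) has_integral -(x powr (- a + 1)) / (- a + 1)) {x..}"
    using assms by (intro has_integral_powr_to_inf) auto
  moreover have "-(x powr (- a + 1)) / (- a + 1) = x powr (1 - a) / (a - 1)"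
    using assms by (simp add: field_simps)
  ultimately have "((\<lambda>t. t powr (- a)) has_integral x powr (1 - a) / (a - 1)) {x..}"
    by simp
  then have "(\<integral>\<^sup>+t. indicator {x..} t * (t powr (- a)) \<partial>lborel) = ennreal (x powr (1 - a) / (a - 1))"
    by (intro nn_integral_has_integral_lebesgue) auto
  moreover have "(\<integral>\<^sup>+t. indicator {x..} t * (t powr (- a)) \<partial>lborel)
     = (\<integral>\<^sup>+t. indicator {x..} t * ennreal (t powr (- a)) \<partial>lborel)"
    by (intro nn_integral_cong) (auto split: split_indicator)
  ultimately show ?thesis by simp
qed

section \<open>Weak type bounds for positive kernels\<close>

text \<open>By the layer cake formula the integral over \<open>S\<close> is at most the integral
  over \<open>t\<close> of the minimum of \<open>m\<close> and
  \<open>(\<omega> / t) powr \<rho>\<close>; \<open>\<rho> > 1\<close> makes the tail converge. This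
  is the weak norm tested against sets of finite measure, a form in which it passes through
  integrals.\<close>

lemma nn_integral_le_of_level_sets:
  fixes k :: "'z \<Rightarrow> ennreal" and \<omega> m \<rho> :: real
  assumes "sigma_finite_measure \<mu>" and [measurable]: "k \<in> borel_measurable \<mu>" "S \<in> sets \<mu>"
    and \<rho>: "1 < \<rho>" and \<omega>: "0 < \<omega>" and m: "0 < m" "emeasure \<mu> S = ennreal m"
    and lev: "\<And>t. 0 < t \<Longrightarrow> emeasure \<mu> {z \<in> space \<mu>. ennreal t < k z} \<le> ennreal ((\<omega> / t) powr \<rho>)"
  shows "(\<integral>\<^sup>+z. indicator S z * k z \<partial>\<mu>) \<le> ennreal (\<rho> / (\<rho> - 1) * \<omega> * m powr (1 - 1 / \<rho>))"
proof -
  interpret sigma_finite_measure \<mu> by fact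
  interpret P: pair_sigma_finite \<mu> "lborel :: real measure" ..
  \<comment> \<open>The level at which the two bounds \<open>m\<close> and
    \<open>(\<omega> / t) powr \<rho>\<close> agree.\<close>
  define \<tau> where "\<tau> = \<omega> * m powr (- 1 / \<rho>)"
  have \<tau>: "0 < \<tau>" using \<omega> m by (simp add: \<tau>_def)
  have "(\<integral>\<^sup>+z. indicator S z * k z \<partial>\<mu>)
    = (\<integral>\<^sup>+z. (\<integral>\<^sup>+t. indicator S z * indicator {t. 0 < t \<and> ennreal t < k z} t \<partial>lborel) \<partial>\<mu>)"
  proof (intro nn_integral_cong, goal_cases)
    case (1 z)
    have "k z = (\<integral>\<^sup>+t. indicator {t. 0 < t \<and> ennreal t < k z} t * ennreal (1 * t powr (1 - 1)) \<partial>lborel)"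
      using epowr_eq_nn_integral[of 1 "k z"] by simp
    also have "\<dots> = (\<integral>\<^sup>+t. indicator {t. 0 < t \<and> ennreal t < k z} t \<partial>lborel)"
      by (intro nn_integral_cong) (auto split: split_indicator)
    finally show ?case by (subst nn_integral_cmult) auto
  qed
  also have "\<dots> = (\<integral>\<^sup>+t. (\<integral>\<^sup>+z. indicator S z * indicator {t. 0 < t \<and> ennreal t < k z} t \<partial>\<mu>) \<partial>lborel)"
    by (intro P.Fubini'[symmetric]) (simp add: case_prod_beta, measurable)
  also have "\<dots> \<le> (\<integral>\<^sup>+t. indicator {0<..<\<tau>} t * ennreal (m * t powr (1 - 1)) +
       ennreal (\<omega> powr \<rho>) * (indicator {\<tau>..} t * ennreal (t powr (- \<rho>))) \<partial>lborel)"
  proof (intro nn_integral_mono, goal_cases)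
    case (1 t)
    show ?case
    proof (cases "0 < t")
      case False
      then show ?thesis by simp
    next
      case True
      have "(\<integral>\<^sup>+z. indicator S z * indicator {t. 0 < t \<and> ennreal t < k z} t \<partial>\<mu>) \<le> (\<integral>\<^sup>+z. indicator S z \<partial>\<mu>)"
        by (intro nn_integral_mono) (auto split: split_indicator)
      then have 1: "(\<integral>\<^sup>+z. indicator S z * indicator {t. 0 < t \<and> ennreal t < k z} t \<partial>\<mu>) \<le> ennreal m"
        using m by simp
      have "(\<integral>\<^sup>+z. indicator S z * indicator {t. 0 < t \<and> ennreal t < k z} t \<partial>\<mu>)
        \<le> (\<integral>\<^sup>+z. indicator {z \<in> space \<mu>. ennreal t < k z} z \<partial>\<mu>)"
        by (intro nn_integral_mono) (auto split: split_indicator)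
      also have "\<dots> = emeasure \<mu> {z \<in> space \<mu>. ennreal t < k z}"
        by (intro nn_integral_indicator) measurable
      also have "\<dots> \<le> ennreal ((\<omega> / t) powr \<rho>)"
        using lev[OF True] .
      also have "\<dots> = ennreal (\<omega> powr \<rho>) * ennreal (t powr (- \<rho>))"
        using True \<omega> by (simp add: powr_divide powr_minus field_simps ennreal_mult[symmetric])
      finally show ?thesis
        using 1 True by (auto split: split_indicator)
    qed
  qed
  also have "\<dots> = (\<integral>\<^sup>+t. indicator {0<..<\<tau>} t * ennreal (m * t powr (1 - 1)) \<partial>lborel) +
       ennreal (\<omega> powr \<rho>) * (\<integral>\<^sup>+t. indicator {\<tau>..} t * ennreal (t powr (- \<rho>)) \<partial>lborel)"
    by (subst nn_integral_add) (auto simp: nn_integral_cmult)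
  also have "(\<integral>\<^sup>+t. indicator {0<..<\<tau>} t * ennreal (m * t powr (1 - 1)) \<partial>lborel)
      = (\<integral>\<^sup>+t. ennreal m * (indicator {0<..<\<tau>} t * ennreal (1 * t powr (1 - 1))) \<partial>lborel)"
    using m by (intro nn_integral_cong) (auto split: split_indicator)
  also have "\<dots> = ennreal m * ennreal (\<tau> powr 1)"
    using nn_integral_powr_from_0[of 1 \<tau>] \<tau> by (subst nn_integral_cmult) auto
  also have "ennreal m * ennreal (\<tau> powr 1) + 
     ennreal (\<omega> powr \<rho>) * (\<integral>\<^sup>+t. indicator {\<tau>..} t * ennreal (t powr (- \<rho>)) \<partial>lborel)
     = ennreal (m * \<tau> + \<omega> powr \<rho> * (\<tau> powr (1 - \<rho>) / (\<rho> - 1)))"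
    using \<rho> \<tau> m by (simp add: nn_integral_powr_to_inf ennreal_mult[symmetric] ennreal_plus[symmetric] del: ennreal_plus)
  also have "m * \<tau> + \<omega> powr \<rho> * (\<tau> powr (1 - \<rho>) / (\<rho> - 1)) = \<rho> / (\<rho> - 1) * \<omega> * m powr (1 - 1 / \<rho>)"
  proof -
    have 1: "m * \<tau> = \<omega> * m powr (1 - 1 / \<rho>)"
      using m by (simp add: \<tau>_def powr_diff powr_minus field_simps)
    have "(m powr (- 1 / \<rho>)) powr (1 - \<rho>) = m powr (1 - 1 / \<rho>)"
    proof -
      have "- 1 / \<rho> * (1 - \<rho>) = 1 - 1 / \<rho>"
        using \<rho> by (simp add: field_simps)
      then show ?thesis by (simp only: powr_powr)
    qed
    then have "\<omega> powr \<rho> * \<tau> powr (1 - \<rho>) = \<omega> powr \<rho> * \<omega> powr (1 - \<rho>) * m powr (1 - 1 / \<rho>)"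
      using \<omega> m by (simp add: \<tau>_def powr_mult)
    also have "\<omega> powr \<rho> * \<omega> powr (1 - \<rho>) = \<omega>"
      using \<omega> by (simp flip: powr_add)
    finally show ?thesis using 1 \<rho> by (simp add: field_simps)
  qed
  finally show ?thesis .
qed

text \<open>Off-diagonal target exponents \<open>\<rho> > 1\<close> make weak \<open>L\<^sup>\<rho>\<close> normable, so it suffices
  to bound the weak norm of each slice of the kernel.\<close>

lemma weak_type_kernel:
  fixes k :: "'z \<Rightarrow> 'y \<Rightarrow> ennreal" and \<omega> :: "'y \<Rightarrow> real"
  assumes sf: "sigma_finite_measure \<mu>" "sigma_finite_measure M"
    and k [measurable]: "(\<lambda>(z, y). k z y) \<in> borel_measurable (\<mu> \<Otimes>\<^sub>M M)"
    and f [measurable]: "f \<in> borel_measurable M" and \<omega> [measurable]: "\<omega> \<in> borel_measurable M"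
    and \<omega>_pos: "\<And>y. 0 < \<omega> y" and \<rho>: "1 < \<rho>" and t: "0 < t"
    and lev: "AE y in M. \<forall>t>0. emeasure \<mu> {z \<in> space \<mu>. ennreal t < k z y} \<le> ennreal ((\<omega> y / t) powr \<rho>)"
  shows "ennreal t * (emeasure \<mu> {z \<in> space \<mu>. ennreal t < (\<integral>\<^sup>+y. k z y * f y \<partial>M)}) epowr (1 / \<rho>)
           \<le> ennreal (\<rho> / (\<rho> - 1)) * (\<integral>\<^sup>+y. f y * ennreal (\<omega> y) \<partial>M)" (is "_ * emeasure \<mu> ?W epowr _ \<le> ?R")
proof -
  interpret \<mu>: sigma_finite_measure \<mu> by fact
  interpret M: sigma_finite_measure M by fact
  interpret P: pair_sigma_finite \<mu> M ..
  have [measurable]: "?W \<in> sets \<mu>" by measurable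
  \<comment> \<open>Kolmogorov's argument: integrating over a subset of the level set of finite
    measure \<open>m\<close> bounds \<open>t * m\<close> by \<open>m powr (1 - 1 / \<rho>)\<close>
    times the right-hand side, and this power can be divided out because \<open>m\<close> is finite
    and positive.\<close>
  have fin: "ennreal t * ennreal (m powr (1 / \<rho>)) \<le> ?R"
    if S [measurable]: "S \<in> sets \<mu>" and SW: "S \<subseteq> ?W" and m: "emeasure \<mu> S = ennreal m" "0 < m" for S m
  proof -
    have "ennreal t * ennreal m = (\<integral>\<^sup>+z. ennreal t * indicator S z \<partial>\<mu>)"
      using m by (subst nn_integral_cmult_indicator) auto
    also have "\<dots> \<le> (\<integral>\<^sup>+z. (\<integral>\<^sup>+y. indicator S z * (k z y * f y) \<partial>M) \<partial>\<mu>)"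
      using SW by (intro nn_integral_mono) (auto split: split_indicator)
    also have "\<dots> = (\<integral>\<^sup>+y. (\<integral>\<^sup>+z. indicator S z * (k z y * f y) \<partial>\<mu>) \<partial>M)"
      by (intro P.Fubini'[symmetric]) (simp add: case_prod_beta, measurable)
    also have "\<dots> \<le> (\<integral>\<^sup>+y. ennreal (\<rho> / (\<rho> - 1) * m powr (1 - 1 / \<rho>)) * (f y * ennreal (\<omega> y)) \<partial>M)"
    proof (rule nn_integral_mono_AE)
      show "AE y in M. (\<integral>\<^sup>+z. indicator S z * (k z y * f y) \<partial>\<mu>)
        \<le> ennreal (\<rho> / (\<rho> - 1) * m powr (1 - 1 / \<rho>)) * (f y * ennreal (\<omega> y))"
        using lev AE_space
      proof eventually_elim
        case (elim y)
        then have [measurable]: "(\<lambda>z. k z y) \<in> borel_measurable \<mu>"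
          using measurable_Pair1[OF k, of y] by simp
        have "(\<integral>\<^sup>+z. indicator S z * (k z y * f y) \<partial>\<mu>) = (\<integral>\<^sup>+z. indicator S z * k z y * f y \<partial>\<mu>)"
          by (simp add: mult.assoc)
        also have "\<dots> = (\<integral>\<^sup>+z. indicator S z * k z y \<partial>\<mu>) * f y"
          by (intro nn_integral_multc) measurable
        also have "\<dots> \<le> ennreal (\<rho> / (\<rho> - 1) * \<omega> y * m powr (1 - 1 / \<rho>)) * f y"
          using elim m \<omega>_pos[of y]
          by (intro mult_right_mono nn_integral_le_of_level_sets[OF sf(1) _ _ \<rho>]) auto
        also have "\<dots> = ennreal (\<rho> / (\<rho> - 1) * m powr (1 - 1 / \<rho>)) * (f y * ennreal (\<omega> y))"
        proof -
          have "ennreal (\<rho> / (\<rho> - 1) * \<omega> y * m powr (1 - 1 / \<rho>))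
             = ennreal (\<rho> / (\<rho> - 1) * m powr (1 - 1 / \<rho>)) * ennreal (\<omega> y)"
            using \<rho> \<omega>_pos[of y] by (subst ennreal_mult[symmetric]) (auto simp: ac_simps)
          then show ?thesis by (simp add: ac_simps)
        qed
        finally show ?case .
      qed
    qed
    also have "\<dots> = ennreal (\<rho> / (\<rho> - 1) * m powr (1 - 1 / \<rho>)) * (\<integral>\<^sup>+y. f y * ennreal (\<omega> y) \<partial>M)"
      by (intro nn_integral_cmult) measurable
    also have "\<dots> = ennreal (m powr (1 - 1 / \<rho>)) * ?R"
    proof -
      have "ennreal (\<rho> / (\<rho> - 1) * m powr (1 - 1 / \<rho>)) = ennreal (\<rho> / (\<rho> - 1)) * ennreal (m powr (1 - 1 / \<rho>))"
        using \<rho> by (intro ennreal_mult) auto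
      then show ?thesis by (simp only: ac_simps)
    qed
    finally have *: "ennreal t * ennreal m \<le> ennreal (m powr (1 - 1 / \<rho>)) * ?R" .
    have "ennreal t * ennreal (m powr (1 / \<rho>)) = ennreal (m powr (- (1 - 1 / \<rho>))) * (ennreal t * ennreal m)"
    proof -
      have "m powr (- (1 - 1 / \<rho>)) * m powr 1 = m powr (1 / \<rho>)"
        unfolding powr_add[symmetric] by simp
      then show ?thesis
        using m t by (simp add: ennreal_mult[symmetric] ac_simps)
    qed
    also have "\<dots> \<le> ennreal (m powr (- (1 - 1 / \<rho>))) * (ennreal (m powr (1 - 1 / \<rho>)) * ?R)"
      by (intro mult_left_mono *) auto
    also have "\<dots> = ennreal (m powr (- (1 - 1 / \<rho>)) * m powr (1 - 1 / \<rho>)) * ?R"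
      by (simp add: ennreal_mult ac_simps)
    also have "m powr (- (1 - 1 / \<rho>)) * m powr (1 - 1 / \<rho>) = 1"
      unfolding powr_add[symmetric] using m by simp
    finally show ?thesis by simp
  qed
  show ?thesis
  proof (cases "emeasure \<mu> ?W" rule: ennreal_cases)
    case (real m)
    then show ?thesis
      using fin[of ?W m] by (cases "m = 0") auto
  next
    case top
    have "?R = \<infinity>"
    proof (rule ccontr)
      assume "?R \<noteq> \<infinity>"
      then obtain R where R: "?R = ennreal R" "0 \<le> R"
        by (cases ?R rule: ennreal_cases) auto
      \<comment> \<open>Sigma-finiteness provides a subset of finite measure so large that
        \<open>fin\<close> would force \<open>R + 1 \<le> R\<close>.\<close>
      obtain Z where Z: "Z \<in> sets \<mu>" "Z \<subseteq> ?W" "emeasure \<mu> Z < \<infinity>" "emeasure \<mu> Z > ennreal (((R + 1) / t) powr \<rho>)"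
        using \<mu>.approx_PInf_emeasure_with_finite[of ?W "((R + 1) / t) powr \<rho>"] top by auto
      then obtain m where m: "emeasure \<mu> Z = ennreal m" "0 \<le> m"
        by (cases "emeasure \<mu> Z" rule: ennreal_cases) auto
      with Z have m': "((R + 1) / t) powr \<rho> < m"
        by (simp add: ennreal_less_iff)
      then have "0 < m" by (smt (verit) powr_ge_zero)
      with fin[OF Z(1,2) m(1)] R t have "t * m powr (1 / \<rho>) \<le> R"
        by (simp add: ennreal_mult[symmetric])
      moreover have "(((R + 1) / t) powr \<rho>) powr (1 / \<rho>) \<le> m powr (1 / \<rho>)"
        using m' \<rho> by (intro powr_mono2) auto
      ultimately show False
        using R t \<rho> by (simp add: powr_powr field_simps)
    qed
    then show ?thesis by simp
  qed
qed

text \<open>Marcinkiewicz interpolation between the trivial \<open>L\<^sup>\<infinity>\<close> bound for averages and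
  their weak type \<open>(1, \<rho>)\<close> bound.\<close>

lemma averages_embedding:
  fixes E :: "'z \<Rightarrow> 'y \<Rightarrow> bool" and m :: "'z \<Rightarrow> real" and f :: "'y \<Rightarrow> real"
  assumes sf: "sigma_finite_measure N" "sigma_finite_measure M"
    and E [measurable]: "Measurable.pred (N \<Otimes>\<^sub>M M) (\<lambda>(z, y). E z y)"
    and m [measurable]: "m \<in> borel_measurable N" and m_pos: "\<And>z. 0 < m z"
    and f [measurable]: "f \<in> borel_measurable M" and f_nonneg: "\<And>y. 0 \<le> f y"
    and p: "1 < p" and \<rho>: "1 < \<rho>" and C: "0 < C"
    and slice: "\<And>z. z \<in> space N \<Longrightarrow> emeasure M {y \<in> space M. E z y} \<le> ennreal (m z)"
    and geom: "\<And>y s. y \<in> space M \<Longrightarrow> 0 < s \<Longrightarrow>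
      (\<integral>\<^sup>+z. indicator {z. E z y \<and> m z < s} z * ennreal (m z powr \<rho>) \<partial>N) \<le> ennreal ((C * s) powr \<rho>)"
  defines "C' \<equiv> \<rho> * p / (p - 1) * (2 * C * \<rho> / (\<rho> - 1)) powr \<rho> * 2 powr ((p - 1) * \<rho>)"
  shows "(\<integral>\<^sup>+z. ennreal (m z powr \<rho>) *
            ((\<integral>\<^sup>+y. indicator {y. E z y} y * ennreal (f y) \<partial>M) / ennreal (m z)) epowr (\<rho> * p) \<partial>N)
         \<le> ennreal C' * (\<integral>\<^sup>+y. ennreal (f y powr p) \<partial>M) epowr \<rho>"
proof (cases "(\<integral>\<^sup>+y. ennreal (f y powr p) \<partial>M)" rule: ennreal_cases)
  case top
  have "0 < C'" using C p \<rho> by (simp add: C'_def)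
  with top show ?thesis by (simp add: ennreal_mult_top)
next
  case (real X)
  interpret N: sigma_finite_measure N by fact
  interpret M: sigma_finite_measure M by fact
  \<comment> \<open>The factor \<open>m z powr \<rho>\<close> goes into the measure, so that the
    claim becomes a bound for the power \<open>\<rho> * p\<close> of the averages \<open>A f\<close>
    alone.\<close>
  define \<mu> where "\<mu> = density N (\<lambda>z. ennreal (m z powr \<rho>))"
  have \<mu>: "sigma_finite_measure \<mu>" unfolding \<mu>_def
    by (subst sigma_finite_measure.sigma_finite_iff_density_finite[OF sf(1)]) auto
  interpret \<mu>: sigma_finite_measure \<mu> by (rule \<mu>)
  have [simp, measurable_cong]: "sets \<mu> = sets N" "space \<mu> = space N"
    by (simp_all add: \<mu>_def)
  have E' [measurable]: "Measurable.pred (\<mu> \<Otimes>\<^sub>M M) (\<lambda>(z, y). E z y)"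
    using E by (simp cong: measurable_cong_sets sets_pair_measure_cong)
  have E1 [measurable]: "Measurable.pred M (E z)" if "z \<in> space N" for z
    using measurable_Pair2[OF E, of z] that by simp
  have E2 [measurable]: "Measurable.pred N (\<lambda>z. E z y)" if "y \<in> space M" for y
    using measurable_Pair1[OF E, of y] that by simp
  define A where "A g z = (\<integral>\<^sup>+y. indicator {y. E z y} y * ennreal (g y) \<partial>M) / ennreal (m z)" for g :: "'y \<Rightarrow> real" and z
  define k where "k z y = indicator {y. E z y} y / ennreal (m z)" for z y
  have [measurable]: "(\<lambda>(z, y). k z y) \<in> borel_measurable (\<mu> \<Otimes>\<^sub>M M)"
    unfolding k_def indicator_def mem_Collect_eq by measurable
  define K where "K = C * \<rho> / (\<rho> - 1)"
  have K: "0 < K" using C \<rho> by (simp add: K_def)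
  \<comment> \<open>The Marcinkiewicz cut at height \<open>t / 2\<close>: by \<open>slice\<close>
    the discarded part has averages at most \<open>t / 2\<close>, so \<open>A f z > t\<close> forces
    \<open>A (g t) z > t / 2\<close>.\<close>
  define g where "g t y = (if t / 2 < f y then f y else 0)" for t y
  define h where "h t = (\<integral>\<^sup>+y. ennreal (g t y) \<partial>M)" for t
  have g_meas [measurable]: "g t \<in> borel_measurable M" for t unfolding g_def by measurable
  have g2_meas [measurable]: "(\<lambda>(t, y). g t y) \<in> borel_measurable (lborel \<Otimes>\<^sub>M M)" unfolding g_def by measurable
  have h_meas [measurable]: "h \<in> borel_measurable lborel" unfolding h_def by measurable
  have A_meas: "A F \<in> borel_measurable \<mu>" if [measurable]: "F \<in> borel_measurable M" for F
    unfolding A_def indicator_def mem_Collect_eq by measurable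
  have A_eq: "A F z = (\<integral>\<^sup>+y. k z y * ennreal (F y) \<partial>M)" if [measurable]: "F \<in> borel_measurable M" and z: "z \<in> space N" for F z
  proof -
    have [measurable]: "Measurable.pred M (E z)" using z by (rule E1)
    have "(\<integral>\<^sup>+y. k z y * ennreal (F y) \<partial>M) = (\<integral>\<^sup>+y. (indicator {y. E z y} y * ennreal (F y)) / ennreal (m z) \<partial>M)"
      by (intro nn_integral_cong) (simp add: k_def divide_ennreal_def ac_simps)
    also have "\<dots> = A F z"
      unfolding A_def by (intro nn_integral_divide) (simp add: indicator_def)
    finally show ?thesis ..
  qed
  have weak: "emeasure \<mu> {z \<in> space N. ennreal t < A f z} \<le> (ennreal (2 * K / t) * h t) epowr \<rho>" if t: "0 < t" for t
  proof -
    have "{z \<in> space N. ennreal t < A f z} \<subseteq> {z \<in> space N. ennreal (t / 2) < A (g t) z}"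
    proof safe
      fix z assume z: "z \<in> space N" and less: "ennreal t < A f z"
      have [measurable]: "Measurable.pred M (E z)" using z by (rule E1)
      have "(\<integral>\<^sup>+y. indicator {y. E z y} y * ennreal (f y) \<partial>M)
        \<le> (\<integral>\<^sup>+y. indicator {y. E z y} y * ennreal (g t y) + ennreal (t / 2) * indicator {y \<in> space M. E z y} y \<partial>M)"
        using t by (intro nn_integral_mono) (auto simp: g_def split: split_indicator intro!: ennreal_leI)
      also have "\<dots> = (\<integral>\<^sup>+y. indicator {y. E z y} y * ennreal (g t y) \<partial>M) + ennreal (t / 2) * emeasure M {y \<in> space M. E z y}"
        using z by (subst nn_integral_add) (simp_all add: nn_integral_cmult_indicator indicator_def[of "{y. E z y}"])
      also have "\<dots> \<le> (\<integral>\<^sup>+y. indicator {y. E z y} y * ennreal (g t y) \<partial>M) + ennreal (t / 2) * ennreal (m z)"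
        by (intro add_left_mono mult_left_mono slice z) simp
      finally have "A f z \<le> ((\<integral>\<^sup>+y. indicator {y. E z y} y * ennreal (g t y) \<partial>M) + ennreal (t / 2) * ennreal (m z)) / ennreal (m z)"
        unfolding A_def by (rule divide_right_mono_ennreal)
      also have "\<dots> = A (g t) z + ennreal (t / 2)"
        using m_pos[of z] t by (simp add: A_def add_divide_distrib_ennreal ennreal_mult[symmetric] divide_ennreal)
      finally have le: "A f z \<le> A (g t) z + ennreal (t / 2)" .
      show "ennreal (t / 2) < A (g t) z"
      proof (rule ccontr)
        assume "\<not> ennreal (t / 2) < A (g t) z"
        then have "A f z \<le> ennreal (t / 2) + ennreal (t / 2)"
          using le by (meson add_right_mono linorder_not_le order_trans)
        with less t show False by (simp add: ennreal_plus[symmetric] del: ennreal_plus)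
      qed
    qed
    then have "emeasure \<mu> {z \<in> space N. ennreal t < A f z} \<le> emeasure \<mu> {z \<in> space N. ennreal (t / 2) < A (g t) z}"
      using A_meas[of "g t"] by (intro emeasure_mono) (auto simp: measurable_def intro!: borel_measurable_less[of "\<lambda>_. ennreal (t/2)"])
    also have "\<dots> = emeasure \<mu> {z \<in> space \<mu>. ennreal (t / 2) < (\<integral>\<^sup>+y. k z y * ennreal (g t y) \<partial>M)}"
      by (intro arg_cong[where f = "emeasure \<mu>"]) (auto simp: A_eq)
    finally have 1: "emeasure \<mu> {z \<in> space N. ennreal t < A f z}
       \<le> emeasure \<mu> {z \<in> space \<mu>. ennreal (t / 2) < (\<integral>\<^sup>+y. k z y * ennreal (g t y) \<partial>M)}" (is "?L \<le> ?B") .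
    have "ennreal (t / 2) * ?B epowr (1 / \<rho>) \<le> ennreal (\<rho> / (\<rho> - 1)) * (\<integral>\<^sup>+y. ennreal (g t y) * ennreal C \<partial>M)"
    proof (rule weak_type_kernel[OF \<mu> sf(2)])
      show "AE y in M. \<forall>t>0. emeasure \<mu> {z \<in> space \<mu>. ennreal t < k z y} \<le> ennreal ((C / t) powr \<rho>)"
      proof (rule AE_I2, intro allI impI)
        fix y and s :: real assume y: "y \<in> space M" and s: "0 < s"
        have [measurable]: "Measurable.pred N (\<lambda>z. E z y)" using y by (rule E2)
        \<comment> \<open>A slice of the kernel takes only the values 0 and \<open>1 / m z\<close>,
          so its level sets are exactly the sets that \<open>geom\<close> measures.\<close>
        have "{z \<in> space \<mu>. ennreal s < k z y} = {z \<in> space N. E z y \<and> m z < 1 / s}"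
          using s m_pos by (auto simp: k_def divide_ennreal[of 1, simplified] ennreal_less_iff field_simps split: split_indicator)
        then have "emeasure \<mu> {z \<in> space \<mu>. ennreal s < k z y} = emeasure \<mu> {z \<in> space N. E z y \<and> m z < 1 / s}"
          by simp
        also have "\<dots> = (\<integral>\<^sup>+z. indicator {z. E z y \<and> m z < 1 / s} z * ennreal (m z powr \<rho>) \<partial>N)"
          unfolding \<mu>_def by (subst emeasure_density) (auto intro!: nn_integral_cong split: split_indicator)
        also have "\<dots> \<le> ennreal ((C * (1 / s)) powr \<rho>)"
          using y s by (intro geom) auto
        finally show "emeasure \<mu> {z \<in> space \<mu>. ennreal s < k z y} \<le> ennreal ((C / s) powr \<rho>)" by simp
      qed
    qed (use C \<rho> t in auto)
    also have "\<dots> = ennreal K * h t"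
    proof -
      have "ennreal K = ennreal (\<rho> / (\<rho> - 1)) * ennreal C"
        using C \<rho> by (subst ennreal_mult[symmetric]) (auto simp: K_def ac_simps)
      moreover have "(\<integral>\<^sup>+y. ennreal (g t y) * ennreal C \<partial>M) = h t * ennreal C"
        unfolding h_def by (intro nn_integral_multc) measurable
      ultimately show ?thesis by (simp only: ac_simps)
    qed
    finally have "ennreal (t / 2) * ?B epowr (1 / \<rho>) \<le> ennreal K * h t" .
    then have "ennreal (2 / t) * (ennreal (t / 2) * ?B epowr (1 / \<rho>)) \<le> ennreal (2 / t) * (ennreal K * h t)"
      by (intro mult_left_mono) auto
    moreover have "ennreal (2 / t) * (ennreal (t / 2) * ?B epowr (1 / \<rho>)) = ?B epowr (1 / \<rho>)"
      using t by (simp add: mult.assoc[symmetric] ennreal_mult[symmetric])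
    moreover have "ennreal (2 / t) * (ennreal K * h t) = ennreal (2 * K / t) * h t"
      using t K by (simp add: mult.assoc[symmetric] ennreal_mult[symmetric])
    ultimately have "(?B epowr (1 / \<rho>)) epowr \<rho> \<le> (ennreal (2 * K / t) * h t) epowr \<rho>"
      using \<rho> by (intro epowr_mono) auto
    with 1 \<rho> show ?thesis by (simp add: epowr_epowr)
  qed
  have h_le: "h t \<le> ennreal ((t / 2) powr (1 - p) * X)" if t: "0 < t" for t
  proof -
    have "h t \<le> (\<integral>\<^sup>+y. ennreal ((t / 2) powr (1 - p)) * ennreal (f y powr p) \<partial>M)"
      unfolding h_def
    proof (intro nn_integral_mono, goal_cases)
      case (1 y)
      have "g t y \<le> (t / 2) powr (1 - p) * f y powr p"
      proof (cases "t / 2 < f y")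
        case True
        then have "f y powr (1 - p) \<le> (t / 2) powr (1 - p)"
          using t p by (intro powr_mono2') auto
        then have "f y powr (1 - p) * f y powr p \<le> (t / 2) powr (1 - p) * f y powr p"
          by (intro mult_right_mono) auto
        with True t show ?thesis by (simp add: g_def flip: powr_add)
      next
        case False
        then have "g t y = 0" by (simp add: g_def)
        then show ?thesis by simp
      qed
      then show ?case by (simp add: ennreal_mult[symmetric] ennreal_leI)
    qed
    also have "\<dots> = ennreal ((t / 2) powr (1 - p) * X)"
      using real by (subst nn_integral_cmult) (auto simp: ennreal_mult)
    finally show ?thesis .
  qed
  define r where "r = \<rho> * p"
  define D where "D = r * (2 * K) powr \<rho> * 2 powr ((p - 1) * (\<rho> - 1)) * X powr (\<rho> - 1)"
  have r: "0 < r" using p \<rho> by (simp add: r_def)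
  have Xnn: "0 \<le> X" using real by simp
  have D: "0 \<le> D" using r by (simp add: D_def)
  interpret P: pair_sigma_finite \<mu> "lborel :: real measure" ..
  interpret PM: pair_sigma_finite M "lborel :: real measure" ..
  have [measurable]: "A f \<in> borel_measurable \<mu>" by (rule A_meas) simp
  have "(\<integral>\<^sup>+z. ennreal (m z powr \<rho>) * A f z epowr r \<partial>N) = (\<integral>\<^sup>+z. A f z epowr r \<partial>\<mu>)"
    unfolding \<mu>_def by (subst nn_integral_density) (auto simp: A_def, measurable)
  also have "\<dots> = (\<integral>\<^sup>+z. (\<integral>\<^sup>+t. indicator {t. 0 < t \<and> ennreal t < A f z} t * ennreal (r * t powr (r - 1)) \<partial>lborel) \<partial>\<mu>)"
    by (simp add: epowr_eq_nn_integral[OF r])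
  also have "\<dots> = (\<integral>\<^sup>+t. (\<integral>\<^sup>+z. indicator {t. 0 < t \<and> ennreal t < A f z} t * ennreal (r * t powr (r - 1)) \<partial>\<mu>) \<partial>lborel)"
    by (intro P.Fubini'[symmetric]) (simp add: case_prod_beta indicator_def, measurable)
  also have "\<dots> \<le> (\<integral>\<^sup>+t. ennreal D * (indicator {0<..} t * ennreal (t powr (p - 2)) * h t) \<partial>lborel)"
  proof (intro nn_integral_mono, goal_cases)
    case (1 t)
    show ?case
    proof (cases "0 < t")
      case t: True
      have "(\<integral>\<^sup>+z. indicator {t. 0 < t \<and> ennreal t < A f z} t * ennreal (r * t powr (r - 1)) \<partial>\<mu>)
        = (\<integral>\<^sup>+z. ennreal (r * t powr (r - 1)) * indicator {z \<in> space N. ennreal t < A f z} z \<partial>\<mu>)"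
        using t by (intro nn_integral_cong) (auto split: split_indicator)
      also have "\<dots> = ennreal (r * t powr (r - 1)) * emeasure \<mu> {z \<in> space N. ennreal t < A f z}"
      proof (rule nn_integral_cmult_indicator)
        have "{z \<in> space \<mu>. ennreal t < A f z} \<in> sets \<mu>" by measurable
        then show "{z \<in> space N. ennreal t < A f z} \<in> sets \<mu>" by simp
      qed
      also have "\<dots> \<le> ennreal (r * t powr (r - 1)) * (ennreal (2 * K / t) * h t) epowr \<rho>"
        by (intro mult_left_mono weak t) simp
      also have "(ennreal (2 * K / t) * h t) epowr \<rho> = ennreal ((2 * K / t) powr \<rho>) * (h t * h t epowr (\<rho> - 1))"
        using K t epowr_add[of "h t" 1 "\<rho> - 1"] by (simp add: epowr_mult)
      \<comment> \<open>One factor \<open>h t\<close> is kept for Tonelli's theorem. The remaining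
        power \<open>\<rho> - 1\<close> is paid for by the norm of \<open>f\<close>, which is how
        \<open>X powr \<rho>\<close> arises in the end.\<close>
      also have "h t * h t epowr (\<rho> - 1) \<le> h t * ennreal (((t / 2) powr (1 - p) * X) powr (\<rho> - 1))"
      proof (rule mult_left_mono)
        have "h t epowr (\<rho> - 1) \<le> ennreal ((t / 2) powr (1 - p) * X) epowr (\<rho> - 1)"
          using \<rho> by (intro epowr_mono h_le t) auto
        then show "h t epowr (\<rho> - 1) \<le> ennreal (((t / 2) powr (1 - p) * X) powr (\<rho> - 1))"
          using Xnn by simp
      qed simp
      also have "ennreal (r * t powr (r - 1)) * (ennreal ((2 * K / t) powr \<rho>) * (h t * ennreal (((t / 2) powr (1 - p) * X) powr (\<rho> - 1))))
        = ennreal (r * t powr (r - 1) * (2 * K / t) powr \<rho> * ((t / 2) powr (1 - p) * X) powr (\<rho> - 1)) * h t"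
        using r by (simp add: ennreal_mult ac_simps)
      also have "r * t powr (r - 1) * (2 * K / t) powr \<rho> * ((t / 2) powr (1 - p) * X) powr (\<rho> - 1) = D * t powr (p - 2)"
      proof -
        have 1: "(2 * K / t) powr \<rho> = (2 * K) powr \<rho> * t powr (- \<rho>)"
          using K t by (simp add: powr_divide powr_minus field_simps)
        have 2: "(t / 2) powr ((1 - p) * (\<rho> - 1)) = t powr ((1 - p) * (\<rho> - 1)) * 2 powr ((p - 1) * (\<rho> - 1))"
        proof -
          have "(p - 1) * (\<rho> - 1) = - ((1 - p) * (\<rho> - 1))" by (simp add: algebra_simps)
          then show ?thesis
            using t by (simp only: powr_minus) (simp add: powr_divide field_simps)
        qed
        have 3: "((t / 2) powr (1 - p) * X) powr (\<rho> - 1) = (t / 2) powr ((1 - p) * (\<rho> - 1)) * X powr (\<rho> - 1)"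
          using Xnn by (simp add: powr_mult powr_powr)
        have "t powr (r - 1) * t powr (- \<rho>) * t powr ((1 - p) * (\<rho> - 1)) = t powr (p - 2)"
          unfolding powr_add[symmetric] by (simp add: r_def algebra_simps)
        then show ?thesis
          unfolding 1 2 3 D_def by (simp add: ac_simps)
      qed
      finally show ?thesis
        using t D by (simp add: ennreal_mult mult.assoc mult_left_mono)
    qed simp
  qed
  also have "\<dots> = ennreal D * (\<integral>\<^sup>+t. indicator {0<..} t * ennreal (t powr (p - 2)) * h t \<partial>lborel)"
    by (intro nn_integral_cmult) measurable
  also have "(\<integral>\<^sup>+t. indicator {0<..} t * ennreal (t powr (p - 2)) * h t \<partial>lborel)
     = (\<integral>\<^sup>+t. (\<integral>\<^sup>+y. indicator {0<..} t * ennreal (t powr (p - 2)) * ennreal (g t y) \<partial>M) \<partial>lborel)"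
    by (simp add: h_def nn_integral_cmult)
  also have "\<dots> = (\<integral>\<^sup>+y. (\<integral>\<^sup>+t. indicator {0<..} t * ennreal (t powr (p - 2)) * ennreal (g t y) \<partial>lborel) \<partial>M)"
    unfolding g_def by (intro PM.Fubini') (simp add: case_prod_beta indicator_def, measurable)
  also have "\<dots> = (\<integral>\<^sup>+y. ennreal (2 powr (p - 1) / (p - 1)) * ennreal (f y powr p) \<partial>M)"
  \<comment> \<open>For fixed \<open>y\<close> only \<open>t < 2 * f y\<close> contributes, and
    \<open>p > 1\<close> makes \<open>t powr (p - 2)\<close> integrable at 0.\<close>
  proof (intro nn_integral_cong, goal_cases)
    case (1 y)
    have "(\<integral>\<^sup>+t. indicator {0<..} t * ennreal (t powr (p - 2)) * ennreal (g t y) \<partial>lborel)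
      = (\<integral>\<^sup>+t. ennreal (f y / (p - 1)) * (indicator {0<..<2 * f y} t * ennreal ((p - 1) * t powr (p - 1 - 1))) \<partial>lborel)"
      using p f_nonneg[of y] by (intro nn_integral_cong)
        (auto simp: g_def ennreal_mult[symmetric] split: split_indicator)
    also have "\<dots> = ennreal (f y / (p - 1)) * ennreal ((2 * f y) powr (p - 1))"
      using p f_nonneg[of y] nn_integral_powr_from_0[of "p - 1" "2 * f y"]
      by (subst nn_integral_cmult) auto
    also have "\<dots> = ennreal (f y / (p - 1) * (2 * f y) powr (p - 1))"
      using p f_nonneg[of y] by (subst ennreal_mult[symmetric]) auto
    also have "f y / (p - 1) * (2 * f y) powr (p - 1) = 2 powr (p - 1) / (p - 1) * (f y powr p)"
      using powr_add[of "f y" 1 "p - 1"] f_nonneg[of y] p by (simp add: powr_mult)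
    finally show ?case
      using p by (subst ennreal_mult[symmetric]) auto
  qed
  also have "\<dots> = ennreal (2 powr (p - 1) / (p - 1)) * ennreal X"
    using real by (subst nn_integral_cmult) auto
  also have "ennreal D * (ennreal (2 powr (p - 1) / (p - 1)) * ennreal X) = ennreal (D * (2 powr (p - 1) / (p - 1) * X))"
    using D p Xnn by (simp add: ennreal_mult[symmetric])
  also have "D * (2 powr (p - 1) / (p - 1) * X) = C' * X powr \<rho>"
  proof -
    have "X powr (\<rho> - 1) * X = X powr \<rho>"
      using powr_add[of X "\<rho> - 1" 1] Xnn by simp
    moreover have "2 powr ((p - 1) * (\<rho> - 1)) * 2 powr (p - 1) = (2::real) powr ((p - 1) * \<rho>)"
      unfolding powr_add[symmetric] by (simp add: algebra_simps)
    moreover have "D * (2 powr (p - 1) / (p - 1) * X) = r / (p - 1) * (2 * K) powr \<rho>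
        * (2 powr ((p - 1) * (\<rho> - 1)) * 2 powr (p - 1)) * (X powr (\<rho> - 1) * X)"
      by (simp add: D_def)
    ultimately show ?thesis by (simp add: C'_def K_def r_def mult.assoc)
  qed
  also have "ennreal (C' * X powr \<rho>) = ennreal C' * ennreal (X powr \<rho>)"
    using C p \<rho> by (intro ennreal_mult) (auto simp: C'_def)
  finally show ?thesis
    using real Xnn unfolding A_def r_def by simp
qed

section \<open>Pairs of weights in balance on balls\<close>

lemma powr_of_power: "0 \<le> x \<Longrightarrow> (x ^ n) powr c = (x powr c) ^ n" for x c :: real
  by (induction n) (auto simp: powr_mult)

lemma ball_in_sets_borel [measurable]: "ball c r \<in> sets borel"
  by simp

lemma emeasure_density_ball_pos:
  fixes v :: "'a::euclidean_space \<Rightarrow> real"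
  assumes [measurable]: "v \<in> borel_measurable borel" and v_pos: "\<And>x. 0 < v x" and r: "0 < r"
  shows "0 < emeasure (density lborel (\<lambda>x. ennreal (v x))) (ball c r)"
proof (rule ccontr)
  assume "\<not> 0 < emeasure (density lborel (\<lambda>x. ennreal (v x))) (ball c r)"
  then have "(\<integral>\<^sup>+x\<in>ball c r. ennreal (v x) \<partial>lborel) = 0"
    by (simp add: emeasure_density)
  then have "AE x in lborel. ennreal (v x) * indicator (ball c r) x = 0"
    by (subst (asm) nn_integral_0_iff_AE) auto
  then have "AE x in lborel. x \<notin> ball c r"
  proof eventually_elim
    case (elim x)
    then show ?case using v_pos[of x] by (auto split: split_indicator_asm)
  qed
  then have "emeasure lborel (ball c r) = 0"
    by (subst (asm) AE_iff_measurable[of "ball c r"]) auto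
  moreover have "0 < emeasure lborel (ball c r)"
    using r by (simp add: emeasure_ball)
  ultimately show False by simp
qed

text \<open>The assumptions are symmetric under exchanging \<open>(u, a)\<close> with
  \<open>(s, b)\<close>, so every result about \<open>u\<close> is available for \<open>s\<close> as
  well. There are two instances, both built from a Borel version of \<open>w\<close>:
  \<open>w powr q\<close> and \<open>w powr (- (p / (p - 1)))\<close> with exponents
  \<open>1 / q\<close> and \<open>1 - 1 / p\<close>, and at the endpoint \<open>w powr q\<close> and
  \<open>1 / w\<close> with exponents \<open>1 / q\<close> and 1.\<close>

locale dual_weights =
  fixes u s :: "'a::euclidean_space \<Rightarrow> real" and a b C0 :: real
  assumes u_meas [measurable]: "u \<in> borel_measurable borel" and s_meas [measurable]: "s \<in> borel_measurable borel"
    and u_pos: "0 < u x" and s_pos: "0 < s x" and a_pos: "0 < a" and b_pos: "0 < b"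
    and dual: "u x powr a * s x powr b = 1"
    and u_finite: "emeasure (density lborel (\<lambda>x. ennreal (u x))) (ball c r) < top"
    and s_finite: "emeasure (density lborel (\<lambda>x. ennreal (s x))) (ball c r) < top"
    and balanced: "0 < r \<Longrightarrow> measure (density lborel (\<lambda>x. ennreal (u x))) (ball c r) powr a *
        measure (density lborel (\<lambda>x. ennreal (s x))) (ball c r) powr b \<le> C0 * r powr (DIM('a) * (a + b))"
begin

abbreviation Mu :: "'a measure" where "Mu \<equiv> density lborel (\<lambda>x. ennreal (u x))"
abbreviation Ms :: "'a measure" where "Ms \<equiv> density lborel (\<lambda>x. ennreal (s x))"

definition U :: "'a \<Rightarrow> real \<Rightarrow> real" where "U c r = measure Mu (ball c r)"

lemma dual_weights_sym: "dual_weights s u b a C0"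
  using u_pos s_pos a_pos b_pos dual u_finite s_finite balanced
  by unfold_locales (auto simp: mult.commute add.commute)

lemma emeasure_u_finite: "E \<subseteq> ball c r \<Longrightarrow> emeasure Mu E < top"
  using emeasure_mono[of E "ball c r" Mu] u_finite[of c r] by (simp add: order_le_less_trans)

lemma emeasure_s_finite: "E \<subseteq> ball c r \<Longrightarrow> emeasure Ms E < top"
  using emeasure_mono[of E "ball c r" Ms] s_finite[of c r] by (simp add: order_le_less_trans)

lemma emeasure_u_ball: "emeasure Mu (ball c r) = ennreal (U c r)"
  unfolding U_def using u_finite[of c r] by (simp add: emeasure_eq_ennreal_measure)

lemma emeasure_s_ball: "emeasure Ms (ball c r) = ennreal (dual_weights.U s c r)"
  using dual_weights.emeasure_u_ball[OF dual_weights_sym] .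

text \<open>Hoelder's inequality for the constant function
  \<open>1 = (u x powr a * s x powr b) powr (1 / (a + b))\<close>. It is the converse of
  \<open>balanced\<close>, but for all Borel subsets of a ball.\<close>

lemma lebesgue_powr_le:
  assumes E [measurable]: "E \<in> sets borel" and sub: "E \<subseteq> ball c r"
  shows "measure lborel E powr (a + b) \<le> measure Mu E powr a * measure Ms E powr b"
proof -
  define \<theta> where "\<theta> = a / (a + b)"
  have \<theta>: "0 < \<theta>" "\<theta> < 1" "1 - \<theta> = b / (a + b)"
    using a_pos b_pos by (auto simp: \<theta>_def field_simps)
  have fin: "emeasure lborel E < top"
    using emeasure_mono[OF sub, of lborel] emeasure_lborel_ball_finite[of c r] by (simp add: order_le_less_trans)
  have "emeasure lborel E = (\<integral>\<^sup>+x. indicator E x \<partial>lborel)"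
    by simp
  also have "\<dots> = (\<integral>\<^sup>+x. (ennreal (u x) * indicator E x) epowr \<theta> * (ennreal (s x) * indicator E x) epowr (1 - \<theta>) \<partial>lborel)"
  proof (intro nn_integral_cong, goal_cases)
    case (1 x)
    have "u x powr \<theta> * s x powr (1 - \<theta>) = (u x powr a * s x powr b) powr (1 / (a + b))"
      using u_pos[of x] s_pos[of x] by (simp add: powr_mult powr_powr \<theta>(3)) (simp add: \<theta>_def)
    then have "u x powr \<theta> * s x powr (1 - \<theta>) = 1"
      by (simp add: dual)
    then show ?case
      using u_pos[of x] s_pos[of x] by (auto simp: less_imp_le ennreal_mult[symmetric] split: split_indicator)
  qed
  also have "\<dots> \<le> (\<integral>\<^sup>+x. ennreal (u x) * indicator E x \<partial>lborel) epowr \<theta> * (\<integral>\<^sup>+x. ennreal (s x) * indicator E x \<partial>lborel) epowr (1 - \<theta>)"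
    by (intro nn_integral_Hoelder \<theta>) auto
  also have "\<dots> = emeasure Mu E epowr \<theta> * emeasure Ms E epowr (1 - \<theta>)"
    by (simp add: emeasure_density)
  also have "\<dots> = ennreal (measure Mu E powr \<theta> * measure Ms E powr (1 - \<theta>))"
    using emeasure_u_finite[OF sub] emeasure_s_finite[OF sub]
    by (simp add: emeasure_eq_ennreal_measure ennreal_mult)
  finally have "measure lborel E \<le> measure Mu E powr \<theta> * measure Ms E powr (1 - \<theta>)"
    using fin by (simp add: emeasure_eq_ennreal_measure)
  then have "measure lborel E powr (a + b) \<le> (measure Mu E powr \<theta> * measure Ms E powr (1 - \<theta>)) powr (a + b)"
    using a_pos b_pos by (intro powr_mono2) auto
  also have "\<dots> = measure Mu E powr a * measure Ms E powr b"
    using a_pos b_pos by (simp add: powr_mult powr_powr \<theta>(3)) (simp add: \<theta>_def)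
  finally show ?thesis .
qed

section \<open>Doubling and reverse doubling of the masses of balls\<close>

lemma U_nonneg [simp]: "0 \<le> U c r"
  by (simp add: U_def)

lemma U_pos: "0 < r \<Longrightarrow> 0 < U c r"
proof (rule ccontr)
  assume r: "0 < r" and "\<not> 0 < U c r"
  then have "U c r = 0" using U_nonneg[of c r] by linarith
  then have "measure lborel (ball c r) powr (a + b) \<le> 0"
    using lebesgue_powr_le[of "ball c r" c r] a_pos by (simp add: U_def)
  moreover have "0 < measure lborel (ball c r)"
    using r by (simp add: content_ball_pos)
  ultimately show False by simp
qed

lemma U_mono: "ball c r \<subseteq> ball c' r' \<Longrightarrow> U c r \<le> U c' r'"
  unfolding U_def using emeasure_u_finite[of "ball c' r'" c' r']
  by (intro measure_mono_fmeasurable) (auto simp: fmeasurable_def)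

lemma C0_pos: "0 < C0"
proof -
  have "0 < U 0 1" "0 < dual_weights.U s 0 1"
    using U_pos[of 1 0] dual_weights.U_pos[OF dual_weights_sym, of 1 0] by auto
  then have "0 < U 0 1 powr a * dual_weights.U s 0 1 powr b" by simp
  also have "\<dots> \<le> C0"
    using balanced[of 1 0] by (simp add: U_def dual_weights.U_def[OF dual_weights_sym])
  finally show ?thesis .
qed

lemma balanced': "0 < r \<Longrightarrow> U c r powr a * dual_weights.U s c r powr b \<le> C0 * r powr (DIM('a) * (a + b))"
  using balanced[of r c] by (simp add: U_def dual_weights.U_def[OF dual_weights_sym])

text \<open>An A-infinity property. Compare \<open>lebesgue_powr_le\<close> on \<open>E\<close> with
  \<open>balanced\<close> on the ball: both contain the factor
  \<open>dual_weights.U s c r powr b\<close>, which cancels, and solving for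
  \<open>measure Mu E\<close> gives \<kappa>.\<close>

lemma fraction_of_ball:
  assumes \<delta>: "0 < \<delta>"
  shows "\<exists>\<kappa>>0. \<forall>c r. \<forall>E\<in>sets borel. 0 < r \<longrightarrow> E \<subseteq> ball c r \<longrightarrow> \<delta> * r powr DIM('a) \<le> measure lborel E \<longrightarrow>
    \<kappa> * U c r \<le> measure Mu E"
proof (intro exI[of _ "(\<delta> powr (a + b) / C0) powr (1 / a)"] conjI allI ballI impI)
  show "0 < (\<delta> powr (a + b) / C0) powr (1 / a)"
    using \<delta> C0_pos by simp
next
  fix c :: 'a and r :: real and E :: "'a set"
  assume E: "E \<in> sets borel" and r: "0 < r" and sub: "E \<subseteq> ball c r" and large: "\<delta> * r powr DIM('a) \<le> measure lborel E"
  let ?S = "dual_weights.U s c r"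
  have S: "0 < ?S" using dual_weights.U_pos[OF dual_weights_sym, of r c] r by simp
  have "\<delta> powr (a + b) * r powr (DIM('a) * (a + b)) = (\<delta> * r powr DIM('a)) powr (a + b)"
    using \<delta> by (simp add: powr_mult powr_powr)
  also have "\<dots> \<le> measure lborel E powr (a + b)"
    using large \<delta> a_pos b_pos by (intro powr_mono2) auto
  also have "\<dots> \<le> measure Mu E powr a * measure Ms E powr b"
    by (rule lebesgue_powr_le[OF E sub])
  also have "\<dots> \<le> measure Mu E powr a * ?S powr b"
  proof (intro mult_left_mono powr_mono2)
    show "measure Ms E \<le> ?S"
      unfolding dual_weights.U_def[OF dual_weights_sym]
      using emeasure_s_finite[of "ball c r" c r] sub E
      by (intro measure_mono_fmeasurable) (auto simp: fmeasurable_def)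
  qed (use b_pos in auto)
  finally have 1: "\<delta> powr (a + b) * r powr (DIM('a) * (a + b)) \<le> measure Mu E powr a * ?S powr b" .
  have "\<delta> powr (a + b) / C0 * (U c r powr a * ?S powr b) \<le> \<delta> powr (a + b) / C0 * (C0 * r powr (DIM('a) * (a + b)))"
    using C0_pos by (intro mult_left_mono balanced' r) auto
  also have "\<dots> \<le> measure Mu E powr a * ?S powr b"
    using 1 C0_pos by simp
  finally have "\<delta> powr (a + b) / C0 * U c r powr a * ?S powr b \<le> measure Mu E powr a * ?S powr b"
    by (simp only: mult.assoc)
  then have "\<delta> powr (a + b) / C0 * U c r powr a \<le> measure Mu E powr a"
    by (rule mult_right_le_imp_le) (use S in simp)
  then have "(\<delta> powr (a + b) / C0 * U c r powr a) powr (1 / a) \<le> (measure Mu E powr a) powr (1 / a)"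
    using a_pos C0_pos by (intro powr_mono2) auto
  moreover have "(\<delta> powr (a + b) / C0 * U c r powr a) powr (1 / a) = (\<delta> powr (a + b) / C0) powr (1 / a) * U c r"
    using a_pos C0_pos by (subst powr_mult) (auto simp: powr_powr)
  ultimately show "(\<delta> powr (a + b) / C0) powr (1 / a) * U c r \<le> measure Mu E"
    using a_pos by (simp add: powr_powr)
qed

text \<open>\<open>fraction_of_ball\<close> for the concentric ball of half the radius; \<delta> is
  its volume divided by the power \<open>DIM('a)\<close> of the larger radius.\<close>

lemma doubling: "\<exists>D\<ge>1. \<forall>c r. 0 < r \<longrightarrow> U c (2 * r) \<le> D * U c r"
proof -
  define \<delta> where "\<delta> = unit_ball_vol DIM('a) * 2 powr (- real DIM('a))"
  have "0 < \<delta>" by (simp add: \<delta>_def)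
  from fraction_of_ball[OF this] obtain \<kappa> where \<kappa>: "0 < \<kappa>"
    "\<And>c r E. E \<in> sets borel \<Longrightarrow> 0 < r \<Longrightarrow> E \<subseteq> ball c r \<Longrightarrow> \<delta> * r powr DIM('a) \<le> measure lborel E \<Longrightarrow> \<kappa> * U c r \<le> measure Mu E"
    by blast
  have *: "\<kappa> * U c (2 * r) \<le> U c r" if "0 < r" for c r
    unfolding U_def[of c r]
    using that by (intro \<kappa>) (auto simp: \<delta>_def content_ball powr_mult powr_minus powr_realpow field_simps)
  show ?thesis
  proof (intro exI[of _ "max 1 (1 / \<kappa>)"] conjI allI impI)
    fix c :: 'a and r :: real assume r: "0 < r"
    have "U c (2 * r) \<le> 1 / \<kappa> * U c r"
      using *[OF r, of c] \<kappa>(1) by (simp add: field_simps)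
    also have "\<dots> \<le> max 1 (1 / \<kappa>) * U c r"
      by (intro mult_right_mono) auto
    finally show "U c (2 * r) \<le> max 1 (1 / \<kappa>) * U c r" .
  qed simp
qed

text \<open>\<open>fraction_of_ball\<close> for the annulus between the two balls: it carries a
  fraction \<kappa> of the larger mass, which leaves at most the fraction
  \<open>1 - \<kappa>\<close> for the smaller ball.\<close>

lemma reverse_doubling: "\<exists>\<theta>. 0 < \<theta> \<and> \<theta> < 1 \<and> (\<forall>c r. 0 < r \<longrightarrow> U c r \<le> \<theta> * U c (2 * r))"
proof -
  define \<delta> where "\<delta> = unit_ball_vol DIM('a) * (1 - 2 powr (- real DIM('a)))"
  have "2 powr (- real DIM('a)) < (1 :: real)"
    by (simp add: powr_less_one)
  then have "0 < \<delta>" by (simp add: \<delta>_def)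
  from fraction_of_ball[OF this] obtain \<kappa> where \<kappa>: "0 < \<kappa>"
    "\<And>c r E. E \<in> sets borel \<Longrightarrow> 0 < r \<Longrightarrow> E \<subseteq> ball c r \<Longrightarrow> \<delta> * r powr DIM('a) \<le> measure lborel E \<Longrightarrow> \<kappa> * U c r \<le> measure Mu E"
    by blast
  have *: "\<kappa> * U c (2 * r) \<le> U c (2 * r) - U c r" if r: "0 < r" for c r
  proof -
    have sub: "ball c r \<subseteq> ball c (2 * r)" using r by auto
    have "measure lborel (ball c (2 * r) - ball c r) = measure lborel (ball c (2 * r)) - measure lborel (ball c r)"
      using sub emeasure_lborel_ball_finite[of c "2 * r"] by (intro measure_Diff) auto
    also have "\<dots> = \<delta> * (2 * r) powr DIM('a)"
      using r by (simp add: \<delta>_def content_ball powr_mult powr_minus powr_realpow field_simps)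
    finally have "\<delta> * (2 * r) powr DIM('a) \<le> measure lborel (ball c (2 * r) - ball c r)" by simp
    then have "\<kappa> * U c (2 * r) \<le> measure Mu (ball c (2 * r) - ball c r)"
      using r by (intro \<kappa>) auto
    also have "\<dots> = U c (2 * r) - U c r"
      unfolding U_def using sub u_finite[of c "2 * r"] by (intro measure_Diff) auto
    finally show ?thesis .
  qed
  have "0 < 1 - \<kappa>"
  proof -
    have "0 < (1 - \<kappa>) * U 0 (2 * 1)"
      using *[of 1 0] U_pos[of 1 0] by (simp add: algebra_simps)
    then show ?thesis using U_pos[of "2 * 1" 0] by (simp add: zero_less_mult_iff)
  qed
  then show ?thesis
    using \<kappa>(1) * by (intro exI[of _ "1 - \<kappa>"]) (auto simp: algebra_simps)
qed

lemma reverse_doubling_iter: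
  assumes "0 < \<theta>" "\<And>c r. 0 < r \<Longrightarrow> U c r \<le> \<theta> * U c (2 * r)" "0 < r"
  shows "U c r \<le> \<theta> ^ i * U c (2 ^ i * r)"
proof (induction i)
  case (Suc i)
  have "\<theta> ^ i * U c (2 ^ i * r) \<le> \<theta> ^ i * (\<theta> * U c (2 * (2 ^ i * r)))"
    using assms by (intro mult_left_mono assms(2)) auto
  with Suc show ?case by (simp add: mult.assoc mult.left_commute)
qed simp

text \<open>The scales whose ball about \<open>y\<close> has mass below \<open>t\<close> form a
  half-line \<open>{..j0}\<close>. Going down from \<open>j0\<close>, reverse doubling makes the
  terms decrease geometrically with ratio \<open>\<theta> powr \<kappa>\<close>, so the sum is
  comparable to a bound \<open>t powr \<kappa>\<close> for its first term.\<close>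

lemma geometric_small_scales:
  assumes \<kappa>: "0 < \<kappa>"
  shows "\<exists>C>0. \<forall>y t. 0 < t \<longrightarrow> (\<integral>\<^sup>+j. indicator {j. U y (2 powr real_of_int j) < t} j *
     ennreal (U y (2 powr real_of_int j) powr \<kappa>) \<partial>count_space UNIV) \<le> ennreal (C * t powr \<kappa>)"
proof -
  obtain \<theta> where \<theta>: "0 < \<theta>" "\<theta> < 1" "\<And>c r. 0 < r \<Longrightarrow> U c r \<le> \<theta> * U c (2 * r)"
    using reverse_doubling by blast
  have iter: "U y (2 powr real_of_int (j - int i)) \<le> \<theta> ^ i * U y (2 powr real_of_int j)" for y j i
    using reverse_doubling_iter[OF \<theta>(1,3), of "2 powr real_of_int (j - int i)" y i]
    by (simp add: powr_diff powr_realpow)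
  define \<eta> where "\<eta> = \<theta> powr \<kappa>"
  have \<eta>: "0 < \<eta>" "\<eta> < 1"
    using \<theta> \<kappa> powr_less_mono2[of \<kappa> \<theta> 1] by (auto simp: \<eta>_def)
  show ?thesis
  proof (intro exI[of _ "1 / (1 - \<eta>)"] conjI allI impI)
    show "0 < 1 / (1 - \<eta>)" using \<eta> by simp
    fix y :: 'a and t :: real assume t: "0 < t"
    define J where "J = {j::int. U y (2 powr real_of_int j) < t}"
    have down: "i \<in> J" if "j \<in> J" "i \<le> j" for i j
    proof -
      have "U y (2 powr real_of_int i) \<le> U y (2 powr real_of_int j)"
        using that by (intro U_mono subset_ball) simp
      with that show ?thesis by (simp add: J_def)
    qed
    show "(\<integral>\<^sup>+j. indicator {j. U y (2 powr real_of_int j) < t} j *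
     ennreal (U y (2 powr real_of_int j) powr \<kappa>) \<partial>count_space UNIV) \<le> ennreal (1 / (1 - \<eta>) * t powr \<kappa>)"
    proof (cases "J = {}")
      case True
      then have "indicator {j. U y (2 powr real_of_int j) < t} j = (0::ennreal)" for j
        by (auto simp: J_def)
      then show ?thesis by simp
    next
      case False
      then obtain j1 where j1: "j1 \<in> J" by auto
      \<comment> \<open>The masses tend to infinity with the radius: once
        \<open>\<theta> ^ i\<close> is below the ratio of the mass at \<open>j1\<close> to
        \<open>t\<close>, the mass at \<open>j1 + int i\<close> exceeds \<open>t\<close>.\<close>
      have ex: "\<exists>i. j1 + int i \<notin> J"
      proof -
        have "0 < U y (2 powr real_of_int j1)" by (intro U_pos) simp
        then obtain i where i: "\<theta> ^ i < U y (2 powr real_of_int j1) / t"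
          using real_arch_pow_inv[of "U y (2 powr real_of_int j1) / t" \<theta>] \<theta> t by auto
        have "j1 + int i \<notin> J"
        proof
          assume "j1 + int i \<in> J"
          then have "\<theta> ^ i * U y (2 powr real_of_int (j1 + int i)) \<le> \<theta> ^ i * t"
            using \<theta> by (intro mult_left_mono) (auto simp: J_def)
          with iter[of y "j1 + int i" i] i t show False
            by (simp add: field_simps)
        qed
        then show ?thesis ..
      qed
      \<comment> \<open>Since \<open>j1\<close> belongs to \<open>J\<close>, the number
        \<open>i0\<close> is positive, and \<open>j1 + int (i0 - 1)\<close> is the largest element
        of \<open>J\<close>.\<close>
      define i0 where "i0 = (LEAST i. j1 + int i \<notin> J)"
      have i0: "j1 + int i0 \<notin> J"
        unfolding i0_def using ex by (rule LeastI_ex)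
      with j1 have "0 < i0" by (cases i0) auto
      then have "j1 + int (i0 - 1) \<in> J"
        using not_less_Least[of "i0 - 1" "\<lambda>i. j1 + int i \<notin> J"] by (simp add: i0_def)
      moreover define j0 where "j0 = j1 + int (i0 - 1)"
      ultimately have j0: "j0 \<in> J" by simp
      have "j \<le> j0" if "j \<in> J" for j
        using down[OF that, of "j1 + int i0"] i0 \<open>0 < i0\<close> by (force simp: j0_def of_nat_diff)
      with down[OF j0] have J: "J = {..j0}" by auto
      have "(\<integral>\<^sup>+j. indicator {j. U y (2 powr real_of_int j) < t} j *
         ennreal (U y (2 powr real_of_int j) powr \<kappa>) \<partial>count_space UNIV)
        = (\<integral>\<^sup>+j. ennreal (U y (2 powr real_of_int j) powr \<kappa>) * indicator {..j0} j \<partial>count_space UNIV)"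
        by (simp add: J[symmetric] J_def mult.commute)
      also have "\<dots> = (\<integral>\<^sup>+j. ennreal (U y (2 powr real_of_int j) powr \<kappa>) \<partial>count_space {..j0})"
        by (simp add: nn_integral_count_space_indicator)
      also have "\<dots> = (\<integral>\<^sup>+i. ennreal (U y (2 powr real_of_int (j0 - int i)) powr \<kappa>) \<partial>count_space UNIV)"
      proof -
        have "bij_betw (\<lambda>i. j0 - int i) UNIV {..j0}"
          by (rule bij_betwI[where g = "\<lambda>j. nat (j0 - j)"]) auto
        then show ?thesis by (simp add: nn_integral_bij_count_space[symmetric])
      qed
      also have "\<dots> \<le> (\<integral>\<^sup>+i. ennreal (t powr \<kappa> * \<eta> ^ i) \<partial>count_space UNIV)"
      proof (intro nn_integral_mono ennreal_leI)
        fix i :: nat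
        have "U y (2 powr real_of_int (j0 - int i)) \<le> \<theta> ^ i * t"
        proof (rule order_trans[OF iter])
          show "\<theta> ^ i * U y (2 powr real_of_int j0) \<le> \<theta> ^ i * t"
            using j0 \<theta> by (intro mult_left_mono) (auto simp: J_def)
        qed
        then have "U y (2 powr real_of_int (j0 - int i)) powr \<kappa> \<le> (\<theta> ^ i * t) powr \<kappa>"
          using \<kappa> by (intro powr_mono2) auto
        also have "\<dots> = t powr \<kappa> * \<eta> ^ i"
          using \<theta> t by (simp add: \<eta>_def powr_mult powr_of_power mult.commute)
        finally show "U y (2 powr real_of_int (j0 - int i)) powr \<kappa> \<le> t powr \<kappa> * \<eta> ^ i" .
      qed
      also have "\<dots> = suminf (\<lambda>i. ennreal (t powr \<kappa> * \<eta> ^ i))"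
        by (rule nn_integral_count_space_nat)
      also have "\<dots> = ennreal (1 / (1 - \<eta>) * t powr \<kappa>)"
      proof (rule suminf_ennreal_eq)
        show "(\<lambda>i. t powr \<kappa> * \<eta> ^ i) sums (1 / (1 - \<eta>) * t powr \<kappa>)"
          using sums_mult[OF geometric_sums[of \<eta>], of "t powr \<kappa>"] \<eta> by (simp add: mult.commute)
      qed (use \<eta> in auto)
      finally show ?thesis .
    qed
  qed
qed

text \<open>Outwards, reverse doubling makes the masses grow at least geometrically, so negative
  powers of them sum to a multiple of the first term.\<close>

lemma geometric_large_scales:
  assumes \<kappa>: "0 < \<kappa>"
  shows "\<exists>C>0. \<forall>c r. 0 < r \<longrightarrow> suminf (\<lambda>i. ennreal (U c (2 ^ i * r) powr (- \<kappa>))) \<le> ennreal (C * U c r powr (- \<kappa>))"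
proof -
  obtain \<theta> where \<theta>: "0 < \<theta>" "\<theta> < 1" "\<And>c r. 0 < r \<Longrightarrow> U c r \<le> \<theta> * U c (2 * r)"
    using reverse_doubling by blast
  define \<eta> where "\<eta> = \<theta> powr \<kappa>"
  have \<eta>: "0 < \<eta>" "\<eta> < 1"
    using \<theta> \<kappa> powr_less_mono2[of \<kappa> \<theta> 1] by (auto simp: \<eta>_def)
  show ?thesis
  proof (intro exI[of _ "1 / (1 - \<eta>)"] conjI allI impI)
    show "0 < 1 / (1 - \<eta>)" using \<eta> by simp
    fix c :: 'a and r :: real assume r: "0 < r"
    have "suminf (\<lambda>i. ennreal (U c (2 ^ i * r) powr (- \<kappa>))) \<le> suminf (\<lambda>i. ennreal (U c r powr (- \<kappa>) * \<eta> ^ i))"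
    proof (intro suminf_le ennreal_leI)
      fix i
      have U2: "0 < U c (2 ^ i * r)" "0 < U c r" using r by (auto intro: U_pos)
      have "U c r powr \<kappa> \<le> (\<theta> ^ i * U c (2 ^ i * r)) powr \<kappa>"
        using \<kappa> r by (intro powr_mono2 reverse_doubling_iter \<theta>) auto
      also have "\<dots> = \<eta> ^ i * U c (2 ^ i * r) powr \<kappa>"
        using \<theta> by (simp add: \<eta>_def powr_mult powr_of_power mult.commute)
      finally show "U c (2 ^ i * r) powr (- \<kappa>) \<le> U c r powr (- \<kappa>) * \<eta> ^ i"
        using U2 \<eta> by (simp add: powr_minus field_simps)
    qed auto
    also have "\<dots> = ennreal (1 / (1 - \<eta>) * U c r powr (- \<kappa>))"
    proof (rule suminf_ennreal_eq)
      show "(\<lambda>i. U c r powr (- \<kappa>) * \<eta> ^ i) sums (1 / (1 - \<eta>) * U c r powr (- \<kappa>))"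
        using sums_mult[OF geometric_sums[of \<eta>], of "U c r powr (- \<kappa>)"] \<eta> by (simp add: mult.commute)
    qed (use \<eta> in auto)
    finally show "suminf (\<lambda>i. ennreal (U c (2 ^ i * r) powr (- \<kappa>))) \<le> ennreal (1 / (1 - \<eta>) * U c r powr (- \<kappa>))" .
  qed
qed

end

section \<open>Averages over balls of all dyadic scales\<close>

text \<open>A pair \<open>(j, z)\<close> stands for the ball with centre \<open>z\<close> and radius
  \<open>2 powr j\<close>. The density gives the balls of one scale that contain a given point the
  total mass \<open>unit_ball_vol DIM('a)\<close>, independently of \<open>j\<close>, much as in
  counting the cubes of a grid.\<close>

definition scales :: "(int \<times> 'a::euclidean_space) measure" where
  "scales = density (count_space UNIV \<Otimes>\<^sub>M lborel) (\<lambda>\<zeta>. ennreal (2 powr (- real DIM('a) * real_of_int (fst \<zeta>))))"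

definition in_scale :: "int \<times> 'a::euclidean_space \<Rightarrow> 'a \<Rightarrow> bool" where
  "in_scale \<zeta> y \<longleftrightarrow> dist (snd \<zeta>) y < 2 powr real_of_int (fst \<zeta>)"

lemma sigma_finite_int_lborel: "sigma_finite_measure (count_space (UNIV :: int set) \<Otimes>\<^sub>M (lborel :: 'a::euclidean_space measure))"
proof -
  interpret A: sigma_finite_measure "count_space (UNIV :: int set)"
    by (rule sigma_finite_measure_count_space)
  interpret pair_sigma_finite "count_space (UNIV :: int set)" "lborel :: 'a measure" ..
  show ?thesis by (rule P.sigma_finite_measure_axioms)
qed

lemma sets_scales [simp, measurable_cong]:
  "sets scales = sets (count_space (UNIV :: int set) \<Otimes>\<^sub>M (borel :: 'a::euclidean_space measure))"
  unfolding scales_def sets_density by (intro sets_pair_measure_cong) auto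

lemma space_scales [simp]: "space scales = UNIV"
  unfolding scales_def by (simp add: space_pair_measure)

lemma sigma_finite_scales: "sigma_finite_measure (scales :: (int \<times> 'a::euclidean_space) measure)"
  unfolding scales_def
  by (subst sigma_finite_measure.sigma_finite_iff_density_finite[OF sigma_finite_int_lborel]) auto

lemma nn_integral_scales:
  fixes h :: "int \<times> 'a::euclidean_space \<Rightarrow> ennreal"
  assumes [measurable]: "h \<in> borel_measurable scales"
  shows "(\<integral>\<^sup>+\<zeta>. h \<zeta> \<partial>scales) = (\<integral>\<^sup>+j. (\<integral>\<^sup>+z. ennreal (2 powr (- real DIM('a) * real_of_int j)) * h (j, z) \<partial>lborel) \<partial>count_space UNIV)"
proof -
  have [measurable]: "h \<in> borel_measurable (count_space UNIV \<Otimes>\<^sub>M lborel)"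
    using assms unfolding scales_def by simp
  show ?thesis
    unfolding scales_def
    by (subst nn_integral_density) (auto simp: lborel.nn_integral_fst[symmetric])
qed

text \<open>The integer coordinate ranges over a countable set, so measurability may be checked one
  scale at a time.\<close>

lemma measurable_scalesI:
  assumes "\<And>j. (\<lambda>z. h (j, z)) \<in> measurable borel L"
  shows "h \<in> measurable scales L"
proof -
  have "h \<in> measurable (count_space (UNIV :: int set) \<Otimes>\<^sub>M borel) L"
    using assms by (intro measurable_pair_measure_countable1) auto
  then show ?thesis
    by (simp cong: measurable_cong_sets)
qed

lemma in_scale_measurable [measurable]:
  fixes M :: "'a::euclidean_space measure"
  assumes [measurable_cong]: "sets M = sets borel"
  shows "Measurable.pred (scales \<Otimes>\<^sub>M M) (\<lambda>(\<zeta>, y). in_scale \<zeta> y)"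
proof -
  have [measurable]: "(\<lambda>\<zeta>::int \<times> 'a. 2 powr real_of_int (fst \<zeta>)) \<in> borel_measurable scales"
    by (rule measurable_scalesI) simp
  have [measurable]: "(snd :: int \<times> 'a \<Rightarrow> 'a) \<in> borel_measurable scales"
    by (rule measurable_scalesI) simp
  show ?thesis unfolding in_scale_def by measurable
qed

text \<open>Points at distance about \<open>2\<^sup>j\<close> are both contained in a large proportion of the balls
  of radius \<open>2\<^sup>j\<close> centred near them.\<close>

lemma Riesz_kernel_le_scales:
  assumes \<beta>: "0 < \<beta>"
  shows "\<exists>C>0. \<forall>x y :: 'a::euclidean_space. ennreal (dist x y powr (- \<beta>)) \<le>
    ennreal C * (\<integral>\<^sup>+\<zeta>. ennreal (2 powr (- \<beta> * real_of_int (fst \<zeta>))) *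
       (indicator {\<zeta>. in_scale \<zeta> x} \<zeta> * indicator {\<zeta>. in_scale \<zeta> y} \<zeta>) \<partial>scales)"
proof (intro exI[of _ "4 powr \<beta> * 2 ^ DIM('a) / unit_ball_vol DIM('a)"] conjI allI)
  let ?v = "unit_ball_vol (real DIM('a))"
  have v: "0 < ?v" by simp
  then have v0: "?v \<noteq> 0" by linarith
  then show "0 < 4 powr \<beta> * 2 ^ DIM('a) / ?v" by simp
  fix x y :: 'a
  show "ennreal (dist x y powr (- \<beta>)) \<le> ennreal (4 powr \<beta> * 2 ^ DIM('a) / ?v) *
    (\<integral>\<^sup>+\<zeta>. ennreal (2 powr (- \<beta> * real_of_int (fst \<zeta>))) *
       (indicator {\<zeta>. in_scale \<zeta> x} \<zeta> * indicator {\<zeta>. in_scale \<zeta> y} \<zeta>) \<partial>scales)"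
    (is "_ \<le> _ * ?I")
  proof (cases "x = y")
    \<comment> \<open>\<open>0 powr (- \<beta>)\<close> is 0, so the kernel vanishes on the
      diagonal.\<close>
    case True
    then show ?thesis by simp
  next
    case False
    define d where "d = dist x y"
    have d: "0 < d" using False by (simp add: d_def)
    \<comment> \<open>With this choice \<open>d \<le> 2 powr (j - 1)\<close>, so every centre in the
      ball of radius \<open>2 powr (j - 1)\<close> about \<open>x\<close> gives a ball containing
      both points. Also \<open>2 powr j \<le> 4 * d\<close>, which accounts for the factor
      \<open>4 powr \<beta>\<close>.\<close>
    define j where "j = \<lceil>log 2 d\<rceil> + 1"
    have "d = 2 powr log 2 d" using d by simp
    also have "\<dots> \<le> 2 powr (real_of_int j - 1)" unfolding j_def by (intro powr_mono) auto
    finally have d1: "d \<le> 2 powr (real_of_int j - 1)" .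
    have "2 powr real_of_int j \<le> 2 powr (2 + log 2 d)"
      unfolding j_def by (intro powr_mono) (simp_all, linarith)
    also have "\<dots> = 4 * d" using d by (simp add: powr_add)
    finally have d2: "2 powr real_of_int j \<le> 4 * d" .
    have half: "2 powr (real_of_int j - 1) + 2 powr (real_of_int j - 1) = (2 powr real_of_int j :: real)"
      by (simp add: powr_diff)
    have [measurable]: "Measurable.pred scales (\<lambda>\<zeta>. in_scale \<zeta> w)" for w :: 'a
      using measurable_Pair1[OF in_scale_measurable[of borel], of w] by simp
    have m1: "(\<lambda>\<zeta>::int \<times> 'a. 2 powr (- \<beta> * real_of_int (fst \<zeta>))) \<in> borel_measurable scales"
      by (rule measurable_scalesI) simp
    have "ennreal (?v * 2 powr (- real DIM('a)) * 2 powr (- \<beta> * real_of_int j))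
      = ennreal (2 powr (- real DIM('a) * real_of_int j) * 2 powr (- \<beta> * real_of_int j)) * ennreal (?v * (2 powr (real_of_int j - 1)) ^ DIM('a))"
    proof -
      have "(2 powr (real_of_int j - 1)) ^ DIM('a) = 2 powr (real DIM('a) * (real_of_int j - 1))"
        by (simp add: powr_power)
      moreover have "2 powr (- real DIM('a) * real_of_int j) * 2 powr (real DIM('a) * (real_of_int j - 1)) = 2 powr (- real DIM('a))"
        by (simp add: powr_add[symmetric] algebra_simps)
      ultimately show ?thesis using v by (simp add: ennreal_mult[symmetric] algebra_simps)
    qed
    also have "\<dots> = ennreal (2 powr (- real DIM('a) * real_of_int j) * 2 powr (- \<beta> * real_of_int j)) * emeasure lborel (ball x (2 powr (real_of_int j - 1)))"
      by (simp add: emeasure_ball)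
    also have "\<dots> = (\<integral>\<^sup>+z. ennreal (2 powr (- real DIM('a) * real_of_int j) * 2 powr (- \<beta> * real_of_int j)) * indicator (ball x (2 powr (real_of_int j - 1))) z \<partial>lborel)"
      by (simp add: nn_integral_cmult_indicator)
    also have "\<dots> \<le> (\<integral>\<^sup>+z. ennreal (2 powr (- real DIM('a) * real_of_int j)) * (ennreal (2 powr (- \<beta> * real_of_int (fst (j, z)))) *
       (indicator {\<zeta>. in_scale \<zeta> x} (j, z) * indicator {\<zeta>. in_scale \<zeta> y} (j, z))) \<partial>lborel)"
    proof (intro nn_integral_mono, goal_cases)
      case (1 z)
      have "in_scale (j, z) x \<and> in_scale (j, z) y" if z: "z \<in> ball x (2 powr (real_of_int j - 1))"
      proof -
        have "dist x z < 2 powr (real_of_int j - 1)" using z by simp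
        moreover have "dist z y \<le> dist x z + d"
          unfolding d_def by (metis add.commute dist_commute dist_triangle2)
        moreover have "0 < (2::real) powr (real_of_int j - 1)" by simp
        ultimately show ?thesis
          using half d1 unfolding in_scale_def fst_conv snd_conv by (simp only: dist_commute[of z x]) linarith
      qed
      then show ?case by (auto simp: ennreal_mult split: split_indicator)
    qed
    also have "\<dots> \<le> (\<integral>\<^sup>+j. (\<integral>\<^sup>+z. ennreal (2 powr (- real DIM('a) * real_of_int j)) * (ennreal (2 powr (- \<beta> * real_of_int (fst (j, z)))) *
       (indicator {\<zeta>. in_scale \<zeta> x} (j, z) * indicator {\<zeta>. in_scale \<zeta> y} (j, z))) \<partial>lborel) \<partial>count_space UNIV)"
      by (rule nn_integral_ge_point) simp
    also have "\<dots> = ?I"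
      using m1 by (subst nn_integral_scales) simp_all
    finally have *: "ennreal (?v * 2 powr (- real DIM('a)) * 2 powr (- \<beta> * real_of_int j)) \<le> ?I" .
    have "(4 * d) powr (- \<beta>) \<le> (2 powr real_of_int j) powr (- \<beta>)"
      using d2 \<beta> by (intro powr_mono2') auto
    then have "d powr (- \<beta>) \<le> 4 powr \<beta> * 2 powr (- \<beta> * real_of_int j)"
      using d by (simp add: powr_mult powr_powr powr_minus field_simps)
    also have "\<dots> = 4 powr \<beta> * 2 ^ DIM('a) / ?v * (?v * 2 powr (- real DIM('a)) * 2 powr (- \<beta> * real_of_int j))"
      using v0 by (simp add: powr_minus powr_realpow)
    finally have "ennreal (dist x y powr (- \<beta>)) \<le> ennreal (4 powr \<beta> * 2 ^ DIM('a) / ?v) * ennreal (?v * 2 powr (- real DIM('a)) * 2 powr (- \<beta> * real_of_int j))"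
      using v by (subst ennreal_mult[symmetric]) (auto simp: d_def v0 intro: ennreal_leI)
    also have "\<dots> \<le> ennreal (4 powr \<beta> * 2 ^ DIM('a) / ?v) * ?I"
      by (intro mult_left_mono *) simp
    finally show ?thesis .
  qed
qed

section \<open>The embedding for the family of all balls\<close>

context dual_weights
begin

lemma sigma_finite_Mu: "sigma_finite_measure Mu"
  by (subst sigma_finite_measure.sigma_finite_iff_density_finite[OF lborel.sigma_finite_measure_axioms]) auto

lemma U_measurable [measurable]: "(\<lambda>z. U z r) \<in> borel_measurable borel"
proof -
  have eq: "U z r = enn2real (\<integral>\<^sup>+y. ennreal (u y) * indicator {y. dist z y < r} y \<partial>lborel)" for z
    unfolding U_def measure_def by (simp add: emeasure_density ball_def)
  show ?thesis unfolding eq indicator_def mem_Collect_eq by measurable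
qed

lemma U_scales_measurable [measurable]: "(\<lambda>\<zeta>. U (snd \<zeta>) (2 powr real_of_int (fst \<zeta>))) \<in> borel_measurable scales"
  by (rule measurable_scalesI) simp

text \<open>This is the hypothesis \<open>geom\<close> of \<open>averages_embedding\<close> for
  balls. A ball of radius \<open>2 powr j\<close> containing \<open>y\<close> has mass comparable to
  that of the ball about \<open>y\<close>, by doubling, and the centres of such balls fill a volume
  that the density of \<open>scales\<close> cancels. What remains is the sum of
  \<open>geometric_small_scales\<close> with threshold \<open>D * t\<close>.\<close>

lemma small_scales_bound:
  assumes \<rho>: "1 < \<rho>"
  shows "\<exists>C>0. \<forall>y t. 0 < t \<longrightarrow> (\<integral>\<^sup>+\<zeta>. indicator {\<zeta>. in_scale \<zeta> y \<and> U (snd \<zeta>) (2 powr real_of_int (fst \<zeta>)) < t} \<zeta> *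
      ennreal (U (snd \<zeta>) (2 powr real_of_int (fst \<zeta>)) powr \<rho>) \<partial>scales) \<le> ennreal ((C * t) powr \<rho>)"
proof -
  obtain D where D: "1 \<le> D" "\<And>c r. 0 < r \<Longrightarrow> U c (2 * r) \<le> D * U c r"
    using doubling by blast
  obtain C1 where C1: "0 < C1" "\<And>y t. 0 < t \<Longrightarrow> (\<integral>\<^sup>+j. indicator {j. U y (2 powr real_of_int j) < t} j *
     ennreal (U y (2 powr real_of_int j) powr \<rho>) \<partial>count_space UNIV) \<le> ennreal (C1 * t powr \<rho>)"
    using geometric_small_scales[of \<rho>] \<rho> by auto
  let ?v = "unit_ball_vol (real DIM('a))"
  have v: "0 < ?v" by simp
  then have v0: "?v \<noteq> 0" by linarith
  \<comment> \<open>One factor \<open>D powr \<rho>\<close> comes from moving the centre from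
    \<open>z\<close> to \<open>y\<close> in the integrand, the other from enlarging the threshold to
    \<open>D * t\<close>. The root \<open>K powr (1 / \<rho>)\<close> used below moves the constant
    inside the power.\<close>
  define K where "K = D powr \<rho> * ?v * C1 * D powr \<rho>"
  have K: "0 < K" using D v C1 by (simp add: K_def)
  show ?thesis
  proof (intro exI[of _ "K powr (1 / \<rho>)"] conjI allI impI, goal_cases)
    case 1
    show ?case using K by simp
  next
    case (2 y t)
    note t = 2
    have [measurable]: "Measurable.pred scales (\<lambda>\<zeta>. in_scale \<zeta> y)"
      using measurable_Pair1[OF in_scale_measurable[of borel], of y] by simp
    let ?h = "\<lambda>\<zeta>. indicator {\<zeta>. in_scale \<zeta> y \<and> U (snd \<zeta>) (2 powr real_of_int (fst \<zeta>)) < t} \<zeta> *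
      ennreal (U (snd \<zeta>) (2 powr real_of_int (fst \<zeta>)) powr \<rho>)"
    have "(\<integral>\<^sup>+\<zeta>. ?h \<zeta> \<partial>scales)
      = (\<integral>\<^sup>+j. (\<integral>\<^sup>+z. ennreal (2 powr (- real DIM('a) * real_of_int j)) * ?h (j, z) \<partial>lborel) \<partial>count_space UNIV)"
      by (subst nn_integral_scales) simp_all
    also have "\<dots> \<le> (\<integral>\<^sup>+j. ennreal (D powr \<rho> * ?v) * (indicator {j. U y (2 powr real_of_int j) < D * t} j *
       ennreal (U y (2 powr real_of_int j) powr \<rho>)) \<partial>count_space UNIV)"
    proof (intro nn_integral_mono, goal_cases)
      case (1 j)
      let ?r = "2 powr real_of_int j"
      have "(\<integral>\<^sup>+z. ennreal (2 powr (- real DIM('a) * real_of_int j)) * ?h (j, z) \<partial>lborel)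
        \<le> (\<integral>\<^sup>+z\<in>ball y ?r. ennreal (2 powr (- real DIM('a) * real_of_int j) * (D powr \<rho> * U y ?r powr \<rho>)) * indicator {j. U y (2 powr real_of_int j) < D * t} j \<partial>lborel)"
      proof (intro nn_integral_mono, goal_cases)
        case (1 z)
        show ?case
        proof (cases "in_scale (j, z) y \<and> U z ?r < t")
          case True
          then have dz: "dist z y < ?r" by (simp add: in_scale_def)
          have s1: "ball y ?r \<subseteq> ball z (2 * ?r)"
          proof
            fix w assume "w \<in> ball y ?r"
            then have "dist y w < ?r" by simp
            moreover have "dist z w \<le> dist z y + dist y w" by (rule dist_triangle)
            ultimately have "dist z w < 2 * ?r" using dz by linarith
            then show "w \<in> ball z (2 * ?r)" by simp
          qed
          have s2: "ball z ?r \<subseteq> ball y (2 * ?r)"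
          proof
            fix w assume "w \<in> ball z ?r"
            then have "dist z w < ?r" by simp
            moreover have "dist y w \<le> dist z y + dist z w" by (metis dist_commute dist_triangle)
            ultimately have "dist y w < 2 * ?r" using dz by linarith
            then show "w \<in> ball y (2 * ?r)" by simp
          qed
          have "U y ?r \<le> D * U z ?r" using U_mono[OF s1] D(2)[of ?r z] by simp
          also have "\<dots> < D * t" using True D(1) by simp
          finally have 1: "U y ?r < D * t" .
          have "U z ?r \<le> D * U y ?r" using U_mono[OF s2] D(2)[of ?r y] by simp
          then have "U z ?r powr \<rho> \<le> (D * U y ?r) powr \<rho>" using \<rho> by (intro powr_mono2) auto
          also have "\<dots> = D powr \<rho> * U y ?r powr \<rho>" using D by (simp add: powr_mult)
          finally have 2: "U z ?r powr \<rho> \<le> D powr \<rho> * U y ?r powr \<rho>" .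
          show ?thesis
            using True 1 2 dz by (simp add: ennreal_mult[symmetric] dist_commute ennreal_leI mult_left_mono)
        qed auto
      qed
      also have "\<dots> = ennreal (2 powr (- real DIM('a) * real_of_int j) * (D powr \<rho> * U y ?r powr \<rho>)) * indicator {j. U y (2 powr real_of_int j) < D * t} j * emeasure lborel (ball y ?r)"
        by (simp add: nn_integral_cmult_indicator)
      also have "\<dots> = ennreal (D powr \<rho> * ?v) * (indicator {j. U y (2 powr real_of_int j) < D * t} j * ennreal (U y ?r powr \<rho>))"
      proof -
        have "2 powr (- real DIM('a) * real_of_int j) * ?r ^ DIM('a) = (1::real)"
          by (simp add: powr_power powr_add[symmetric])
        moreover have "2 powr (- real DIM('a) * real_of_int j) * (D powr \<rho> * U y ?r powr \<rho>) * (?v * ?r ^ DIM('a))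
          = (2 powr (- real DIM('a) * real_of_int j) * ?r ^ DIM('a)) * (D powr \<rho> * ?v * U y ?r powr \<rho>)"
          by (simp only: ac_simps)
        ultimately have "2 powr (- real DIM('a) * real_of_int j) * (D powr \<rho> * U y ?r powr \<rho>) * (?v * ?r ^ DIM('a)) = D powr \<rho> * ?v * U y ?r powr \<rho>"
          by (simp only: mult_1)
        then have "ennreal (2 powr (- real DIM('a) * real_of_int j) * (D powr \<rho> * U y ?r powr \<rho>)) * ennreal (?v * ?r ^ DIM('a)) = ennreal (D powr \<rho> * ?v) * ennreal (U y ?r powr \<rho>)"
          using v by (simp add: ennreal_mult[symmetric] v0)
        then show ?thesis by (auto simp: emeasure_ball split: split_indicator)
      qed
      finally show ?case .
    qed
    also have "\<dots> = ennreal (D powr \<rho> * ?v) * (\<integral>\<^sup>+j. (indicator {j. U y (2 powr real_of_int j) < D * t} j *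
       ennreal (U y (2 powr real_of_int j) powr \<rho>)) \<partial>count_space UNIV)"
      by (rule nn_integral_cmult) simp
    also have "\<dots> \<le> ennreal (D powr \<rho> * ?v) * ennreal (C1 * (D * t) powr \<rho>)"
      using t D by (intro mult_left_mono C1) auto
    also have "\<dots> = ennreal ((K powr (1 / \<rho>) * t) powr \<rho>)"
      using v C1 D t K \<rho> by (simp add: ennreal_mult[symmetric] powr_mult powr_powr) (simp add: K_def ac_simps)
    finally show ?case .
  qed
qed

text \<open>\<open>averages_embedding\<close> with \<open>m\<close> the mass of the ball:
  \<open>slice\<close> is then an equality and \<open>geom\<close> is
  \<open>small_scales_bound\<close>.\<close>

lemma ball_averages_embedding:
  assumes p: "1 < p" and \<rho>: "1 < \<rho>"
  shows "\<exists>C>0. \<forall>f :: 'a \<Rightarrow> real. f \<in> borel_measurable borel \<longrightarrow> (\<forall>y. 0 \<le> f y) \<longrightarrow>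
    (\<integral>\<^sup>+\<zeta>. ennreal (U (snd \<zeta>) (2 powr real_of_int (fst \<zeta>)) powr \<rho>) *
       ((\<integral>\<^sup>+y. indicator {y. in_scale \<zeta> y} y * ennreal (f y) \<partial>Mu) / ennreal (U (snd \<zeta>) (2 powr real_of_int (fst \<zeta>)))) epowr (\<rho> * p) \<partial>scales)
    \<le> ennreal C * (\<integral>\<^sup>+y. ennreal (f y powr p) \<partial>Mu) epowr \<rho>"
proof -
  obtain C where C: "0 < C" "\<And>y t. 0 < t \<Longrightarrow> (\<integral>\<^sup>+\<zeta>. indicator {\<zeta>. in_scale \<zeta> y \<and> U (snd \<zeta>) (2 powr real_of_int (fst \<zeta>)) < t} \<zeta> *
      ennreal (U (snd \<zeta>) (2 powr real_of_int (fst \<zeta>)) powr \<rho>) \<partial>scales) \<le> ennreal ((C * t) powr \<rho>)"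
    using small_scales_bound[OF \<rho>] by blast
  let ?C' = "\<rho> * p / (p - 1) * (2 * C * \<rho> / (\<rho> - 1)) powr \<rho> * 2 powr ((p - 1) * \<rho>)"
  show ?thesis
  proof (intro exI[of _ ?C'] conjI allI impI, goal_cases)
    case 1
    show ?case using p \<rho> C by simp
  next
    case (2 f)
    note f = 2
    show ?case
    proof (rule averages_embedding[OF sigma_finite_scales sigma_finite_Mu])
      show "emeasure Mu {y \<in> space Mu. in_scale \<zeta> y} \<le> ennreal (U (snd \<zeta>) (2 powr real_of_int (fst \<zeta>)))" for \<zeta>
        by (simp add: in_scale_def emeasure_u_ball[symmetric] ball_def)
    qed (use f p \<rho> C U_pos in auto)
  qed
qed

end

section \<open>Weighted bounds for the Riesz potential\<close>

context dual_weights
begin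

lemma Riesz_bilinear:
  assumes ab: "a + b < 1"
  shows "\<exists>C>0. \<forall>(f :: 'a \<Rightarrow> real) (g :: 'a \<Rightarrow> real).
    f \<in> borel_measurable borel \<longrightarrow> (\<forall>y. 0 \<le> f y) \<longrightarrow> g \<in> borel_measurable borel \<longrightarrow> (\<forall>x. 0 \<le> g x) \<longrightarrow>
    (\<integral>\<^sup>+x. ennreal (g x) * (\<integral>\<^sup>+y. ennreal (dist x y powr (- (DIM('a) * (a + b)))) * ennreal (f y) \<partial>Ms) \<partial>Mu)
     \<le> ennreal C * ((\<integral>\<^sup>+x. ennreal (g x powr (1 / (1 - a))) \<partial>Mu) epowr (1 - a) *
         (\<integral>\<^sup>+y. ennreal (f y powr (1 / (1 - b))) \<partial>Ms) epowr (1 - b))"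
proof -
  interpret dual: dual_weights s u b a C0 by (rule dual_weights_sym)
  interpret u: sigma_finite_measure Mu by (rule sigma_finite_Mu)
  interpret s: sigma_finite_measure Ms by (rule dual.sigma_finite_Mu)
  interpret sc: sigma_finite_measure "scales :: (int \<times> 'a) measure" by (rule sigma_finite_scales)
  interpret us: pair_sigma_finite "scales :: (int \<times> 'a) measure" Mu ..
  interpret ss: pair_sigma_finite "scales :: (int \<times> 'a) measure" Ms ..
  define \<beta> where "\<beta> = DIM('a) * (a + b)"
  \<comment> \<open>\<open>T\<close> and \<theta> are the only choice with
    \<open>T * \<theta> = 1 - a\<close> and \<open>T * (1 - \<theta>) = 1 - b\<close>. Hoelder's
    inequality with weights \<theta> and \<open>1 - \<theta>\<close> then leaves the power
    \<open>T\<close> of both masses, and \<open>T > 1\<close> is the off-diagonal exponent that the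
    embeddings require.\<close>
  define T where "T = 2 - a - b"
  define \<theta> where "\<theta> = (1 - a) / T"
  have T: "1 < T" using ab by (simp add: T_def)
  have a1: "a < 1" "b < 1" using ab a_pos b_pos by auto
  have \<theta>: "0 < \<theta>" "\<theta> < 1" "1 - \<theta> = (1 - b) / T"
    using T a1 by (auto simp: \<theta>_def T_def field_simps)
  have \<beta>: "0 < \<beta>" using a_pos b_pos by (simp add: \<beta>_def)
  define p where "p = 1 / (1 - b)"
  define p2 where "p2 = 1 / (1 - a)"
  have p: "1 < p" "1 < p2" using a_pos b_pos a1 by (auto simp: p_def p2_def)
  have \<theta>T: "T * \<theta> = 1 - a" "T * (1 - \<theta>) = 1 - b" "T * p2 * \<theta> = 1" "T * p * (1 - \<theta>) = 1"
    unfolding \<theta>(3) unfolding \<theta>_def p_def p2_def using T a1 by (auto simp: field_simps)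
  obtain C1 where C1: "0 < C1" "\<And>x y :: 'a. ennreal (dist x y powr (- \<beta>)) \<le>
    ennreal C1 * (\<integral>\<^sup>+\<zeta>. ennreal (2 powr (- \<beta> * real_of_int (fst \<zeta>))) *
       (indicator {\<zeta>. in_scale \<zeta> x} \<zeta> * indicator {\<zeta>. in_scale \<zeta> y} \<zeta>) \<partial>scales)"
    using Riesz_kernel_le_scales[OF \<beta>, where 'a = 'a] by blast
  define m where "m \<zeta> = U (snd \<zeta>) (2 powr real_of_int (fst \<zeta>))" for \<zeta> :: "int \<times> 'a"
  define l where "l \<zeta> = dual.U (snd \<zeta>) (2 powr real_of_int (fst \<zeta>))" for \<zeta> :: "int \<times> 'a"
  have ml_pos: "0 < m \<zeta>" "0 < l \<zeta>" for \<zeta>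
    unfolding m_def l_def by (auto intro: U_pos dual.U_pos)
  have [measurable]: "m \<in> borel_measurable scales" "l \<in> borel_measurable scales"
    unfolding m_def l_def by measurable
  obtain C2 where C2: "0 < C2" "\<And>g :: 'a \<Rightarrow> real. g \<in> borel_measurable borel \<Longrightarrow> (\<forall>y. 0 \<le> g y) \<Longrightarrow>
    (\<integral>\<^sup>+\<zeta>. ennreal (m \<zeta> powr T) * ((\<integral>\<^sup>+y. indicator {y. in_scale \<zeta> y} y * ennreal (g y) \<partial>Mu) / ennreal (m \<zeta>)) epowr (T * p2) \<partial>scales)
    \<le> ennreal C2 * (\<integral>\<^sup>+y. ennreal (g y powr p2) \<partial>Mu) epowr T"
    using ball_averages_embedding[OF p(2) T] unfolding m_def by blast
  obtain C3 where C3: "0 < C3" "\<And>f :: 'a \<Rightarrow> real. f \<in> borel_measurable borel \<Longrightarrow> (\<forall>y. 0 \<le> f y) \<Longrightarrow>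
    (\<integral>\<^sup>+\<zeta>. ennreal (l \<zeta> powr T) * ((\<integral>\<^sup>+y. indicator {y. in_scale \<zeta> y} y * ennreal (f y) \<partial>Ms) / ennreal (l \<zeta>)) epowr (T * p) \<partial>scales)
    \<le> ennreal C3 * (\<integral>\<^sup>+y. ennreal (f y powr p) \<partial>Ms) epowr T"
    using dual.ball_averages_embedding[OF p(1) T] unfolding l_def by blast
  define c where "c \<zeta> = 2 powr (- \<beta> * real_of_int (fst \<zeta>))" for \<zeta> :: "int \<times> 'a"
  have [measurable]: "c \<in> borel_measurable scales"
    by (rule measurable_scalesI) (simp add: c_def)
  have [measurable]: "Measurable.pred scales (\<lambda>\<zeta>. in_scale \<zeta> w)" for w :: 'a
    using measurable_Pair1[OF in_scale_measurable[of borel], of w] by simp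
  \<comment> \<open>Here \<open>balanced\<close> trades the size of the kernel at a scale for
    negative powers of the two masses of the ball.\<close>
  have c_le: "c \<zeta> \<le> C0 * (m \<zeta> powr (- a) * l \<zeta> powr (- b))" for \<zeta>
  proof -
    have "m \<zeta> powr a * l \<zeta> powr b \<le> C0 * (2 powr real_of_int (fst \<zeta>)) powr \<beta>"
      using balanced'[of "2 powr real_of_int (fst \<zeta>)" "snd \<zeta>"] by (simp add: m_def l_def \<beta>_def)
    also have "\<dots> = C0 / c \<zeta>"
      unfolding c_def by (simp add: powr_powr powr_minus field_simps)
    finally show ?thesis
      using ml_pos[of \<zeta>] by (simp add: c_def powr_minus field_simps)
  qed
  define C where "C = C1 * (C0 * (C2 powr \<theta> * C3 powr (1 - \<theta>)))"
  show ?thesis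
  proof (intro exI[of _ C] conjI allI impI, goal_cases)
    case 1
    show ?case using C1 C2 C3 C0_pos by (simp add: C_def)
  next
    case (2 f g)
    note f [measurable] = 2(1) and f0 = 2(2) and g [measurable] = 2(3) and g0 = 2(4)
    define F where "F \<zeta> = (\<integral>\<^sup>+y. indicator {y. in_scale \<zeta> y} y * ennreal (f y) \<partial>Ms)" for \<zeta>
    define G where "G \<zeta> = (\<integral>\<^sup>+y. indicator {y. in_scale \<zeta> y} y * ennreal (g y) \<partial>Mu)" for \<zeta>
    have inm: "Measurable.pred (scales \<Otimes>\<^sub>M Ms) (\<lambda>(\<zeta>, y). in_scale \<zeta> y)"
      "Measurable.pred (scales \<Otimes>\<^sub>M Mu) (\<lambda>(\<zeta>, y). in_scale \<zeta> y)"
      by (rule in_scale_measurable, simp)+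
    note [measurable] = inm
    have [measurable]: "F \<in> borel_measurable scales"
      unfolding F_def indicator_def mem_Collect_eq by measurable
    have [measurable]: "G \<in> borel_measurable scales"
      unfolding G_def indicator_def mem_Collect_eq by measurable
    have mG: "(\<lambda>\<zeta>. ennreal (m \<zeta> powr T) * (G \<zeta> / ennreal (m \<zeta>)) epowr (T * p2)) \<in> borel_measurable scales"
      by measurable
    have lF: "(\<lambda>\<zeta>. ennreal (l \<zeta> powr T) * (F \<zeta> / ennreal (l \<zeta>)) epowr (T * p)) \<in> borel_measurable scales"
      by measurable
    have A: "(\<integral>\<^sup>+y. ennreal (dist x y powr (- \<beta>)) * ennreal (f y) \<partial>Ms)
       \<le> ennreal C1 * (\<integral>\<^sup>+\<zeta>. ennreal (c \<zeta>) * indicator {\<zeta>. in_scale \<zeta> x} \<zeta> * F \<zeta> \<partial>scales)" for x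
    proof -
      have "(\<integral>\<^sup>+y. ennreal (dist x y powr (- \<beta>)) * ennreal (f y) \<partial>Ms)
        \<le> (\<integral>\<^sup>+y. ennreal C1 * (\<integral>\<^sup>+\<zeta>. ennreal (c \<zeta>) *
       (indicator {\<zeta>. in_scale \<zeta> x} \<zeta> * indicator {\<zeta>. in_scale \<zeta> y} \<zeta>) \<partial>scales) * ennreal (f y) \<partial>Ms)"
        unfolding c_def by (intro nn_integral_mono mult_right_mono C1) simp
      also have "\<dots> = (\<integral>\<^sup>+y. ennreal C1 * (\<integral>\<^sup>+\<zeta>. ennreal (c \<zeta>) *
       indicator {\<zeta>. in_scale \<zeta> x} \<zeta> * (indicator {y. in_scale \<zeta> y} y * ennreal (f y)) \<partial>scales) \<partial>Ms)"
      proof (intro nn_integral_cong, goal_cases)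
        case (1 y)
        have "(\<integral>\<^sup>+\<zeta>. ennreal (c \<zeta>) * (indicator {\<zeta>. in_scale \<zeta> x} \<zeta> * indicator {\<zeta>. in_scale \<zeta> y} \<zeta>) \<partial>scales) * ennreal (f y)
          = (\<integral>\<^sup>+\<zeta>. ennreal (c \<zeta>) * (indicator {\<zeta>. in_scale \<zeta> x} \<zeta> * indicator {\<zeta>. in_scale \<zeta> y} \<zeta>) * ennreal (f y) \<partial>scales)"
          by (rule nn_integral_multc[symmetric]) measurable
        also have "\<dots> = (\<integral>\<^sup>+\<zeta>. ennreal (c \<zeta>) * indicator {\<zeta>. in_scale \<zeta> x} \<zeta> * (indicator {y. in_scale \<zeta> y} y * ennreal (f y)) \<partial>scales)"
          by (intro nn_integral_cong) (simp add: indicator_def)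
        finally show ?case by (simp only: mult.assoc)
      qed
      also have "\<dots> = ennreal C1 * (\<integral>\<^sup>+y. (\<integral>\<^sup>+\<zeta>. ennreal (c \<zeta>) *
       indicator {\<zeta>. in_scale \<zeta> x} \<zeta> * (indicator {y. in_scale \<zeta> y} y * ennreal (f y)) \<partial>scales) \<partial>Ms)"
        by (intro nn_integral_cmult) (simp add: indicator_def, measurable)
      also have "(\<integral>\<^sup>+y. (\<integral>\<^sup>+\<zeta>. ennreal (c \<zeta>) *
       indicator {\<zeta>. in_scale \<zeta> x} \<zeta> * (indicator {y. in_scale \<zeta> y} y * ennreal (f y)) \<partial>scales) \<partial>Ms)
        = (\<integral>\<^sup>+\<zeta>. (\<integral>\<^sup>+y. ennreal (c \<zeta>) *
       indicator {\<zeta>. in_scale \<zeta> x} \<zeta> * (indicator {y. in_scale \<zeta> y} y * ennreal (f y)) \<partial>Ms) \<partial>scales)"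
        by (intro ss.Fubini') (simp add: case_prod_beta indicator_def, measurable)
      also have "\<dots> = (\<integral>\<^sup>+\<zeta>. ennreal (c \<zeta>) * indicator {\<zeta>. in_scale \<zeta> x} \<zeta> * F \<zeta> \<partial>scales)"
        unfolding F_def
        by (intro nn_integral_cong nn_integral_cmult) (simp add: indicator_def in_scale_def)
      finally show ?thesis .
    qed
    have "(\<integral>\<^sup>+x. ennreal (g x) * (\<integral>\<^sup>+y. ennreal (dist x y powr (- \<beta>)) * ennreal (f y) \<partial>Ms) \<partial>Mu)
      \<le> (\<integral>\<^sup>+x. ennreal (g x) * (ennreal C1 * (\<integral>\<^sup>+\<zeta>. ennreal (c \<zeta>) * indicator {\<zeta>. in_scale \<zeta> x} \<zeta> * F \<zeta> \<partial>scales)) \<partial>Mu)"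
      by (intro nn_integral_mono mult_left_mono A) simp
    also have "\<dots> = (\<integral>\<^sup>+x. ennreal C1 * (\<integral>\<^sup>+\<zeta>. ennreal (c \<zeta>) * F \<zeta> * (indicator {x. in_scale \<zeta> x} x * ennreal (g x)) \<partial>scales) \<partial>Mu)"
    proof (intro nn_integral_cong, goal_cases)
      case (1 x)
      have "ennreal (g x) * (\<integral>\<^sup>+\<zeta>. ennreal (c \<zeta>) * indicator {\<zeta>. in_scale \<zeta> x} \<zeta> * F \<zeta> \<partial>scales)
        = (\<integral>\<^sup>+\<zeta>. ennreal (g x) * (ennreal (c \<zeta>) * indicator {\<zeta>. in_scale \<zeta> x} \<zeta> * F \<zeta>) \<partial>scales)"
        by (rule nn_integral_cmult[symmetric]) measurable
      also have "\<dots> = (\<integral>\<^sup>+\<zeta>. ennreal (c \<zeta>) * F \<zeta> * (indicator {x. in_scale \<zeta> x} x * ennreal (g x)) \<partial>scales)"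
        by (intro nn_integral_cong) (simp add: indicator_def ac_simps)
      finally show ?case by (simp add: mult.left_commute)
    qed
    also have "\<dots> = ennreal C1 * (\<integral>\<^sup>+x. (\<integral>\<^sup>+\<zeta>. ennreal (c \<zeta>) * F \<zeta> * (indicator {x. in_scale \<zeta> x} x * ennreal (g x)) \<partial>scales) \<partial>Mu)"
      by (intro nn_integral_cmult) (simp add: indicator_def, measurable)
    also have "(\<integral>\<^sup>+x. (\<integral>\<^sup>+\<zeta>. ennreal (c \<zeta>) * F \<zeta> * (indicator {x. in_scale \<zeta> x} x * ennreal (g x)) \<partial>scales) \<partial>Mu)
      = (\<integral>\<^sup>+\<zeta>. (\<integral>\<^sup>+x. ennreal (c \<zeta>) * F \<zeta> * (indicator {x. in_scale \<zeta> x} x * ennreal (g x)) \<partial>Mu) \<partial>scales)"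
      by (intro us.Fubini') (simp add: case_prod_beta indicator_def, measurable)
    also have "\<dots> = (\<integral>\<^sup>+\<zeta>. ennreal (c \<zeta>) * F \<zeta> * G \<zeta> \<partial>scales)"
      unfolding G_def
      by (intro nn_integral_cong nn_integral_cmult) (simp add: indicator_def in_scale_def)
    also have "\<dots> \<le> (\<integral>\<^sup>+\<zeta>. ennreal C0 * ((ennreal (m \<zeta> powr T) * (G \<zeta> / ennreal (m \<zeta>)) epowr (T * p2)) epowr \<theta> *
        (ennreal (l \<zeta> powr T) * (F \<zeta> / ennreal (l \<zeta>)) epowr (T * p)) epowr (1 - \<theta>)) \<partial>scales)"
    proof (intro nn_integral_mono, goal_cases)
      case (1 \<zeta>)
      \<comment> \<open>The exponents undo each other: \<open>m powr (1 - a)\<close> times the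
        average \<open>G / m\<close> is \<open>m powr (- a) * G\<close>, one of the two factors
        supplied by \<open>c_le\<close>.\<close>
      have e1: "(ennreal (m \<zeta> powr T) * (G \<zeta> / ennreal (m \<zeta>)) epowr (T * p2)) epowr \<theta> = ennreal (m \<zeta> powr (- a)) * G \<zeta>"
      proof -
        have "(ennreal (m \<zeta> powr T) * (G \<zeta> / ennreal (m \<zeta>)) epowr (T * p2)) epowr \<theta> = ennreal (m \<zeta> powr (1 - a)) * (G \<zeta> / ennreal (m \<zeta>))"
          by (simp add: epowr_mult epowr_epowr powr_powr \<theta>T)
        also have "\<dots> = ennreal (m \<zeta> powr (1 - a)) * ennreal (1 / m \<zeta>) * G \<zeta>"
          using ml_pos[of \<zeta>] by (simp add: divide_ennreal_def inverse_ennreal inverse_eq_divide ac_simps)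
        also have "ennreal (m \<zeta> powr (1 - a)) * ennreal (1 / m \<zeta>) = ennreal (m \<zeta> powr (- a))"
          using ml_pos[of \<zeta>] by (subst ennreal_mult[symmetric]) (auto simp: powr_diff powr_minus field_simps)
        finally show ?thesis .
      qed
      have e2: "(ennreal (l \<zeta> powr T) * (F \<zeta> / ennreal (l \<zeta>)) epowr (T * p)) epowr (1 - \<theta>) = ennreal (l \<zeta> powr (- b)) * F \<zeta>"
      proof -
        have "(ennreal (l \<zeta> powr T) * (F \<zeta> / ennreal (l \<zeta>)) epowr (T * p)) epowr (1 - \<theta>) = ennreal (l \<zeta> powr (1 - b)) * (F \<zeta> / ennreal (l \<zeta>))"
          by (simp add: epowr_mult epowr_epowr powr_powr \<theta>T)
        also have "\<dots> = ennreal (l \<zeta> powr (1 - b)) * ennreal (1 / l \<zeta>) * F \<zeta>"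
          using ml_pos[of \<zeta>] by (simp add: divide_ennreal_def inverse_ennreal inverse_eq_divide ac_simps)
        also have "ennreal (l \<zeta> powr (1 - b)) * ennreal (1 / l \<zeta>) = ennreal (l \<zeta> powr (- b))"
          using ml_pos[of \<zeta>] by (subst ennreal_mult[symmetric]) (auto simp: powr_diff powr_minus field_simps)
        finally show ?thesis .
      qed
      have "ennreal (c \<zeta>) \<le> ennreal (C0 * (m \<zeta> powr (- a) * l \<zeta> powr (- b)))"
        by (intro ennreal_leI c_le)
      also have "\<dots> = ennreal C0 * (ennreal (m \<zeta> powr (- a)) * ennreal (l \<zeta> powr (- b)))"
        using C0_pos by (simp add: ennreal_mult)
      finally have "ennreal (c \<zeta>) * F \<zeta> * G \<zeta> \<le> ennreal C0 * (ennreal (m \<zeta> powr (- a)) * ennreal (l \<zeta> powr (- b))) * F \<zeta> * G \<zeta>"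
        by (intro mult_right_mono) auto
      then show ?case
        unfolding e1 e2 by (simp only: ac_simps)
    qed
    also have "\<dots> = ennreal C0 * (\<integral>\<^sup>+\<zeta>. (ennreal (m \<zeta> powr T) * (G \<zeta> / ennreal (m \<zeta>)) epowr (T * p2)) epowr \<theta> *
        (ennreal (l \<zeta> powr T) * (F \<zeta> / ennreal (l \<zeta>)) epowr (T * p)) epowr (1 - \<theta>) \<partial>scales)"
      by (intro nn_integral_cmult) measurable
    also have "\<dots> \<le> ennreal C0 * ((\<integral>\<^sup>+\<zeta>. ennreal (m \<zeta> powr T) * (G \<zeta> / ennreal (m \<zeta>)) epowr (T * p2) \<partial>scales) epowr \<theta> *
        (\<integral>\<^sup>+\<zeta>. ennreal (l \<zeta> powr T) * (F \<zeta> / ennreal (l \<zeta>)) epowr (T * p) \<partial>scales) epowr (1 - \<theta>))"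
      by (intro mult_left_mono nn_integral_Hoelder[OF mG lF \<theta>(1,2)]) simp
    also have "\<dots> \<le> ennreal C0 * ((ennreal C2 * (\<integral>\<^sup>+y. ennreal (g y powr p2) \<partial>Mu) epowr T) epowr \<theta> *
       (ennreal C3 * (\<integral>\<^sup>+y. ennreal (f y powr p) \<partial>Ms) epowr T) epowr (1 - \<theta>))"
      unfolding F_def G_def using \<theta>
      by (intro mult_left_mono mult_mono epowr_mono C2 C3 f f0 g g0) auto
    also have "\<dots> = ennreal (C0 * (C2 powr \<theta> * C3 powr (1 - \<theta>))) * ((\<integral>\<^sup>+y. ennreal (g y powr p2) \<partial>Mu) epowr (1 - a) * (\<integral>\<^sup>+y. ennreal (f y powr p) \<partial>Ms) epowr (1 - b))"
      using C0_pos C2 C3 by (simp add: epowr_mult epowr_epowr \<theta>T ennreal_mult ac_simps)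
    finally show ?case
      unfolding \<beta>_def[symmetric] p_def[symmetric] p2_def[symmetric] C_def
      using C1 C0_pos C2 C3 by (simp add: ennreal_mult mult_left_mono mult.assoc)
  qed
qed

text \<open>Duality. Testing the bilinear form with a power of a truncation of the potential gives
  \<open>?Y \<le> ?Y epowr (1 - a) * X\<close>. Truncation keeps \<open>?Y\<close> finite, so the
  power can be divided out, and monotone convergence then removes the truncation.\<close>

lemma Riesz_strong_type:
  assumes ab: "a + b < 1"
  shows "\<exists>C>0. \<forall>f :: 'a \<Rightarrow> real. f \<in> borel_measurable borel \<longrightarrow> (\<forall>y. 0 \<le> f y) \<longrightarrow>
    (\<integral>\<^sup>+x. (\<integral>\<^sup>+y. ennreal (dist x y powr (- (DIM('a) * (a + b)))) * ennreal (f y) \<partial>Ms) epowr (1 / a) \<partial>Mu) epowr a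
     \<le> ennreal C * (\<integral>\<^sup>+y. ennreal (f y powr (1 / (1 - b))) \<partial>Ms) epowr (1 - b)"
proof -
  interpret dual: dual_weights s u b a C0 by (rule dual_weights_sym)
  interpret s: sigma_finite_measure Ms by (rule dual.sigma_finite_Mu)
  obtain C where C: "0 < C" "\<And>(f :: 'a \<Rightarrow> real) (g :: 'a \<Rightarrow> real).
    f \<in> borel_measurable borel \<Longrightarrow> (\<forall>y. 0 \<le> f y) \<Longrightarrow> g \<in> borel_measurable borel \<Longrightarrow> (\<forall>x. 0 \<le> g x) \<Longrightarrow>
    (\<integral>\<^sup>+x. ennreal (g x) * (\<integral>\<^sup>+y. ennreal (dist x y powr (- (DIM('a) * (a + b)))) * ennreal (f y) \<partial>Ms) \<partial>Mu)
     \<le> ennreal C * ((\<integral>\<^sup>+x. ennreal (g x powr (1 / (1 - a))) \<partial>Mu) epowr (1 - a) *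
         (\<integral>\<^sup>+y. ennreal (f y powr (1 / (1 - b))) \<partial>Ms) epowr (1 - b))"
    using Riesz_bilinear[OF ab] by blast
  have a1: "a < 1" using ab b_pos by simp
  show ?thesis
  proof (intro exI[of _ C] conjI allI impI, goal_cases)
    case 1
    show ?case by fact
  next
    case (2 f)
    note f [measurable] = 2(1) and f0 = 2(2)
    define R where "R x = (\<integral>\<^sup>+y. ennreal (dist x y powr (- (DIM('a) * (a + b)))) * ennreal (f y) \<partial>Ms)" for x
    have [measurable]: "R \<in> borel_measurable borel" unfolding R_def by measurable
    define X where "X = ennreal C * (\<integral>\<^sup>+y. ennreal (f y powr (1 / (1 - b))) \<partial>Ms) epowr (1 - b)"
    \<comment> \<open>Both the values and the support are cut. Where the potential is infinite,
      \<open>h N x\<close> equals \<open>N\<close> for large \<open>N\<close>, so the supremum over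
      \<open>N\<close> recovers it there too.\<close>
    define h where "h N x = indicator (ball 0 (real N)) x * min (R x) (of_nat N)" for N and x :: 'a
    have [measurable]: "h N \<in> borel_measurable borel" for N
      unfolding h_def by (intro borel_measurable_times_ennreal borel_measurable_indicator borel_measurable_min) auto
    have h_fin: "h N x < top" for N x by (auto simp: h_def min_less_iff_disj ennreal_of_nat_eq_real_of_nat split: split_indicator)
    have trunc: "(\<integral>\<^sup>+x. h N x epowr (1 / a) \<partial>Mu) epowr a \<le> X" for N
    proof -
      let ?Y = "\<integral>\<^sup>+x. h N x epowr (1 / a) \<partial>Mu"
      \<comment> \<open>With this exponent the power \<open>1 / (1 - a)\<close> of \<open>g\<close>
        is the power \<open>1 / a\<close> of \<open>h N\<close>, so the same integral
        \<open>?Y\<close> appears on both sides.\<close>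
      define g where "g x = enn2real (h N x) powr (1 / a - 1)" for x
      have h_eq: "h N x = ennreal (enn2real (h N x))" for x
        using h_fin[of N x] by simp
      have g_pow: "ennreal (g x powr (1 / (1 - a))) = h N x epowr (1 / a)" for x
      proof -
        have "(1 / a - 1) * (1 / (1 - a)) = 1 / a" using a1 a_pos by (simp add: field_simps)
        then have "g x powr (1 / (1 - a)) = enn2real (h N x) powr (1 / a)"
          unfolding g_def powr_powr by simp
        then show ?thesis using h_eq[of x] by (metis enn2real_nonneg epowr_ennreal)
      qed
      have "?Y \<le> (\<integral>\<^sup>+x. ennreal (g x) * R x \<partial>Mu)"
      proof (intro nn_integral_mono, goal_cases)
        case (1 x)
        have "h N x epowr (1 / a) = h N x epowr (1 / a - 1) * h N x"
          using epowr_add[of "h N x" "1 / a - 1" 1] by simp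
        also have "h N x epowr (1 / a - 1) = ennreal (g x)"
          unfolding g_def using h_eq[of x] by (metis enn2real_nonneg epowr_ennreal)
        also have "ennreal (g x) * h N x \<le> ennreal (g x) * R x"
          by (intro mult_left_mono) (auto simp: h_def split: split_indicator)
        finally show ?case .
      qed
      also have "\<dots> \<le> ennreal C * ((\<integral>\<^sup>+x. ennreal (g x powr (1 / (1 - a))) \<partial>Mu) epowr (1 - a) *
         (\<integral>\<^sup>+y. ennreal (f y powr (1 / (1 - b))) \<partial>Ms) epowr (1 - b))"
        unfolding R_def by (intro C f f0) (auto simp: g_def)
      also have "\<dots> = ?Y epowr (1 - a) * X"
        by (simp add: g_pow X_def ac_simps)
      finally have Y: "?Y \<le> ?Y epowr (1 - a) * X" .
      have "?Y \<le> (\<integral>\<^sup>+x. ennreal (real N powr (1 / a)) * indicator (ball 0 (real N)) x \<partial>Mu)"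
      proof (intro nn_integral_mono, goal_cases)
        case (1 x)
        have "h N x epowr (1 / a) \<le> (of_nat N * indicator (ball 0 (real N)) x) epowr (1 / a)"
          using a_pos by (intro epowr_mono) (auto simp: h_def split: split_indicator)
        also have "\<dots> = ennreal (real N powr (1 / a)) * indicator (ball 0 (real N)) x"
          by (auto simp: ennreal_of_nat_eq_real_of_nat split: split_indicator)
        finally show ?case .
      qed
      also have "\<dots> = ennreal (real N powr (1 / a)) * emeasure Mu (ball 0 (real N))"
        by (intro nn_integral_cmult_indicator) simp
      also have "\<dots> < top"
        by (simp add: emeasure_u_ball ennreal_mult[symmetric])
      finally have "?Y < top" .
      then obtain Yr where Yr: "?Y = ennreal Yr" "0 \<le> Yr"
        by (cases ?Y rule: ennreal_cases) auto
      show ?thesis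
      proof (cases "Yr = 0")
        case True
        then show ?thesis using Yr by simp
      next
        case False
        with Yr have pos: "0 < Yr" by simp
        have "ennreal (Yr powr (- (1 - a))) * ennreal Yr \<le> ennreal (Yr powr (- (1 - a))) * (ennreal (Yr powr (1 - a)) * X)"
          using Y Yr by (intro mult_left_mono) auto
        also have "\<dots> = ennreal (Yr powr (- (1 - a)) * Yr powr (1 - a)) * X"
          by (simp add: ennreal_mult mult.assoc)
        also have "Yr powr (- (1 - a)) * Yr powr (1 - a) = 1"
          unfolding powr_add[symmetric] using pos by simp
        also have "ennreal (Yr powr (- (1 - a))) * ennreal Yr = ennreal (Yr powr a)"
        proof -
          have "Yr powr (- (1 - a)) * Yr powr 1 = Yr powr a" unfolding powr_add[symmetric] by simp
          then show ?thesis using pos by (simp add: ennreal_mult[symmetric])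
        qed
        finally show ?thesis using Yr by simp
      qed
    qed
    have "(\<integral>\<^sup>+x. R x epowr (1 / a) \<partial>Mu) \<le> (\<integral>\<^sup>+x. (SUP N. h N x epowr (1 / a)) \<partial>Mu)"
    proof (intro nn_integral_mono, goal_cases)
      case (1 x)
      show ?case
      proof (cases "R x" rule: ennreal_cases)
        case (real r)
        obtain N where N: "max r (norm x) < real N" using reals_Archimedean2 by blast
        then have "h N x = R x"
          using real by (auto simp: h_def ennreal_of_nat_eq_real_of_nat min_def ennreal_le_iff2 split: split_indicator)
        then show ?thesis by (metis SUP_upper UNIV_I)
      next
        case top
        have "of_nat n \<le> (SUP N. h N x epowr (1 / a))" for n :: nat
        proof -
          obtain N where N: "max (real n powr a) (norm x) < real N" using reals_Archimedean2 by blast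
          then have h: "h N x = ennreal (real N)"
            using top by (auto simp: h_def ennreal_of_nat_eq_real_of_nat min_def top_unique)
          have "real n = (real n powr a) powr (1 / a)" using a_pos by (simp add: powr_powr)
          also have "\<dots> \<le> real N powr (1 / a)" using N a_pos by (intro powr_mono2) auto
          finally have "of_nat n \<le> h N x epowr (1 / a)"
            using h by (simp add: ennreal_of_nat_eq_real_of_nat ennreal_leI)
          also have "\<dots> \<le> (SUP N. h N x epowr (1 / a))" by (rule SUP_upper) simp
          finally show ?thesis .
        qed
        then have "(SUP N. h N x epowr (1 / a)) = top"
          by (metis ennreal_Ex_less_of_nat linorder_not_le top.not_eq_extremum)
        then show ?thesis by (simp only: top_greatest)
      qed
    qed
    also have "\<dots> = (SUP N. (\<integral>\<^sup>+x. h N x epowr (1 / a) \<partial>Mu))"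
    proof (rule nn_integral_monotone_convergence_SUP)
      show "incseq (\<lambda>N x. h N x epowr (1 / a))"
        using a_pos by (auto simp: incseq_def le_fun_def h_def intro!: epowr_mono mult_mono min.mono split: split_indicator)
    qed simp
    also have "\<dots> \<le> X epowr (1 / a)"
    proof (intro SUP_least)
      fix N
      have "((\<integral>\<^sup>+x. h N x epowr (1 / a) \<partial>Mu) epowr a) epowr (1 / a) \<le> X epowr (1 / a)"
        using a_pos by (intro epowr_mono trunc) auto
      then show "(\<integral>\<^sup>+x. h N x epowr (1 / a) \<partial>Mu) \<le> X epowr (1 / a)"
        using a_pos by (simp add: epowr_epowr)
    qed
    finally have "(\<integral>\<^sup>+x. R x epowr (1 / a) \<partial>Mu) epowr a \<le> (X epowr (1 / a)) epowr a"
      using a_pos by (intro epowr_mono) auto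
    then show ?case
      using a_pos by (simp add: epowr_epowr R_def X_def)
  qed
qed

end

section \<open>Morrey bounds for the Riesz potential\<close>

text \<open>The unnormalised Riesz potential of order \<open>DIM('a) - \<beta>\<close>, indexed by
  the decay \<beta> of its kernel, which is \<open>DIM('a) * (a + b)\<close> for the strong type and
  \<open>DIM('a) / q\<close> at the endpoint.\<close>

definition Riesz :: "real \<Rightarrow> ('a::euclidean_space \<Rightarrow> ennreal) \<Rightarrow> 'a \<Rightarrow> ennreal" where
  "Riesz \<beta> F x = (\<integral>\<^sup>+y. ennreal (dist x y powr (- \<beta>)) * F y \<partial>lborel)"

lemma Riesz_measurable [measurable]:
  assumes [measurable]: "F \<in> borel_measurable borel"
  shows "Riesz \<beta> F \<in> borel_measurable borel"
  unfolding Riesz_def by measurable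

lemma Riesz_split:
  assumes [measurable]: "F \<in> borel_measurable borel" "A \<in> sets borel"
  shows "Riesz \<beta> F x = Riesz \<beta> (\<lambda>y. F y * indicator A y) x + Riesz \<beta> (\<lambda>y. F y * indicator (- A) y) x"
  unfolding Riesz_def
  by (subst nn_integral_add[symmetric]) (auto intro!: nn_integral_cong split: split_indicator)

lemma epowr_add_le:
  assumes c: "0 \<le> c"
  shows "(x + y) epowr c \<le> ennreal (2 powr c) * (x epowr c + y epowr c)"
proof -
  have "x + y \<le> 2 * max x y"
    by (simp add: mult_2 add_mono)
  then have "(x + y) epowr c \<le> (2 * max x y) epowr c"
    using c by (rule epowr_mono)
  also have "\<dots> = ennreal (2 powr c) * max x y epowr c"
    using epowr_ennreal[of 2 c] by (simp add: epowr_mult)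
  also have "max x y epowr c \<le> x epowr c + y epowr c"
    by (simp add: max_def add_increasing add_increasing2)
  finally show ?thesis by (simp add: mult_left_mono)
qed

text \<open>The index is shifted so that \<open>i = 0\<close> is the first annulus outside the
  doubled ball. Moving from the centre to a point of the ball of radius \<open>r\<close> then still
  leaves a distance of at least \<open>2 ^ i * r\<close>.\<close>

lemma dyadic_annulus:
  fixes d r :: real
  assumes "0 < r" "2 * r \<le> d"
  obtains i where "2 ^ (i + 1) * r \<le> d" "d < 2 ^ (i + 2) * r"
proof -
  obtain n where "d / r < 2 ^ n" using real_arch_pow[of 2 "d / r"] by auto
  then have ex: "\<exists>n. d < 2 ^ n * r" using assms by (auto simp: field_simps)
  define n where "n = (LEAST n. d < 2 ^ n * r)"
  have n: "d < 2 ^ n * r" unfolding n_def using ex by (rule LeastI_ex)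
  have "2 \<le> n"
  proof (rule ccontr)
    assume "\<not> 2 \<le> n"
    then have "n = 0 \<or> n = 1" by auto
    with n assms show False by auto
  qed
  then obtain i where i: "n = i + 2" using le_Suc_ex by (metis add.commute)
  have "\<not> d < 2 ^ (i + 1) * r"
    using not_less_Least[of "i + 1" "\<lambda>n. d < 2 ^ n * r"] i by (simp add: n_def[symmetric])
  with n i show ?thesis by (intro that[of i]) auto
qed

context dual_weights
begin

text \<open>On the annulus of index \<open>i\<close> the kernel is at most \<open>K i\<close>, and
  the growth hypothesis on the ball of radius \<open>R i\<close> cancels this up to
  \<open>4 powr \<beta>\<close>. A sum of negative powers of masses remains, to which
  \<open>geometric_large_scales\<close> applies. The exponent \<beta> is left free because at the
  endpoint the kernel exponent is \<open>DIM('a) / q\<close>, not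
  \<open>DIM('a) * (a + b)\<close>.\<close>

lemma Riesz_far:
  assumes \<beta>: "0 < \<beta>" and \<delta>: "0 < \<delta>"
  shows "\<exists>C>0. \<forall>(F :: 'a \<Rightarrow> ennreal) N. F \<in> borel_measurable borel \<longrightarrow>
    (\<forall>c r. 0 < r \<longrightarrow> (\<integral>\<^sup>+y\<in>ball c r. F y \<partial>lborel) \<le> ennreal (r powr \<beta> * U c r powr (- \<delta>)) * N) \<longrightarrow>
    (\<forall>c r x. 0 < r \<longrightarrow> x \<in> ball c r \<longrightarrow>
      Riesz \<beta> (\<lambda>y. F y * indicator (- ball c (2 * r)) y) x \<le> ennreal (C * U c r powr (- \<delta>)) * N)"
proof -
  obtain C1 where C1: "0 < C1"
    "\<And>c r. 0 < r \<Longrightarrow> suminf (\<lambda>i. ennreal (U c (2 ^ i * r) powr (- \<delta>))) \<le> ennreal (C1 * U c r powr (- \<delta>))"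
    using geometric_large_scales[OF \<delta>] by blast
  show ?thesis
  proof (intro exI[of _ "4 powr \<beta> * C1"] conjI allI impI, goal_cases)
    case 1
    show ?case using C1 by simp
  next
    case (2 F N c r x)
    note F [measurable] = 2(1) and hyp = 2(2) and r = 2(3) and x = 2(4)
    define K where "K i = (2 ^ i * r) powr (- \<beta>)" for i :: nat
    define R where "R i = 2 ^ (i + 2) * r" for i :: nat
    have R: "0 < R i" for i using r by (simp add: R_def)
    have m [measurable]: "(\<lambda>y. F y * indicator (ball c (R i)) y) \<in> borel_measurable borel" for i
      by (intro borel_measurable_times_ennreal borel_measurable_indicator F) simp
    have pt: "ennreal (dist x y powr (- \<beta>)) * (F y * indicator (- ball c (2 * r)) y)
      \<le> suminf (\<lambda>i. ennreal (K i) * (F y * indicator (ball c (R i)) y))" for y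
    proof (cases "y \<in> ball c (2 * r)")
      case False
      then have "2 * r \<le> dist c y" by simp
      then obtain i where i: "2 ^ (i + 1) * r \<le> dist c y" "dist c y < 2 ^ (i + 2) * r"
        using dyadic_annulus[OF r] by blast
      have "dist c y \<le> dist c x + dist x y" by (rule dist_triangle)
      moreover have "r \<le> 2 ^ i * r" using r by simp
      moreover have "2 ^ (i + 1) * r = 2 ^ i * r + 2 ^ i * r" by simp
      ultimately have "2 ^ i * r \<le> dist x y" using x i by simp
      then have "dist x y powr (- \<beta>) \<le> K i"
        unfolding K_def using r \<beta> by (intro powr_mono2') auto
      then have "ennreal (dist x y powr (- \<beta>)) * (F y * indicator (- ball c (2 * r)) y) \<le> ennreal (K i) * (F y * indicator (ball c (R i)) y)"
        using i by (intro mult_mono) (auto simp: R_def ennreal_leI split: split_indicator)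
      also have "\<dots> \<le> suminf (\<lambda>i. ennreal (K i) * (F y * indicator (ball c (R i)) y))"
        using sum_le_suminf[of "\<lambda>i. ennreal (K i) * (F y * indicator (ball c (R i)) y)" "{i}"] by simp
      finally show ?thesis .
    qed simp
    have "Riesz \<beta> (\<lambda>y. F y * indicator (- ball c (2 * r)) y) x
      \<le> (\<integral>\<^sup>+y. suminf (\<lambda>i. ennreal (K i) * (F y * indicator (ball c (R i)) y)) \<partial>lborel)"
      unfolding Riesz_def by (intro nn_integral_mono pt)
    also have "\<dots> = suminf (\<lambda>i. \<integral>\<^sup>+y. ennreal (K i) * (F y * indicator (ball c (R i)) y) \<partial>lborel)"
      by (rule nn_integral_suminf) (auto intro: borel_measurable_times_ennreal[OF _ m])
    also have "\<dots> = suminf (\<lambda>i. ennreal (K i) * (\<integral>\<^sup>+y\<in>ball c (R i). F y \<partial>lborel))"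
      by (intro arg_cong[where f = suminf] ext nn_integral_cmult) simp
    also have "\<dots> \<le> suminf (\<lambda>i. ennreal (4 powr \<beta>) * N * ennreal (U c (2 ^ i * r) powr (- \<delta>)))"
    proof (rule suminf_le)
      fix i
      have "ennreal (K i) * (\<integral>\<^sup>+y\<in>ball c (R i). F y \<partial>lborel) \<le> ennreal (K i) * (ennreal (R i powr \<beta> * U c (R i) powr (- \<delta>)) * N)"
        using hyp R[of i] by (intro mult_left_mono) auto
      also have "\<dots> = ennreal (K i * R i powr \<beta> * U c (R i) powr (- \<delta>)) * N"
        by (simp add: ennreal_mult K_def mult.assoc)
      also have "K i * R i powr \<beta> = 4 powr \<beta>"
        using r by (simp add: K_def R_def powr_mult powr_minus field_simps)
      \<comment> \<open>The exponent of the mass is negative, so shrinking the radius to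
        \<open>2 ^ i * r\<close> only enlarges the term; it then matches the series.\<close>
      also have "4 powr \<beta> * U c (R i) powr (- \<delta>) \<le> 4 powr \<beta> * U c (2 ^ i * r) powr (- \<delta>)"
      proof (intro mult_left_mono powr_mono2')
        show "0 < U c (2 ^ i * r)" using r by (intro U_pos) simp
        show "U c (2 ^ i * r) \<le> U c (R i)" using r by (intro U_mono subset_ball) (simp add: R_def)
      qed (use \<delta> in auto)
      finally show "ennreal (K i) * (\<integral>\<^sup>+y\<in>ball c (R i). F y \<partial>lborel)
        \<le> ennreal (4 powr \<beta>) * N * ennreal (U c (2 ^ i * r) powr (- \<delta>))"
        by (simp add: ennreal_mult ac_simps ennreal_leI mult_left_mono)
    qed auto
    also have "\<dots> = ennreal (4 powr \<beta>) * N * suminf (\<lambda>i. ennreal (U c (2 ^ i * r) powr (- \<delta>)))"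
      by (rule ennreal_suminf_cmult)
    also have "\<dots> \<le> ennreal (4 powr \<beta>) * N * ennreal (C1 * U c r powr (- \<delta>))"
      by (intro mult_left_mono C1 r) simp
    also have "\<dots> = ennreal (4 powr \<beta> * C1 * U c r powr (- \<delta>)) * N"
      using C1 by (simp add: ennreal_mult ac_simps)
    finally show ?case .
  qed
qed

text \<open>The substitution \<open>f = F / s\<close> returns to Lebesgue measure: as
  \<open>b * p = p - 1\<close>, the relation \<open>dual\<close> turns
  \<open>s * (F / s) powr p\<close> into \<open>F powr p * u powr (a * p)\<close>. In the
  application \<open>u powr a\<close> is \<open>w\<close>, so this is the weight
  \<open>w powr p\<close>.\<close>

lemma Riesz_strong_type_lborel:
  assumes ab: "a + b < 1"
  defines "p \<equiv> 1 / (1 - b)"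
  shows "\<exists>C>0. \<forall>F :: 'a \<Rightarrow> real. F \<in> borel_measurable borel \<longrightarrow> (\<forall>y. 0 \<le> F y) \<longrightarrow>
    (\<integral>\<^sup>+x. Riesz (DIM('a) * (a + b)) F x epowr (1 / a) * ennreal (u x) \<partial>lborel) epowr a
     \<le> ennreal C * (\<integral>\<^sup>+y. ennreal (F y powr p * u y powr (a * p)) \<partial>lborel) epowr (1 - b)"
proof -
  have b1: "b < 1" using ab a_pos by simp
  obtain C where C: "0 < C" "\<And>f :: 'a \<Rightarrow> real. f \<in> borel_measurable borel \<Longrightarrow> (\<forall>y. 0 \<le> f y) \<Longrightarrow>
    (\<integral>\<^sup>+x. (\<integral>\<^sup>+y. ennreal (dist x y powr (- (DIM('a) * (a + b)))) * ennreal (f y) \<partial>Ms) epowr (1 / a) \<partial>Mu) epowr a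
     \<le> ennreal C * (\<integral>\<^sup>+y. ennreal (f y powr (1 / (1 - b))) \<partial>Ms) epowr (1 - b)"
    using Riesz_strong_type[OF ab] by blast
  show ?thesis
  proof (intro exI[of _ C] conjI allI impI, goal_cases)
    case 1
    show ?case by fact
  next
    case (2 F)
    note F [measurable] = 2(1) and F0 = 2(2)
    have s0: "s y \<noteq> 0" for y using s_pos[of y] by simp
    have eq1: "(\<integral>\<^sup>+y. ennreal (dist x y powr (- (DIM('a) * (a + b)))) * ennreal (F y / s y) \<partial>Ms) = Riesz (DIM('a) * (a + b)) F x" for x
    proof -
      have "ennreal (s y) * (ennreal (dist x y powr (- (DIM('a) * (a + b)))) * ennreal (F y / s y)) = ennreal (dist x y powr (- (DIM('a) * (a + b)))) * ennreal (F y)" for y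
        using s_pos[of y] F0 by (simp add: ennreal_mult[symmetric] s0)
      then show ?thesis
        unfolding Riesz_def by (subst nn_integral_density) auto
    qed
    have eq2: "(\<integral>\<^sup>+y. ennreal ((F y / s y) powr p) \<partial>Ms) = (\<integral>\<^sup>+y. ennreal (F y powr p * u y powr (a * p)) \<partial>lborel)"
    proof -
      have "ennreal (s y) * ennreal ((F y / s y) powr p) = ennreal (F y powr p * u y powr (a * p))" for y
      proof -
        have "u y powr (a * p) * s y powr (b * p) = (u y powr a * s y powr b) powr p"
          by (simp add: powr_mult powr_powr)
        then have "u y powr (a * p) * s y powr (b * p) = 1" by (simp add: dual)
        moreover have "s y * s y powr (b * p) = s y powr p"
        proof -
          have "1 + b * p = p" using b1 by (simp add: p_def field_simps)
          then show ?thesis using s_pos[of y] powr_add[of "s y" 1 "b * p"] by simp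
        qed
        ultimately have "s y = u y powr (a * p) * s y powr p"
          by (metis mult.assoc mult.commute mult.right_neutral)
        then have "s y * (F y / s y) powr p = F y powr p * u y powr (a * p)"
          using s_pos[of y] F0 by (simp add: powr_divide field_simps)
        then show ?thesis using s_pos[of y] by (simp add: ennreal_mult[symmetric])
      qed
      then show ?thesis by (subst nn_integral_density) auto
    qed
    have "(\<lambda>y. F y / s y) \<in> borel_measurable borel" "\<forall>y. 0 \<le> F y / s y"
      using F0 s_pos by (auto intro!: divide_nonneg_pos)
    from C(2)[OF this] show ?case
      unfolding eq1 p_def[symmetric] eq2 by (subst (asm) nn_integral_density) (auto simp: mult.commute)
  qed
qed

text \<open>\<open>N\<close> stands for the Morrey norm of \<open>F\<close>. The near part is the
  strong type bound on the doubled ball, with doubling to return to the mass of the ball itself; the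
  far part is \<open>Riesz_far\<close> with decay \<open>a - \<kappa>\<close>.\<close>

lemma Riesz_Morrey:
  assumes ab: "a + b < 1" and \<kappa>: "0 < \<kappa>" "\<kappa> < a"
  defines "p \<equiv> 1 / (1 - b)"
  shows "\<exists>C>0. \<forall>(F :: 'a \<Rightarrow> real) N. F \<in> borel_measurable borel \<longrightarrow> (\<forall>y. 0 \<le> F y) \<longrightarrow>
    (\<forall>c r. 0 < r \<longrightarrow> (\<integral>\<^sup>+y\<in>ball c r. ennreal (F y powr p * u y powr (a * p)) \<partial>lborel) epowr (1 - b)
        \<le> ennreal (U c r powr \<kappa>) * N) \<longrightarrow>
    (\<forall>c r. 0 < r \<longrightarrow> (\<integral>\<^sup>+x\<in>ball c r. Riesz (DIM('a) * (a + b)) F x epowr (1 / a) * ennreal (u x) \<partial>lborel) epowr a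
        \<le> ennreal (C * U c r powr \<kappa>) * N)"
proof -
  interpret dual: dual_weights s u b a C0 by (rule dual_weights_sym)
  have b1: "b < 1" using ab a_pos by simp
  define \<beta> where "\<beta> = DIM('a) * (a + b)"
  have \<beta>: "0 < \<beta>" using a_pos b_pos by (simp add: \<beta>_def)
  obtain C1 where C1: "0 < C1" "\<And>F :: 'a \<Rightarrow> real. F \<in> borel_measurable borel \<Longrightarrow> (\<forall>y. 0 \<le> F y) \<Longrightarrow>
    (\<integral>\<^sup>+x. Riesz \<beta> F x epowr (1 / a) * ennreal (u x) \<partial>lborel) epowr a
     \<le> ennreal C1 * (\<integral>\<^sup>+y. ennreal (F y powr p * u y powr (a * p)) \<partial>lborel) epowr (1 - b)"
    using Riesz_strong_type_lborel[OF ab] unfolding \<beta>_def p_def by blast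
  obtain D where D: "1 \<le> D" "\<And>c r. 0 < r \<Longrightarrow> U c (2 * r) \<le> D * U c r"
    using doubling by blast
  have "0 < a - \<kappa>" using \<kappa> by simp
  from Riesz_far[OF \<beta> \<open>0 < a - \<kappa>\<close>] obtain C2 where C2_pos: "0 < C2" and C2_all: "\<forall>(F :: 'a \<Rightarrow> ennreal) N. F \<in> borel_measurable borel \<longrightarrow>
    (\<forall>c r. 0 < r \<longrightarrow> (\<integral>\<^sup>+y\<in>ball c r. F y \<partial>lborel) \<le> ennreal (r powr \<beta> * U c r powr (- (a - \<kappa>))) * N) \<longrightarrow>
    (\<forall>c r x. 0 < r \<longrightarrow> x \<in> ball c r \<longrightarrow>
      Riesz \<beta> (\<lambda>y. F y * indicator (- ball c (2 * r)) y) x \<le> ennreal (C2 * U c r powr (- (a - \<kappa>))) * N)"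
    by (elim exE conjE)
  note C2 = C2_pos C2_all[rule_format]
  \<comment> \<open>Of the factor 4, one 2 is \<open>(2 powr (1 / a)) powr a\<close>, from splitting
    the potential inside the integral; the other bounds \<open>2 powr a\<close>, from splitting the
    resulting sum of integrals.\<close>
  define C where "C = 4 * (C1 * D powr \<kappa> + C2 * C0)"
  have C_pos: "0 < C" using C1 C2 D C0_pos by (simp add: C_def add_pos_pos)
  show ?thesis
  proof (intro exI[of _ C] conjI allI impI, goal_cases)
    case 1
    show ?case by fact
  next
    case (2 F N c r)
    note F [measurable] = 2(1) and F0 = 2(2) and hyp = 2(3) and r = 2(4)
    define R1 where "R1 = Riesz \<beta> (\<lambda>y. ennreal (F y) * indicator (ball c (2 * r)) y)"
    define R2 where "R2 = Riesz \<beta> (\<lambda>y. ennreal (F y) * indicator (- ball c (2 * r)) y)"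
    have [measurable]: "R1 \<in> borel_measurable borel" "R2 \<in> borel_measurable borel"
      unfolding R1_def R2_def by measurable
    have split: "Riesz \<beta> F x = R1 x + R2 x" for x
      unfolding R1_def R2_def by (intro Riesz_split) auto
    have near: "(\<integral>\<^sup>+x\<in>ball c r. R1 x epowr (1 / a) * ennreal (u x) \<partial>lborel) epowr a \<le> ennreal (C1 * D powr \<kappa> * U c r powr \<kappa>) * N"
    proof -
      let ?F = "\<lambda>y. F y * indicator (ball c (2 * r)) y"
      have R1: "R1 = Riesz \<beta> (\<lambda>y. ennreal (?F y))"
        unfolding R1_def by (intro arg_cong[where f = "Riesz \<beta>"] ext) (auto split: split_indicator)
      have "(\<integral>\<^sup>+x\<in>ball c r. R1 x epowr (1 / a) * ennreal (u x) \<partial>lborel) epowr a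
        \<le> (\<integral>\<^sup>+x. R1 x epowr (1 / a) * ennreal (u x) \<partial>lborel) epowr a"
        using a_pos by (intro epowr_mono nn_integral_mono) (auto split: split_indicator)
      also have "\<dots> \<le> ennreal C1 * (\<integral>\<^sup>+y. ennreal (?F y powr p * u y powr (a * p)) \<partial>lborel) epowr (1 - b)"
        unfolding R1 using F0 by (intro C1) auto
      also have "(\<integral>\<^sup>+y. ennreal (?F y powr p * u y powr (a * p)) \<partial>lborel)
          = (\<integral>\<^sup>+y\<in>ball c (2 * r). ennreal (F y powr p * u y powr (a * p)) \<partial>lborel)"
        by (intro nn_integral_cong) (auto split: split_indicator)
      also have "ennreal C1 * \<dots> epowr (1 - b) \<le> ennreal C1 * (ennreal (U c (2 * r) powr \<kappa>) * N)"
        using hyp r by (intro mult_left_mono) auto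
      also have "\<dots> \<le> ennreal C1 * (ennreal ((D * U c r) powr \<kappa>) * N)"
        using \<kappa> D r by (intro mult_left_mono mult_right_mono ennreal_leI powr_mono2) auto
      also have "\<dots> = ennreal (C1 * D powr \<kappa> * U c r powr \<kappa>) * N"
        using C1 D by (simp add: powr_mult ennreal_mult mult.assoc)
      finally show ?thesis .
    qed
    \<comment> \<open>Hoelder's inequality for
      \<open>F = (F powr p * u powr (a * p)) powr (1 - b) * s powr b\<close>;
      \<open>balanced\<close> then bounds the mass of \<open>s\<close> by a negative power of the
      mass of \<open>u\<close>.\<close>
    have far_hyp: "(\<integral>\<^sup>+y\<in>ball c r. ennreal (F y) \<partial>lborel) \<le> ennreal (r powr \<beta> * U c r powr (- (a - \<kappa>))) * (ennreal C0 * N)"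
      if r: "0 < r" for c r
    proof -
      have "(\<integral>\<^sup>+y\<in>ball c r. ennreal (F y) \<partial>lborel)
        = (\<integral>\<^sup>+y. (ennreal (F y powr p * u y powr (a * p)) * indicator (ball c r) y) epowr (1 - b)
           * (ennreal (s y) * indicator (ball c r) y) epowr (1 - (1 - b)) \<partial>lborel)"
      proof (intro nn_integral_cong, goal_cases)
        case (1 y)
        have e: "p * (1 - b) = 1" "a * p * (1 - b) = a" using b1 by (auto simp: p_def)
        have "(F y powr p * u y powr (a * p)) powr (1 - b) * s y powr b = F y powr 1 * u y powr a * s y powr b"
          by (simp only: powr_mult powr_powr e)
        then have "(F y powr p * u y powr (a * p)) powr (1 - b) * s y powr b = F y * (u y powr a * s y powr b)"
          using F0 by simp
        then have "(F y powr p * u y powr (a * p)) powr (1 - b) * s y powr b = F y"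
          by (simp add: dual)
        then show ?case
          using s_pos[of y] by (auto simp: ennreal_mult[symmetric] split: split_indicator)
      qed
      also have "\<dots> \<le> (\<integral>\<^sup>+y\<in>ball c r. ennreal (F y powr p * u y powr (a * p)) \<partial>lborel) epowr (1 - b)
           * (\<integral>\<^sup>+y\<in>ball c r. ennreal (s y) \<partial>lborel) epowr (1 - (1 - b))"
        using b1 b_pos by (intro nn_integral_Hoelder) auto
      also have "(\<integral>\<^sup>+y\<in>ball c r. ennreal (s y) \<partial>lborel) = ennreal (dual.U c r)"
        by (simp add: emeasure_s_ball[symmetric] emeasure_density)
      also have "(\<integral>\<^sup>+y\<in>ball c r. ennreal (F y powr p * u y powr (a * p)) \<partial>lborel) epowr (1 - b) * ennreal (dual.U c r) epowr (1 - (1 - b))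
        \<le> (ennreal (U c r powr \<kappa>) * N) * ennreal (C0 * r powr \<beta> * U c r powr (- a))"
      proof (rule mult_mono)
        have "dual.U c r powr b \<le> C0 * r powr \<beta> * U c r powr (- a)"
          using balanced'[OF r, of c] U_pos[OF r, of c] by (simp add: \<beta>_def powr_minus field_simps)
        then show "ennreal (dual.U c r) epowr (1 - (1 - b)) \<le> ennreal (C0 * r powr \<beta> * U c r powr (- a))"
          by (simp add: ennreal_leI)
      qed (use hyp r in auto)
      also have "\<dots> = ennreal (r powr \<beta> * (U c r powr \<kappa> * U c r powr (- a))) * (ennreal C0 * N)"
        using C0_pos by (simp add: ennreal_mult ac_simps)
      also have "U c r powr \<kappa> * U c r powr (- a) = U c r powr (- (a - \<kappa>))"
        by (simp add: powr_add[symmetric])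
      finally show ?thesis .
    qed
    have far: "(\<integral>\<^sup>+x\<in>ball c r. R2 x epowr (1 / a) * ennreal (u x) \<partial>lborel) epowr a \<le> ennreal (C2 * C0 * U c r powr \<kappa>) * N"
    proof -
      \<comment> \<open>The far part is at most the constant \<open>B\<close> on the ball.
        Integrating costs \<open>U c r powr a\<close>, which turns
        \<open>U c r powr (- (a - \<kappa>))\<close> into
        \<open>U c r powr \<kappa>\<close>.\<close>
      define B where "B = ennreal (C2 * U c r powr (- (a - \<kappa>))) * (ennreal C0 * N)"
      have "R2 x \<le> B" if "x \<in> ball c r" for x
        unfolding R2_def B_def by (intro C2 allI impI far_hyp r that) auto
      then have "(\<integral>\<^sup>+x\<in>ball c r. R2 x epowr (1 / a) * ennreal (u x) \<partial>lborel)
        \<le> (\<integral>\<^sup>+x. B epowr (1 / a) * (ennreal (u x) * indicator (ball c r) x) \<partial>lborel)"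
        using a_pos by (intro nn_integral_mono) (auto intro!: mult_right_mono epowr_mono split: split_indicator)
      also have "\<dots> = B epowr (1 / a) * ennreal (U c r)"
        by (subst nn_integral_cmult) (auto simp: emeasure_u_ball[symmetric] emeasure_density)
      finally have "(\<integral>\<^sup>+x\<in>ball c r. R2 x epowr (1 / a) * ennreal (u x) \<partial>lborel) epowr a
        \<le> (B epowr (1 / a) * ennreal (U c r)) epowr a"
        using a_pos by (intro epowr_mono) auto
      also have "\<dots> = B * ennreal (U c r powr a)"
        using a_pos by (simp add: epowr_mult epowr_epowr)
      also have "\<dots> = ennreal (C2 * C0 * (U c r powr (- (a - \<kappa>)) * U c r powr a)) * N"
        using C2 C0_pos by (simp add: B_def ennreal_mult ac_simps)
      also have "U c r powr (- (a - \<kappa>)) * U c r powr a = U c r powr \<kappa>"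
        by (simp add: powr_add[symmetric])
      finally show ?thesis .
    qed
    let ?A1 = "\<integral>\<^sup>+x. R1 x epowr (1 / a) * ennreal (u x) * indicator (ball c r) x \<partial>lborel"
    let ?A2 = "\<integral>\<^sup>+x. R2 x epowr (1 / a) * ennreal (u x) * indicator (ball c r) x \<partial>lborel"
    have "(\<integral>\<^sup>+x\<in>ball c r. Riesz \<beta> F x epowr (1 / a) * ennreal (u x) \<partial>lborel)
      \<le> (\<integral>\<^sup>+x. ennreal (2 powr (1 / a)) * (R1 x epowr (1 / a) * ennreal (u x) * indicator (ball c r) x + R2 x epowr (1 / a) * ennreal (u x) * indicator (ball c r) x) \<partial>lborel)"
    proof (intro nn_integral_mono, goal_cases)
      case (1 x)
      have "Riesz \<beta> F x epowr (1 / a) * (ennreal (u x) * indicator (ball c r) x)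
        \<le> ennreal (2 powr (1 / a)) * (R1 x epowr (1 / a) + R2 x epowr (1 / a)) * (ennreal (u x) * indicator (ball c r) x)"
        unfolding split using a_pos by (intro mult_right_mono epowr_add_le) auto
      then show ?case by (simp add: distrib_left distrib_right mult.assoc)
    qed
    also have "\<dots> = ennreal (2 powr (1 / a)) * (?A1 + ?A2)"
      by (subst nn_integral_cmult, measurable, subst nn_integral_add, auto)
    finally have "(\<integral>\<^sup>+x\<in>ball c r. Riesz \<beta> F x epowr (1 / a) * ennreal (u x) \<partial>lborel) epowr a
      \<le> (ennreal (2 powr (1 / a)) * (?A1 + ?A2)) epowr a"
      using a_pos by (intro epowr_mono) auto
    also have "\<dots> = ennreal 2 * (?A1 + ?A2) epowr a"
      using a_pos by (simp add: epowr_mult powr_powr)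
    also have "(?A1 + ?A2) epowr a \<le> ennreal (2 powr a) * (?A1 epowr a + ?A2 epowr a)"
      using a_pos by (intro epowr_add_le) simp
    also have "\<dots> \<le> ennreal 2 * (ennreal (C1 * D powr \<kappa> * U c r powr \<kappa>) * N + ennreal (C2 * C0 * U c r powr \<kappa>) * N)"
    proof (intro mult_mono add_mono near far)
      have "2 powr a \<le> 2 powr (1::real)" using ab b_pos by (intro powr_mono) auto
      then show "ennreal (2 powr a) \<le> ennreal 2" by (intro ennreal_leI) simp
    qed auto
    also have "ennreal 2 * (ennreal 2 * (ennreal (C1 * D powr \<kappa> * U c r powr \<kappa>) * N + ennreal (C2 * C0 * U c r powr \<kappa>) * N)) = ennreal (C * U c r powr \<kappa>) * N"
    proof -
      have "ennreal (C1 * D powr \<kappa> * U c r powr \<kappa>) * N + ennreal (C2 * C0 * U c r powr \<kappa>) * N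
        = ennreal (C1 * D powr \<kappa> * U c r powr \<kappa> + C2 * C0 * U c r powr \<kappa>) * N"
        using C1 C2 C0_pos D by (subst ennreal_plus) (auto simp: distrib_right)
      moreover have "C * U c r powr \<kappa> = 2 * (2 * (C1 * D powr \<kappa> * U c r powr \<kappa> + C2 * C0 * U c r powr \<kappa>))"
        by (simp add: C_def algebra_simps)
      ultimately show ?thesis
        using C1 C2 C0_pos D by (simp only: mult.assoc[symmetric] ennreal_mult[symmetric]) (simp add: ennreal_mult mult.assoc)
    qed
    finally show ?case
      unfolding \<beta>_def by (simp add: mult_left_mono)
  qed
qed

end

section \<open>The weak type endpoint\<close>

text \<open>The endpoint class with the essential supremum of \<open>1 / w\<close> multiplied out.
  The exceptional null set depends on the ball.\<close>

locale A1_weight =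
  fixes w :: "'a::euclidean_space \<Rightarrow> real" and q A :: real
  assumes w_meas [measurable]: "w \<in> borel_measurable borel" and w_pos: "0 < w x"
    and q: "1 < q" and A_pos: "0 < A"
    and finite_balls: "emeasure (density lborel (\<lambda>x. ennreal (w x powr q))) (ball c r) < top"
    and A1: "0 < r \<Longrightarrow> AE x in lborel. x \<in> ball c r \<longrightarrow>
      measure (density lborel (\<lambda>x. ennreal (w x powr q))) (ball c r) powr (1 / q) \<le> A * r powr (DIM('a) / q) * w x"
begin

lemma inverse_weight_le:
  fixes c :: 'a
  assumes r: "0 < r"
  defines "V \<equiv> measure (density lborel (\<lambda>x. ennreal (w x powr q))) (ball c r)"
  shows "0 < V" "AE x in lborel. x \<in> ball c r \<longrightarrow> 1 / w x \<le> A * r powr (DIM('a) / q) * V powr (- 1 / q)"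
proof -
  have "0 < emeasure (density lborel (\<lambda>x. ennreal (w x powr q))) (ball c r)"
    using r less_imp_neq[OF w_pos] by (intro emeasure_density_ball_pos) auto
  then show V: "0 < V"
    unfolding V_def using finite_balls[of c r] by (simp add: emeasure_eq_ennreal_measure)
  show "AE x in lborel. x \<in> ball c r \<longrightarrow> 1 / w x \<le> A * r powr (DIM('a) / q) * V powr (- 1 / q)"
    using A1[OF r, of c]
  proof eventually_elim
    case (elim x)
    show ?case
    proof
      assume "x \<in> ball c r"
      with elim have "V powr (1 / q) \<le> A * r powr (DIM('a) / q) * w x" by (simp add: V_def)
      then show "1 / w x \<le> A * r powr (DIM('a) / q) * V powr (- 1 / q)"
        using V w_pos[of x] by (simp add: powr_minus field_simps)
    qed
  qed
qed

text \<open>Integrating \<open>inverse_weight_le\<close> over the ball gives the balance of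
  \<open>w powr q\<close> and \<open>1 / w\<close>. The exponents add up to more than 1, outside the
  range of the strong type results; what is inherited is doubling, reverse doubling and
  \<open>Riesz_far\<close>.\<close>

lemma dual_weights: "dual_weights (\<lambda>x. w x powr q) (\<lambda>x. 1 / w x) (1 / q) 1 (A * unit_ball_vol DIM('a))"
proof -
  have bound: "emeasure (density lborel (\<lambda>x. ennreal (1 / w x))) (ball c r) \<le>
     ennreal (A * r powr (DIM('a) / q) * measure (density lborel (\<lambda>x. ennreal (w x powr q))) (ball c r) powr (- 1 / q) * (unit_ball_vol DIM('a) * r powr DIM('a)))"
    (is "_ \<le> ennreal (?B * _)") if r: "0 < r" for c r
  proof -
    have "emeasure (density lborel (\<lambda>x. ennreal (1 / w x))) (ball c r) = (\<integral>\<^sup>+x\<in>ball c r. ennreal (1 / w x) \<partial>lborel)"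
      by (subst emeasure_density) auto
    also have "\<dots> \<le> (\<integral>\<^sup>+x\<in>ball c r. ennreal ?B \<partial>lborel)"
      using inverse_weight_le(2)[OF r, of c]
      by (intro nn_integral_mono_AE) (auto elim!: eventually_mono intro!: ennreal_leI split: split_indicator)
    also have "\<dots> = ennreal ?B * emeasure lborel (ball c r)"
      by (intro nn_integral_cmult_indicator) simp
    also have "\<dots> = ennreal (?B * (unit_ball_vol DIM('a) * r powr DIM('a)))"
      using r A_pos by (simp add: emeasure_ball ennreal_mult[symmetric] powr_realpow)
    finally show ?thesis .
  qed
  show ?thesis
  proof unfold_locales
    show "0 < w x powr q" for x
      using w_pos[of x] by simp
    show "(w x powr q) powr (1 / q) * (1 / w x) powr 1 = 1" for x
      using q w_pos[of x] by (simp add: powr_powr)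
    show "emeasure (density lborel (\<lambda>x. ennreal (1 / w x))) (ball c r) < top" for c r
    proof (cases "0 < r")
      case True
      then show ?thesis using bound[OF True, of c] by (meson ennreal_less_top order_le_less_trans)
    qed (simp add: not_less ball_empty)
    fix r :: real and c :: 'a assume r: "0 < r"
    define V where "V = measure (density lborel (\<lambda>x. ennreal (w x powr q))) (ball c r)"
    have V: "0 < V" unfolding V_def by (rule inverse_weight_le(1)[OF r])
    have "measure (density lborel (\<lambda>x. ennreal (1 / w x))) (ball c r) \<le> A * r powr (DIM('a) / q) * V powr (- 1 / q) * (unit_ball_vol DIM('a) * r powr DIM('a))"
      using bound[OF r, of c] A_pos unfolding V_def measure_def by (intro enn2real_leI) auto
    then have "V powr (1 / q) * measure (density lborel (\<lambda>x. ennreal (1 / w x))) (ball c r) \<le> V powr (1 / q) * (A * r powr (DIM('a) / q) * V powr (- 1 / q) * (unit_ball_vol DIM('a) * r powr DIM('a)))"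
      by (intro mult_left_mono) auto
    also have "\<dots> = A * unit_ball_vol DIM('a) * (r powr (DIM('a) / q) * r powr DIM('a))"
      using V by (simp add: powr_minus field_simps)
    also have "r powr (DIM('a) / q) * r powr DIM('a) = r powr (DIM('a) * (1 / q + 1))"
      by (simp add: powr_add[symmetric] algebra_simps)
    finally show "measure (density lborel (\<lambda>x. ennreal (w x powr q))) (ball c r) powr (1 / q) *
       measure (density lborel (\<lambda>x. ennreal (1 / w x))) (ball c r) powr 1
       \<le> A * unit_ball_vol (real DIM('a)) * r powr (real DIM('a) * (1 / q + 1))"
      by (simp add: V_def)
  qed (use q w_pos finite_balls in auto)
qed

sublocale dual_weights "\<lambda>x. w x powr q" "\<lambda>x. 1 / w x" "1 / q" 1 "A * unit_ball_vol DIM('a)"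
  by (rule dual_weights)

lemma A1_ball: "0 < r \<Longrightarrow> AE x in lborel. x \<in> ball c r \<longrightarrow> U c r powr (1 / q) \<le> A * r powr (DIM('a) / q) * w x"
  using A1[of r c] by (simp add: U_def)

text \<open>Countably many balls suffice to obtain the bound at almost every centre for all radii at
  once.\<close>

lemma AE_ball_le:
  "AE y in lborel. \<forall>r>0. U y r powr (1 / q) \<le> A * (2 * r) powr (DIM('a) / q) * w y"
proof -
  obtain D :: "'a set" where D: "countable D" "\<And>X. open X \<Longrightarrow> X \<noteq> {} \<Longrightarrow> \<exists>d\<in>D. d \<in> X"
    using countable_dense_exists by blast
  have "AE y in lborel. \<forall>c\<in>D. \<forall>r\<in>{r\<in>\<rat>. 0 < r}. y \<in> ball c r \<longrightarrow> U c r powr (1 / q) \<le> A * r powr (DIM('a) / q) * w y"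
    using D(1) A1_ball by (intro AE_ball_countable' countable_Collect countable_rat) auto
  then show ?thesis
  proof eventually_elim
    case (elim y)
    show ?case
    proof (intro allI impI)
      fix r :: real assume r: "0 < r"
      obtain c where c: "c \<in> D" "c \<in> ball y (r / 2)"
        using D(2)[of "ball y (r / 2)"] r by auto
      \<comment> \<open>The lower bound exceeds \<open>r + dist c y\<close>, so that
        \<open>ball c r'\<close> contains \<open>ball y r\<close>; the upper bound is the source of
        the factor 2 in the statement.\<close>
      obtain r' where r': "r' \<in> \<rat>" "3 / 2 * r < r'" "r' < 2 * r"
        using Rats_dense_in_real[of "3 / 2 * r" "2 * r"] r by auto
      have cy: "dist c y < r / 2" using c by (simp add: dist_commute)
      have "ball y r \<subseteq> ball c r'"
      proof
        fix z assume "z \<in> ball y r"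
        moreover have "dist c z \<le> dist c y + dist y z" by (rule dist_triangle)
        ultimately show "z \<in> ball c r'" using cy r' by simp
      qed
      then have "U y r powr (1 / q) \<le> U c r' powr (1 / q)"
        using q by (intro powr_mono2 U_mono) auto
      also have "\<dots> \<le> A * r' powr (DIM('a) / q) * w y"
        using elim c(1) r' r cy by auto
      also have "\<dots> \<le> A * (2 * r) powr (DIM('a) / q) * w y"
        using r' r A_pos w_pos[of y] q by (intro mult_right_mono mult_left_mono powr_mono2) auto
      finally show "U y r powr (1 / q) \<le> A * (2 * r) powr (DIM('a) / q) * w y" .
    qed
  qed
qed

text \<open>This is \<open>weak_type_kernel\<close> with exponent \<open>q\<close>: the set where
  the kernel with pole \<open>y\<close> exceeds a level lies in a ball about \<open>y\<close>, whose
  mass \<open>AE_ball_le\<close> controls by \<open>w y\<close> for almost every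
  \<open>y\<close>.\<close>

lemma Riesz_weak_type:
  "\<exists>C>0. \<forall>F t. F \<in> borel_measurable borel \<longrightarrow> 0 < t \<longrightarrow>
    emeasure Mu {x. ennreal t < Riesz (DIM('a) / q) F x} \<le> (ennreal (C / t) * (\<integral>\<^sup>+y. F y * ennreal (w y) \<partial>lborel)) epowr q"
proof -
  define \<beta> where "\<beta> = DIM('a) / q"
  have \<beta>: "0 < \<beta>" using q by (simp add: \<beta>_def)
  define B where "B = A * 2 powr \<beta>"
  have B: "0 < B" using A_pos by (simp add: B_def)
  define C where "C = q / (q - 1) * B"
  have C: "0 < C" using B q by (simp add: C_def)
  show ?thesis
  proof (intro exI[of _ C] conjI allI impI, goal_cases)
    case 1
    show ?case by fact
  next
    case (2 F t)
    note F [measurable] = 2(1) and t = 2(2)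
    have "ennreal t * (emeasure Mu {x \<in> space Mu. ennreal t < (\<integral>\<^sup>+y. ennreal (dist x y powr (- \<beta>)) * F y \<partial>lborel)}) epowr (1 / q)
      \<le> ennreal (q / (q - 1)) * (\<integral>\<^sup>+y. F y * ennreal (B * w y) \<partial>lborel)"
    proof (rule weak_type_kernel[OF sigma_finite_Mu lborel.sigma_finite_measure_axioms])
      show "AE y in lborel. \<forall>t>0. emeasure Mu {z \<in> space Mu. ennreal t < ennreal (dist z y powr (- \<beta>))} \<le> ennreal ((B * w y / t) powr q)"
        using AE_ball_le
      proof eventually_elim
        case (elim y)
        show ?case
        proof (intro allI impI)
          fix \<tau> :: real assume \<tau>: "0 < \<tau>"
          \<comment> \<open>The radius at which the kernel equals \<tau>. The pole itself is not in
            the level set, since \<open>0 powr (- \<beta>)\<close> is 0.\<close>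
          define \<rho> where "\<rho> = \<tau> powr (- 1 / \<beta>)"
          have \<rho>: "0 < \<rho>" "\<rho> powr \<beta> = 1 / \<tau>" using \<tau> \<beta> powr_powr[of \<tau> "- 1 / \<beta>" \<beta>] by (auto simp: \<rho>_def powr_minus_divide)
          have "{z \<in> space Mu. ennreal \<tau> < ennreal (dist z y powr (- \<beta>))} \<subseteq> ball y \<rho>"
          proof safe
            fix z assume "ennreal \<tau> < ennreal (dist z y powr (- \<beta>))"
            then have less: "\<tau> < dist z y powr (- \<beta>)" using \<tau> by (simp add: ennreal_less_iff)
            then have d: "0 < dist z y" using \<tau> by (cases "z = y") auto
            show "z \<in> ball y \<rho>"
            proof (rule ccontr)
              assume "z \<notin> ball y \<rho>"
              then have "dist z y powr (- \<beta>) \<le> \<rho> powr (- \<beta>)"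
                using \<rho> \<beta> by (intro powr_mono2') (auto simp: dist_commute)
              also have "\<dots> = \<tau>" using \<rho> by (simp add: powr_minus)
              finally show False using less by simp
            qed
          qed
          then have "emeasure Mu {z \<in> space Mu. ennreal \<tau> < ennreal (dist z y powr (- \<beta>))} \<le> emeasure Mu (ball y \<rho>)"
            by (intro emeasure_mono) auto
          also have "\<dots> = ennreal (U y \<rho>)" by (rule emeasure_u_ball)
          also have "U y \<rho> \<le> (B * w y / \<tau>) powr q"
          proof -
            have "U y \<rho> powr (1 / q) \<le> A * (2 * \<rho>) powr \<beta> * w y"
              using elim \<rho> by (simp add: \<beta>_def)
            also have "\<dots> = B * w y / \<tau>"
              using \<rho> by (simp add: powr_mult B_def)
            finally have "(U y \<rho> powr (1 / q)) powr q \<le> (B * w y / \<tau>) powr q"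
              using q by (intro powr_mono2) auto
            then show ?thesis using q by (simp add: powr_powr)
          qed
          finally show "emeasure Mu {z \<in> space Mu. ennreal \<tau> < ennreal (dist z y powr (- \<beta>))} \<le> ennreal ((B * w y / \<tau>) powr q)"
            by (simp add: ennreal_leI)
        qed
      qed
    qed (use B w_pos q t in auto)
    also have "(\<integral>\<^sup>+y. F y * ennreal (B * w y) \<partial>lborel) = ennreal B * (\<integral>\<^sup>+y. F y * ennreal (w y) \<partial>lborel)"
      using B w_pos by (subst nn_integral_cmult[symmetric]) (auto simp: ennreal_mult less_imp_le ac_simps)
    finally have "ennreal (1 / t) * (ennreal t * (emeasure Mu {x. ennreal t < Riesz \<beta> F x}) epowr (1 / q))
      \<le> ennreal (1 / t) * (ennreal (q / (q - 1)) * (ennreal B * (\<integral>\<^sup>+y. F y * ennreal (w y) \<partial>lborel)))"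
      by (intro mult_left_mono) (auto simp: Riesz_def)
    moreover have "ennreal (1 / t) * ennreal t = 1" using t by (simp add: ennreal_mult[symmetric])
    moreover have "ennreal (1 / t) * (ennreal (q / (q - 1)) * ennreal B) = ennreal (C / t)"
      using t B q by (simp add: ennreal_mult[symmetric] C_def)
    ultimately have "emeasure Mu {x. ennreal t < Riesz \<beta> F x} epowr (1 / q) \<le> ennreal (C / t) * (\<integral>\<^sup>+y. F y * ennreal (w y) \<partial>lborel)"
      by (simp add: mult.assoc[symmetric])
    then have "(emeasure Mu {x. ennreal t < Riesz \<beta> F x} epowr (1 / q)) epowr q \<le> (ennreal (C / t) * (\<integral>\<^sup>+y. F y * ennreal (w y) \<partial>lborel)) epowr q"
      using q by (intro epowr_mono) auto
    then show ?case
      using q by (simp add: epowr_epowr \<beta>_def)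
  qed
qed

lemma Riesz_weak_Morrey:
  assumes k: "0 < k" "k < 1 / q"
  shows "\<exists>C>0. \<forall>F N. F \<in> borel_measurable borel \<longrightarrow>
    (\<forall>c r. 0 < r \<longrightarrow> (\<integral>\<^sup>+y\<in>ball c r. F y * ennreal (w y) \<partial>lborel) \<le> ennreal (U c r powr k) * N) \<longrightarrow>
    (\<forall>c r t. 0 < r \<longrightarrow> 0 < t \<longrightarrow>
       emeasure Mu {x \<in> ball c r. ennreal t < Riesz (DIM('a) / q) F x} \<le> ennreal (C / t powr q * U c r powr (k * q)) * N epowr q)"
proof -
  define \<beta> where "\<beta> = DIM('a) / q"
  have \<beta>: "0 < \<beta>" using q by (simp add: \<beta>_def)
  define \<delta> where "\<delta> = 1 / q - k"
  have \<delta>: "0 < \<delta>" using k by (simp add: \<delta>_def)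
  obtain D where D: "1 \<le> D" "\<And>c r. 0 < r \<Longrightarrow> U c (2 * r) \<le> D * U c r"
    using doubling by blast
  from Riesz_weak_type obtain C1 where C1: "0 < C1" and C1': "\<forall>F t. F \<in> borel_measurable borel \<longrightarrow> 0 < t \<longrightarrow>
    emeasure Mu {x. ennreal t < Riesz \<beta> F x} \<le> (ennreal (C1 / t) * (\<integral>\<^sup>+y. F y * ennreal (w y) \<partial>lborel)) epowr q"
    unfolding \<beta>_def by (elim exE conjE)
  from Riesz_far[OF \<beta> \<delta>] obtain C2 where C2: "0 < C2" and C2': "\<forall>(F :: 'a \<Rightarrow> ennreal) N. F \<in> borel_measurable borel \<longrightarrow>
    (\<forall>c r. 0 < r \<longrightarrow> (\<integral>\<^sup>+y\<in>ball c r. F y \<partial>lborel) \<le> ennreal (r powr \<beta> * U c r powr (- \<delta>)) * N) \<longrightarrow>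
    (\<forall>c r x. 0 < r \<longrightarrow> x \<in> ball c r \<longrightarrow>
      Riesz \<beta> (\<lambda>y. F y * indicator (- ball c (2 * r)) y) x \<le> ennreal (C2 * U c r powr (- \<delta>)) * N)"
    by (elim exE conjE)
  define L where "L = (2 * C1 * D powr k) powr q"
  define M where "M = (2 * C2 * A) powr q"
  have LM: "0 < L" "0 < M" using C1 C2 D A_pos by (auto simp: L_def M_def)
  show ?thesis
  proof (intro exI[of _ "L + M"] conjI allI impI, goal_cases)
    case 1
    show ?case using LM by simp
  next
    case (2 F N c r t)
    note F [measurable] = 2(1) and hyp = 2(2) and r = 2(3) and t = 2(4)
    define R1 where "R1 = Riesz \<beta> (\<lambda>y. F y * indicator (ball c (2 * r)) y)"
    define R2 where "R2 = Riesz \<beta> (\<lambda>y. F y * indicator (- ball c (2 * r)) y)"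
    have [measurable]: "R1 \<in> borel_measurable borel" "R2 \<in> borel_measurable borel"
      unfolding R1_def R2_def by measurable
    have split: "Riesz \<beta> F x = R1 x + R2 x" for x
      unfolding R1_def R2_def by (intro Riesz_split) auto
    let ?E1 = "{x. ennreal (t / 2) < R1 x}" and ?E2 = "{x \<in> ball c r. ennreal (t / 2) < R2 x}"
    have "{x \<in> ball c r. ennreal t < Riesz \<beta> F x} \<subseteq> ?E1 \<union> ?E2"
    proof (safe, rule ccontr)
      fix x assume "ennreal t < Riesz \<beta> F x" and "\<not> ennreal (t / 2) < R2 x" "\<not> ennreal (t / 2) < R1 x"
      then have "ennreal t < ennreal (t / 2) + ennreal (t / 2)"
        unfolding split by (meson add_mono linorder_not_le order_less_le_trans)
      then show False using t by (simp add: ennreal_plus[symmetric] del: ennreal_plus)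
    qed
    then have "emeasure Mu {x \<in> ball c r. ennreal t < Riesz \<beta> F x} \<le> emeasure Mu (?E1 \<union> ?E2)"
      by (intro emeasure_mono) auto
    also have "\<dots> \<le> emeasure Mu ?E1 + emeasure Mu ?E2"
      by (intro emeasure_subadditive) auto
    also have "\<dots> \<le> ennreal (L / t powr q * U c r powr (k * q)) * N epowr q + ennreal (M / t powr q * U c r powr (k * q)) * N epowr q"
    proof (rule add_mono)
      have "emeasure Mu ?E1 \<le> (ennreal (C1 / (t / 2)) * (\<integral>\<^sup>+y. F y * indicator (ball c (2 * r)) y * ennreal (w y) \<partial>lborel)) epowr q"
        unfolding R1_def using t by (intro C1'[rule_format]) auto
      also have "(\<integral>\<^sup>+y. F y * indicator (ball c (2 * r)) y * ennreal (w y) \<partial>lborel) = (\<integral>\<^sup>+y\<in>ball c (2 * r). F y * ennreal (w y) \<partial>lborel)"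
        by (intro nn_integral_cong) (simp add: ac_simps)
      also have "(ennreal (C1 / (t / 2)) * (\<integral>\<^sup>+y\<in>ball c (2 * r). F y * ennreal (w y) \<partial>lborel)) epowr q
        \<le> (ennreal (C1 / (t / 2)) * (ennreal ((D * U c r) powr k) * N)) epowr q"
      proof (intro epowr_mono mult_left_mono)
        have "(\<integral>\<^sup>+y\<in>ball c (2 * r). F y * ennreal (w y) \<partial>lborel) \<le> ennreal (U c (2 * r) powr k) * N"
          using hyp r by simp
        also have "\<dots> \<le> ennreal ((D * U c r) powr k) * N"
          using k D r by (intro mult_right_mono ennreal_leI powr_mono2) auto
        finally show "(\<integral>\<^sup>+y\<in>ball c (2 * r). F y * ennreal (w y) \<partial>lborel) \<le> ennreal ((D * U c r) powr k) * N" .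
      qed (use q in auto)
      also have "\<dots> = (ennreal (2 * C1 * D powr k / t * U c r powr k) * N) epowr q"
        using C1 t D by (simp add: powr_mult mult.assoc[symmetric] ennreal_mult[symmetric]) (simp add: ac_simps)
      also have "\<dots> = ennreal ((2 * C1 * D powr k / t * U c r powr k) powr q) * N epowr q"
        using C1 t D by (simp add: epowr_mult)
      also have "(2 * C1 * D powr k / t * U c r powr k) powr q = L / t powr q * U c r powr (k * q)"
        by (simp only: powr_mult powr_divide powr_powr L_def)
      finally show "emeasure Mu ?E1 \<le> ennreal (L / t powr q * U c r powr (k * q)) * N epowr q" .
    next
      have far_hyp: "(\<integral>\<^sup>+y\<in>ball c r. F y \<partial>lborel) \<le> ennreal (r powr \<beta> * U c r powr (- \<delta>)) * (ennreal A * N)"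
        if r: "0 < r" for c r
      proof -
        have "(\<integral>\<^sup>+y\<in>ball c r. F y \<partial>lborel)
          \<le> (\<integral>\<^sup>+y. ennreal (A * r powr \<beta> * U c r powr (- 1 / q)) * (F y * ennreal (w y) * indicator (ball c r) y) \<partial>lborel)"
        proof (rule nn_integral_mono_AE)
          show "AE y in lborel. F y * indicator (ball c r) y \<le> ennreal (A * r powr \<beta> * U c r powr (- 1 / q)) * (F y * ennreal (w y) * indicator (ball c r) y)"
            using inverse_weight_le(2)[OF r, of c]
          proof eventually_elim
            case (elim y)
            show ?case
            proof (cases "y \<in> ball c r")
              case True
              then have "1 \<le> A * r powr \<beta> * U c r powr (- 1 / q) * w y"
                using elim w_pos[of y] by (simp add: U_def \<beta>_def field_simps)
              then have "1 * F y \<le> ennreal (A * r powr \<beta> * U c r powr (- 1 / q) * w y) * F y"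
                by (intro mult_right_mono) (auto simp: ennreal_1[symmetric] simp del: ennreal_1 intro: ennreal_leI)
              also have "ennreal (A * r powr \<beta> * U c r powr (- 1 / q) * w y) = ennreal (A * r powr \<beta> * U c r powr (- 1 / q)) * ennreal (w y)"
                using A_pos w_pos[of y] by (intro ennreal_mult) auto
              finally show ?thesis using True by (simp add: mult.assoc mult.commute[of "ennreal (w y)"])
            qed simp
          qed
        qed
        also have "\<dots> = ennreal (A * r powr \<beta> * U c r powr (- 1 / q)) * (\<integral>\<^sup>+y\<in>ball c r. F y * ennreal (w y) \<partial>lborel)"
          by (intro nn_integral_cmult) auto
        also have "\<dots> \<le> ennreal (A * r powr \<beta> * U c r powr (- 1 / q)) * (ennreal (U c r powr k) * N)"
          using hyp r by (intro mult_left_mono) auto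
        also have "\<dots> = ennreal (r powr \<beta> * (U c r powr (- 1 / q) * U c r powr k)) * (ennreal A * N)"
          using A_pos by (simp add: ennreal_mult ac_simps)
        also have "U c r powr (- 1 / q) * U c r powr k = U c r powr (- \<delta>)"
          by (simp add: powr_add[symmetric] \<delta>_def)
        finally show ?thesis .
      qed
      show "emeasure Mu ?E2 \<le> ennreal (M / t powr q * U c r powr (k * q)) * N epowr q"
      \<comment> \<open>The far part has a constant bound on the ball. Hence either its level set is
        empty, or \<open>t\<close> is so small that the whole ball already satisfies the
        estimate.\<close>
      proof (cases "?E2 = {}")
        case True
        show ?thesis unfolding True by simp
      next
        case False
        then obtain x where x: "x \<in> ball c r" "ennreal (t / 2) < R2 x" by blast
        have U: "0 < U c r" using r by (rule U_pos)
        have "ennreal (t / 2) \<le> ennreal (C2 * U c r powr (- \<delta>)) * (ennreal A * N)"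
        proof (rule order_trans)
          show "ennreal (t / 2) \<le> R2 x" using x by simp
          show "R2 x \<le> ennreal (C2 * U c r powr (- \<delta>)) * (ennreal A * N)"
            unfolding R2_def by (intro C2'[rule_format] far_hyp r x(1)) auto
        qed
        then have "ennreal (2 / t * U c r powr (1 / q)) * ennreal (t / 2) \<le> ennreal (2 / t * U c r powr (1 / q)) * (ennreal (C2 * U c r powr (- \<delta>)) * (ennreal A * N))"
          by (intro mult_left_mono) auto
        also have "ennreal (2 / t * U c r powr (1 / q)) * ennreal (t / 2) = ennreal (U c r powr (1 / q))"
          using t by (simp add: ennreal_mult[symmetric])
        also have "ennreal (2 / t * U c r powr (1 / q)) * (ennreal (C2 * U c r powr (- \<delta>)) * (ennreal A * N))
           = ennreal (2 * C2 * A / t * (U c r powr (1 / q) * U c r powr (- \<delta>))) * N"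
          using t C2 A_pos by (simp add: mult.assoc[symmetric] ennreal_mult[symmetric]) (simp add: ac_simps)
        also have "U c r powr (1 / q) * U c r powr (- \<delta>) = U c r powr k"
          by (simp add: powr_add[symmetric] \<delta>_def)
        finally have "ennreal (U c r powr (1 / q)) epowr q \<le> (ennreal (2 * C2 * A / t * U c r powr k) * N) epowr q"
          using q by (intro epowr_mono) auto
        also have "\<dots> = ennreal ((2 * C2 * A / t * U c r powr k) powr q) * N epowr q"
          using t C2 A_pos by (simp add: epowr_mult)
        also have "(2 * C2 * A / t * U c r powr k) powr q = M / t powr q * U c r powr (k * q)"
          by (simp only: powr_mult powr_divide powr_powr M_def)
        also have "ennreal (U c r powr (1 / q)) epowr q = emeasure Mu (ball c r)"
          using q by (simp add: emeasure_u_ball powr_powr)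
        finally have "emeasure Mu (ball c r) \<le> ennreal (M / t powr q * U c r powr (k * q)) * N epowr q" .
        moreover have "emeasure Mu ?E2 \<le> emeasure Mu (ball c r)"
          by (intro emeasure_mono) auto
        ultimately show ?thesis by (rule order_trans[rotated])
      qed
    qed
    also have "\<dots> = ennreal ((L + M) / t powr q * U c r powr (k * q)) * N epowr q"
    proof -
      have "(L + M) / t powr q * U c r powr (k * q) = L / t powr q * U c r powr (k * q) + M / t powr q * U c r powr (k * q)"
        by (simp add: add_divide_distrib distrib_right)
      then show ?thesis using LM by (simp add: distrib_right)
    qed
    finally show ?case
      by (simp add: \<beta>_def)
  qed
qed

end

section \<open>Oscillatory operators\<close>

lemma norm_linear_le_gradient:
  fixes D :: "real ^ 'n \<Rightarrow> complex"
  assumes "linear D"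
  shows "norm (D h) \<le> real CARD('n) * norm (\<chi> i. D (axis i 1)) * norm h"
proof -
  interpret linear D by fact
  have "D h = D (\<Sum>i\<in>UNIV. (h $ i) *\<^sub>R axis i 1)"
    by (simp add: basis_expansion flip: scalar_mult_eq_scaleR)
  also have "\<dots> = (\<Sum>i\<in>UNIV. (h $ i) *\<^sub>R D (axis i 1))"
    by (simp add: sum scale)
  also have "norm \<dots> \<le> (\<Sum>i\<in>(UNIV :: 'n set). norm h * norm (\<chi> i. D (axis i 1)))"
  proof (rule sum_norm_le)
    fix i :: 'n
    have "norm ((\<chi> i. D (axis i 1)) $ i) \<le> norm (\<chi> i. D (axis i 1))"
      by (rule Finite_Cartesian_Product.norm_nth_le)
    then show "norm ((h $ i) *\<^sub>R D (axis i 1)) \<le> norm h * norm (\<chi> i. D (axis i 1))"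
      by (simp add: mult_mono component_le_norm_cart)
  qed
  also have "\<dots> = real CARD('n) * norm (\<chi> i. D (axis i 1)) * norm h"
    by simp
  finally show ?thesis .
qed

text \<open>Arbitrary diagonal values may spoil joint Borel measurability. The value 0 avoids this
  and also keeps the size bound true on the diagonal, where its right-hand side is 0.\<close>

definition off_diagonal :: "('a \<Rightarrow> 'a \<Rightarrow> complex) \<Rightarrow> 'a \<Rightarrow> 'a \<Rightarrow> complex" where
  "off_diagonal K x y = (if x = y then 0 else K x y)"

context
  fixes \<alpha> :: real and K :: "real ^ 'n::finite \<Rightarrow> real ^ 'n \<Rightarrow> complex"
  assumes \<alpha>: "\<alpha> < real CARD('n)" and SFCZK: "SFCZK \<alpha> K"
begin

lemma SFCZK_size:
  obtains C where "0 < C" "\<And>x y. x \<noteq> y \<Longrightarrow> cmod (K x y) \<le> C * dist x y powr (- (real CARD('n) - \<alpha>))"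
proof -
  obtain C where C: "\<And>x y. x \<noteq> y \<Longrightarrow> cmod (K x y) \<le> C * norm (x - y) powr (- (real CARD('n) - \<alpha>))"
    using SFCZK unfolding SFCZK_def by blast
  show ?thesis
  proof (rule that[of "max C 1"])
    fix x y :: "real ^ 'n" assume "x \<noteq> y"
    from C[OF this] show "cmod (K x y) \<le> max C 1 * dist x y powr (- (real CARD('n) - \<alpha>))"
      unfolding dist_norm by (rule order_trans) (intro mult_right_mono, auto)
  qed simp
qed

text \<open>Only separate differentiability is given. The gradient bound in \<open>x\<close> is
  locally uniform off the diagonal, so the mean value inequality yields a Lipschitz bound in
  \<open>x\<close> that is uniform for \<open>y\<close> near \<open>y0\<close>; with continuity in
  \<open>y\<close> at the single point \<open>x0\<close> this gives joint continuity.\<close>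

lemma SFCZK_continuous: "continuous_on {p. fst p \<noteq> snd p} (\<lambda>p. K (fst p) (snd p))"
proof -
  obtain C where C: "\<And>x y. x \<noteq> y \<Longrightarrow> (\<lambda>u. K u y) differentiable (at x)" "\<And>x y. x \<noteq> y \<Longrightarrow> (\<lambda>v. K x v) differentiable (at y)"
    "\<And>x y. x \<noteq> y \<Longrightarrow> norm (gradient (\<lambda>u. K u y) x) + norm (gradient (\<lambda>v. K x v) y)
       \<le> C * norm (x - y) powr (- (real CARD('n) + 1 - \<alpha>))"
    using SFCZK unfolding SFCZK_def by blast
  have "isCont (\<lambda>p. K (fst p) (snd p)) (x0, y0)" if ne: "x0 \<noteq> y0" for x0 y0
  proof -
    \<comment> \<open>A quarter of the distance keeps points of the two balls at least
      \<open>2 * \<delta>\<close> apart, where the gradient bound is a fixed constant.\<close>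
    define \<delta> where "\<delta> = dist x0 y0 / 4"
    have \<delta>: "0 < \<delta>" using ne by (simp add: \<delta>_def)
    define L where "L = real CARD('n) * (\<bar>C\<bar> * (2 * \<delta>) powr (- (real CARD('n) + 1 - \<alpha>)))"
    have lip: "norm (K x y - K x0 y) \<le> L * norm (x - x0)" if x: "x \<in> ball x0 \<delta>" and y: "y \<in> ball y0 \<delta>" for x y
    proof (rule differentiable_bound[where S = "ball x0 \<delta>" and f' = "\<lambda>x. frechet_derivative (\<lambda>u. K u y) (at x)"])
      fix z assume z: "z \<in> ball x0 \<delta>"
      have "dist x0 y0 \<le> dist x0 z + dist z y + dist y y0"
        using dist_triangle[of x0 y0 z] dist_triangle[of z y0 y] by linarith
      then have far: "2 * \<delta> \<le> dist z y" using z y by (simp add: \<delta>_def dist_commute)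
      then have "z \<noteq> y" using \<delta> by auto
      then have der: "((\<lambda>u. K u y) has_derivative frechet_derivative (\<lambda>u. K u y) (at z)) (at z)"
        using C(1) frechet_derivative_works by blast
      then show "((\<lambda>u. K u y) has_derivative frechet_derivative (\<lambda>u. K u y) (at z)) (at z within ball x0 \<delta>)"
        by (rule has_derivative_at_withinI)
      have "norm (gradient (\<lambda>u. K u y) z) \<le> C * norm (z - y) powr (- (real CARD('n) + 1 - \<alpha>))"
        using C(3)[OF \<open>z \<noteq> y\<close>] by (smt (verit) norm_ge_zero)
      also have "\<dots> \<le> \<bar>C\<bar> * (2 * \<delta>) powr (- (real CARD('n) + 1 - \<alpha>))"
        using far \<alpha> \<delta> by (intro mult_mono powr_mono2') (auto simp: dist_norm)
      finally have g: "norm (gradient (\<lambda>u. K u y) z) \<le> \<bar>C\<bar> * (2 * \<delta>) powr (- (real CARD('n) + 1 - \<alpha>))" .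
      show "onorm (frechet_derivative (\<lambda>u. K u y) (at z)) \<le> L"
      proof (rule onorm_le)
        fix h
        have "norm (frechet_derivative (\<lambda>u. K u y) (at z) h) \<le> real CARD('n) * norm (gradient (\<lambda>u. K u y) z) * norm h"
          unfolding gradient_def using der by (intro norm_linear_le_gradient) (rule has_derivative_linear)
        also have "\<dots> \<le> L * norm h"
          unfolding L_def using g by (intro mult_right_mono mult_left_mono) auto
        finally show "norm (frechet_derivative (\<lambda>u. K u y) (at z) h) \<le> L * norm h" .
      qed
    qed (use x \<delta> in auto)
    have "((\<lambda>p. K (fst p) (snd p) - K x0 (snd p)) \<longlongrightarrow> 0) (at (x0, y0))"
    proof (rule Lim_null_comparison)
      have "eventually (\<lambda>p. p \<in> ball x0 \<delta> \<times> ball y0 \<delta>) (at (x0, y0))"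
        using \<delta> by (intro eventually_at_in_open' open_Times) auto
      then show "eventually (\<lambda>p. norm (K (fst p) (snd p) - K x0 (snd p)) \<le> L * norm (fst p - x0)) (at (x0, y0))"
        by (rule eventually_mono) (auto intro!: lip)
      show "((\<lambda>p. L * norm (fst p - x0)) \<longlongrightarrow> 0) (at (x0, y0))"
        by (auto intro!: tendsto_eq_intros)
    qed
    moreover have "((\<lambda>p. K x0 (snd p)) \<longlongrightarrow> K x0 y0) (at (x0, y0))"
    proof -
      have "isCont (\<lambda>v. K x0 v) y0"
        using C(2)[OF ne] by (rule differentiable_imp_continuous_within)
      then show ?thesis
        by (rule isCont_tendsto_compose) (auto intro!: tendsto_eq_intros)
    qed
    ultimately have "((\<lambda>p. (K (fst p) (snd p) - K x0 (snd p)) + K x0 (snd p)) \<longlongrightarrow> 0 + K x0 y0) (at (x0, y0))"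
      by (rule tendsto_add)
    then show ?thesis by (simp add: isCont_def)
  qed
  then show ?thesis
    by (intro continuous_at_imp_continuous_on) auto
qed

lemma off_diagonal_measurable: "(\<lambda>p. off_diagonal K (fst p) (snd p)) \<in> borel_measurable (borel \<Otimes>\<^sub>M borel)"
proof -
  have "open {p :: (real ^ 'n) \<times> (real ^ 'n). fst p \<noteq> snd p}"
    by (intro open_Collect_neq continuous_intros)
  then have "(\<lambda>p. indicator {p. fst p \<noteq> snd p} p *\<^sub>R K (fst p) (snd p)) \<in> borel_measurable borel"
    by (intro borel_measurable_continuous_on_indicator SFCZK_continuous) auto
  moreover have "(\<lambda>p. indicator {p. fst p \<noteq> snd p} p *\<^sub>R K (fst p) (snd p)) = (\<lambda>p. off_diagonal K (fst p) (snd p))"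
    by (auto simp: off_diagonal_def fun_eq_iff split: split_indicator)
  ultimately show ?thesis by (simp add: borel_prod)
qed

lemma off_diagonal_section: "off_diagonal K x \<in> borel_measurable borel"
  using measurable_compose[OF measurable_Pair1'[of x borel borel] off_diagonal_measurable] by simp

end

section \<open>The operator as a Borel integral with parameter\<close>

lemma poly2_eval_continuous: "continuous_on UNIV (\<lambda>p. poly2_eval P (fst p) (snd p))"
  unfolding poly2_eval_def by (intro continuous_intros)

lemma poly2_eval_measurable: "(\<lambda>p. poly2_eval P (fst p) (snd p)) \<in> borel_measurable (borel \<Otimes>\<^sub>M borel)"
  unfolding borel_prod by (intro borel_measurable_continuous_onI poly2_eval_continuous)

lemma complex_Borel_version:
  fixes f :: "'a::euclidean_space \<Rightarrow> complex"
  assumes [measurable]: "f \<in> borel_measurable lebesgue"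
  obtains g where "g \<in> borel_measurable borel" "AE x in lborel. f x = g x"
proof -
  have "(\<lambda>x. Re (f x)) \<in> borel_measurable lebesgue" "(\<lambda>x. Im (f x)) \<in> borel_measurable lebesgue"
    by measurable
  then obtain a b where "a \<in> borel_measurable lborel" "b \<in> borel_measurable lborel"
    and ab: "AE x in lborel. Re (f x) = a x" "AE x in lborel. Im (f x) = b x"
    using completion_ex_borel_measurable_real by blast
  then have [measurable]: "a \<in> borel_measurable borel" "b \<in> borel_measurable borel"
    by simp_all
  show ?thesis
  proof (rule that[of "\<lambda>x. Complex (a x) (b x)"])
    have "(\<lambda>x. complex_of_real (a x) + \<i> * complex_of_real (b x)) \<in> borel_measurable borel"
      by measurable
    then show "(\<lambda>x. Complex (a x) (b x)) \<in> borel_measurable borel"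
      by (simp add: Complex_eq)
    show "AE x in lborel. f x = Complex (a x) (b x)"
      using ab by eventually_elim (simp add: complex_eq_iff)
  qed
qed

lemma AE_lborel_neq: "AE y in lborel. y \<noteq> x" for x :: "'a::euclidean_space"
  by (rule AE_I'[of "{x}"]) (auto simp: null_sets_def)

context
  fixes \<alpha> :: real and K :: "real ^ 'n::finite \<Rightarrow> real ^ 'n \<Rightarrow> complex"
  assumes \<alpha>: "\<alpha> < real CARD('n)" and SFCZK: "SFCZK \<alpha> K"
begin

text \<open>The operator sees neither the diagonal values of the kernel nor changes of \<open>f\<close> on null sets,
  hence it can be written as a Borel parameter integral.\<close>

lemma
  fixes f g :: "real ^ 'n \<Rightarrow> complex"
  assumes f [measurable]: "f \<in> borel_measurable lebesgue" and g [measurable]: "g \<in> borel_measurable borel"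
    and fg: "AE x in lborel. f x = g x"
  shows osc_op_eq: "osc_op P K f x = (LINT y|lborel. osc_integrand P (off_diagonal K) g x y)"
    and osc_integrable_iff: "integrable lebesgue (osc_integrand P K f x) \<longleftrightarrow> integrable lborel (osc_integrand P (off_diagonal K) g x)"
    and osc_op_measurable: "osc_op P K f \<in> borel_measurable borel"
    and osc_integrand_measurable: "osc_integrand P (off_diagonal K) g x \<in> borel_measurable borel"
proof -
  note [measurable] = off_diagonal_measurable[OF \<alpha> SFCZK] poly2_eval_measurable[of P]
  have joint: "(\<lambda>p. osc_integrand P (off_diagonal K) g (fst p) (snd p)) \<in> borel_measurable (borel \<Otimes>\<^sub>M borel)"
    unfolding osc_integrand_def by measurable
  then show m: "osc_integrand P (off_diagonal K) g x \<in> borel_measurable borel" for x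
    using measurable_compose[OF measurable_Pair1'[of x borel borel] joint] by simp
  have mL: "osc_integrand P (off_diagonal K) g x \<in> borel_measurable lebesgue" for x
    using m[of x] by (intro measurable_completion) simp
  have fm: "osc_integrand P K f x \<in> borel_measurable lebesgue" for x
  proof -
    have "poly2_eval P x \<in> borel_measurable borel"
      using measurable_compose[OF measurable_Pair1'[of x borel borel] poly2_eval_measurable[of P]] by simp
    then have [measurable]: "poly2_eval P x \<in> borel_measurable lebesgue"
      by (intro measurable_completion) simp
    have [measurable]: "off_diagonal K x \<in> borel_measurable lebesgue"
      using off_diagonal_section[OF \<alpha> SFCZK, of x] by (intro measurable_completion) simp
    have [measurable]: "Measurable.pred lebesgue (\<lambda>y. y = x)"
      by (rule measurable_completion) simp
    have "K x y = (if y = x then K x x else off_diagonal K x y)" for y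
      by (auto simp: off_diagonal_def)
    then have "osc_integrand P K f x = (\<lambda>y. exp (\<i> * complex_of_real (poly2_eval P x y)) * (if y = x then K x x else off_diagonal K x y) * f y)"
      by (simp add: osc_integrand_def fun_eq_iff)
    then show ?thesis by simp
  qed
  have "AE y in lborel. osc_integrand P K f x y = osc_integrand P (off_diagonal K) g x y" for x
    using AE_lborel_neq[of x] fg by eventually_elim (simp add: osc_integrand_def off_diagonal_def)
  then have ae: "AE y in lebesgue. osc_integrand P K f x y = osc_integrand P (off_diagonal K) g x y" for x
    by (rule AE_completion)
  show eq: "osc_op P K f x = (LINT y|lborel. osc_integrand P (off_diagonal K) g x y)" for x
  proof -
    have "osc_op P K f x = (LINT y|lebesgue. osc_integrand P (off_diagonal K) g x y)"
      unfolding osc_op_def by (intro integral_cong_AE fm mL ae)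
    also have "\<dots> = (LINT y|lborel. osc_integrand P (off_diagonal K) g x y)"
      using m by (intro integral_completion) simp
    finally show ?thesis .
  qed
  show "integrable lebesgue (osc_integrand P K f x) \<longleftrightarrow> integrable lborel (osc_integrand P (off_diagonal K) g x)"
  proof -
    have "integrable lebesgue (osc_integrand P K f x) \<longleftrightarrow> integrable lebesgue (osc_integrand P (off_diagonal K) g x)"
      by (intro integrable_cong_AE fm mL ae)
    also have "\<dots> \<longleftrightarrow> integrable lborel (osc_integrand P (off_diagonal K) g x)"
      using m by (intro integrable_completion) simp
    finally show ?thesis .
  qed
  have "osc_op P K f = (\<lambda>x. LINT y|lborel. osc_integrand P (off_diagonal K) g x y)"
    using eq by (simp add: fun_eq_iff)
  moreover have "(\<lambda>x. LINT y|lborel. osc_integrand P (off_diagonal K) g x y) \<in> borel_measurable borel"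
    using joint by (intro lborel.borel_measurable_lebesgue_integral) (simp add: case_prod_beta cong: measurable_cong_sets sets_pair_measure_cong)
  ultimately show "osc_op P K f \<in> borel_measurable borel" by simp
qed

lemma osc_op_le_Riesz:
  obtains C where "0 < C"
    "\<And>P f g x. f \<in> borel_measurable lebesgue \<Longrightarrow> g \<in> borel_measurable borel \<Longrightarrow> AE x in lborel. f x = g x \<Longrightarrow>
       ennreal (cmod (osc_op P K f x)) \<le> ennreal C * Riesz (real CARD('n) - \<alpha>) (\<lambda>y. ennreal (cmod (g y))) x"
    "\<And>P f g x. f \<in> borel_measurable lebesgue \<Longrightarrow> g \<in> borel_measurable borel \<Longrightarrow> AE x in lborel. f x = g x \<Longrightarrow>
       Riesz (real CARD('n) - \<alpha>) (\<lambda>y. ennreal (cmod (g y))) x < top \<Longrightarrow> integrable lebesgue (osc_integrand P K f x)"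
proof -
  obtain C where C: "0 < C" "\<And>x y. x \<noteq> y \<Longrightarrow> cmod (K x y) \<le> C * dist x y powr (- (real CARD('n) - \<alpha>))"
    using SFCZK_size[OF \<alpha> SFCZK] by blast
  have bound: "(\<integral>\<^sup>+y. ennreal (cmod (osc_integrand P (off_diagonal K) g x y)) \<partial>lborel)
     \<le> ennreal C * Riesz (real CARD('n) - \<alpha>) (\<lambda>y. ennreal (cmod (g y))) x"
    if [measurable]: "g \<in> borel_measurable borel" for P g x
  proof -
    have "(\<integral>\<^sup>+y. ennreal (cmod (osc_integrand P (off_diagonal K) g x y)) \<partial>lborel)
      \<le> (\<integral>\<^sup>+y. ennreal C * (ennreal (dist x y powr (- (real CARD('n) - \<alpha>))) * ennreal (cmod (g y))) \<partial>lborel)"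
    proof (intro nn_integral_mono, goal_cases)
      case (1 y)
      have "cmod (osc_integrand P (off_diagonal K) g x y) = cmod (off_diagonal K x y) * cmod (g y)"
        by (simp add: osc_integrand_def norm_mult)
      also have "\<dots> \<le> (C * dist x y powr (- (real CARD('n) - \<alpha>))) * cmod (g y)"
        using C(2)[of x y] C(1) by (intro mult_right_mono) (auto simp: off_diagonal_def)
      finally show ?case
        using C(1) by (simp add: ennreal_mult[symmetric] mult.assoc ennreal_leI)
    qed
    also have "\<dots> = ennreal C * Riesz (real CARD('n) - \<alpha>) (\<lambda>y. ennreal (cmod (g y))) x"
      unfolding Riesz_def by (intro nn_integral_cmult) measurable
    finally show ?thesis .
  qed
  show ?thesis
  proof (rule that[OF C(1)])
    fix P :: "'n poly2" and f g :: "real ^ 'n \<Rightarrow> complex" and x :: "real ^ 'n"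
    assume A: "f \<in> borel_measurable lebesgue" "g \<in> borel_measurable borel" "AE x in lborel. f x = g x"
    show "ennreal (cmod (osc_op P K f x)) \<le> ennreal C * Riesz (real CARD('n) - \<alpha>) (\<lambda>y. ennreal (cmod (g y))) x"
    proof (cases "integrable lborel (osc_integrand P (off_diagonal K) g x)")
      case True
      then have "ennreal (cmod (osc_op P K f x)) \<le> (\<integral>\<^sup>+y. ennreal (cmod (osc_integrand P (off_diagonal K) g x y)) \<partial>lborel)"
        unfolding osc_op_eq[OF A] by (rule integral_norm_bound_ennreal)
      then show ?thesis using bound[OF A(2)] by (rule order_trans)
    next
      \<comment> \<open>The integral has the default value 0 here, so the bound holds for a trivial
        reason. Where the potential is finite, the second conclusion excludes this case.\<close>
      case False
      then have "osc_op P K f x = 0" unfolding osc_op_eq[OF A] by (rule not_integrable_integral_eq)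
      then show ?thesis by simp
    qed
    assume fin: "Riesz (real CARD('n) - \<alpha>) (\<lambda>y. ennreal (cmod (g y))) x < top"
    show "integrable lebesgue (osc_integrand P K f x)"
      unfolding osc_integrable_iff[OF A] unfolding integrable_iff_bounded
    proof
      show "osc_integrand P (off_diagonal K) g x \<in> borel_measurable lborel"
        using osc_integrand_measurable[OF A] by simp
      have "ennreal C * Riesz (real CARD('n) - \<alpha>) (\<lambda>y. ennreal (cmod (g y))) x < top"
        using fin by (simp add: ennreal_mult_less_top)
      then show "(\<integral>\<^sup>+y. ennreal (norm (osc_integrand P (off_diagonal K) g x y)) \<partial>lborel) < \<infinity>"
        using bound[OF A(2), of P x] by (simp add: order_le_less_trans)
    qed
  qed
qed

end

text \<open>Lebesgue measurability of \<open>w\<close> follows from local integrability by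
  exhausting the space with compact balls. Setting the Borel representative to 1 where it is not
  positive alters it only on a null set and makes it positive at every point.\<close>

lemma weight_Borel_version:
  fixes w :: "'a::euclidean_space \<Rightarrow> real"
  assumes "weight w"
  obtains v where "v \<in> borel_measurable borel" "\<And>x. 0 < v x" "AE x in lborel. w x = v x"
proof -
  have "w \<in> borel_measurable lebesgue"
  proof (rule borel_measurable_LIMSEQ_real)
    show "(\<lambda>x. indicator (cball 0 (real i)) x *\<^sub>R w x) \<in> borel_measurable lebesgue" for i
      using assms unfolding weight_def set_integrable_def by (intro borel_measurable_integrable) auto
    show "(\<lambda>i. indicator (cball 0 (real i)) x *\<^sub>R w x) \<longlonglongrightarrow> w x" for x
    proof (rule tendsto_eventually)
      obtain n where "norm x \<le> real n" using real_arch_simple by blast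
      then show "eventually (\<lambda>i. indicator (cball 0 (real i)) x *\<^sub>R w x = w x) sequentially"
        by (intro eventually_sequentiallyI[of n]) (auto split: split_indicator)
    qed
  qed
  then obtain v where "v \<in> borel_measurable lborel" and v: "AE x in lborel. w x = v x"
    using completion_ex_borel_measurable_real by blast
  then have [measurable]: "v \<in> borel_measurable borel" by simp
  have "AE x in lborel. 0 < w x"
    using assms by (simp add: weight_def AE_completion_iff)
  then have ae: "AE x in lborel. w x = (if 0 < v x then v x else 1)"
    using v by eventually_elim simp
  show ?thesis
    by (rule that[of "\<lambda>x. if 0 < v x then v x else 1"]) (use ae in auto)
qed

section \<open>Weights and operators on Morrey spaces\<close>

lemma ennreal_divide_le_iff':
  assumes "0 < y"
  shows "X / ennreal y \<le> N \<longleftrightarrow> X \<le> ennreal y * N"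
proof -
  have eq: "X / ennreal y = ennreal (1 / y) * X"
    using assms by (simp add: divide_ennreal_def inverse_ennreal inverse_eq_divide mult.commute)
  have one: "ennreal y * ennreal (1 / y) = 1" "ennreal (1 / y) * ennreal y = 1"
    using assms by (simp_all add: ennreal_mult[symmetric])
  show ?thesis
    unfolding eq
  proof
    assume "ennreal (1 / y) * X \<le> N"
    then have "ennreal y * (ennreal (1 / y) * X) \<le> ennreal y * N" by (intro mult_left_mono) auto
    then show "X \<le> ennreal y * N" by (simp add: one mult.assoc[symmetric])
  next
    assume "X \<le> ennreal y * N"
    then have "ennreal (1 / y) * X \<le> ennreal (1 / y) * (ennreal y * N)" by (intro mult_left_mono) auto
    then show "ennreal (1 / y) * X \<le> N" by (simp add: one mult.assoc[symmetric])
  qed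
qed

lemma nn_integral_lebesgue_Borel_version:
  assumes "AE x in lborel. f x = g x"
  shows "(\<integral>\<^sup>+x. f x \<partial>lebesgue) = (\<integral>\<^sup>+x. g x \<partial>lborel)"
  unfolding nn_integral_completion by (intro nn_integral_cong_AE assms)

lemma wmeasure_eq:
  fixes v :: "'a::euclidean_space \<Rightarrow> real"
  assumes ae: "AE x in lborel. w x = v x" and [measurable]: "v \<in> borel_measurable borel" "E \<in> sets borel"
  shows "wmeasure w E = emeasure (density lborel (\<lambda>x. ennreal (v x))) E"
proof -
  have "wmeasure w E = (\<integral>\<^sup>+x. ennreal (v x) * indicator E x \<partial>lborel)"
    unfolding wmeasure_def
    by (intro nn_integral_lebesgue_Borel_version eventually_mono[OF ae]) simp
  then show ?thesis by (simp add: emeasure_density)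
qed

lemma avg_ball:
  fixes v :: "'a::euclidean_space \<Rightarrow> real"
  assumes "AE x in lborel. w x = v x" "v \<in> borel_measurable borel" and r: "0 < r"
  shows "avg (ball c r) w = emeasure (density lborel (\<lambda>x. ennreal (v x))) (ball c r) / ennreal (unit_ball_vol DIM('a) * r powr DIM('a))"
proof -
  have "emeasure lebesgue (ball c r) = emeasure lborel (ball c r)"
    by simp
  then show ?thesis
    using wmeasure_eq[OF assms(1,2), of "ball c r"] r
    by (simp add: avg_def wmeasure_def emeasure_ball powr_realpow)
qed

text \<open>Multiplying the class condition by the power \<open>G = 1 / q + 1 / p'\<close> of the
  volume \<open>V * r powr DIM('a)\<close> turns averages into masses, which is the origin of the
  constant \<open>M * V powr G\<close>.\<close>

lemma A_class_dual_weights: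
  fixes w v :: "'a::euclidean_space \<Rightarrow> real"
  assumes p: "1 < p" and q: "0 < q" and w: "w \<in> A_class p q"
    and v [measurable]: "v \<in> borel_measurable borel" and v_pos: "\<And>x. 0 < v x" and wv: "AE x in lborel. w x = v x"
  shows "\<exists>C0. dual_weights (\<lambda>x. v x powr q) (\<lambda>x. v x powr (- (p / (p - 1)))) (1 / q) (1 - 1 / p) C0"
proof -
  define p' where "p' = p / (p - 1)"
  have p': "0 < p'" "1 / p' = 1 - 1 / p" using p by (auto simp: p'_def field_simps)
  define V where "V = unit_ball_vol (real DIM('a))"
  have V: "0 < V" by (simp add: V_def)
  define X where "X c r = emeasure (density lborel (\<lambda>x. ennreal (v x powr q))) (ball c r)" for c r
  define Y where "Y c r = emeasure (density lborel (\<lambda>x. ennreal (v x powr (- p')))) (ball c r)" for c r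
  define G where "G = 1 / q + (1 - 1 / p)"
  define S where "S = (SUP B\<in>balls. (avg B (\<lambda>x. w x powr q)) epowr (1 / q) * (avg B (\<lambda>x. w x powr (- p'))) epowr (1 / p'))"
  have "S < top"
    using w p unfolding A_class_def S_def p'_def Let_def by auto
  then obtain M where M: "S = ennreal M" "0 \<le> M" by (cases S rule: ennreal_cases) auto
  have aeq: "AE x in lborel. w x powr q = v x powr q" "AE x in lborel. w x powr (- p') = v x powr (- p')"
    using wv by (auto elim!: eventually_mono)
  have pos: "0 < X c r" "0 < Y c r" if "0 < r" for c r
    unfolding X_def Y_def using that less_imp_neq[OF v_pos]
    by (auto intro!: emeasure_density_ball_pos)
  have main: "X c r epowr (1 / q) * Y c r epowr (1 / p') \<le> ennreal (M * (V powr G * r powr (DIM('a) * G)))" if r: "0 < r" for c r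
  proof -
    define m where "m = V * r powr DIM('a)"
    have m: "0 < m" using V r by (simp add: m_def)
    have "(avg (ball c r) (\<lambda>x. w x powr q)) epowr (1 / q) * (avg (ball c r) (\<lambda>x. w x powr (- p'))) epowr (1 / p') \<le> ennreal M"
      unfolding M(1)[symmetric] S_def using r by (intro SUP_upper) (auto simp: balls_def)
    moreover have "avg (ball c r) (\<lambda>x. w x powr q) = X c r / ennreal m"
      unfolding X_def m_def V_def by (rule avg_ball[OF aeq(1) _ r]) simp
    moreover have "avg (ball c r) (\<lambda>x. w x powr (- p')) = Y c r / ennreal m"
      unfolding Y_def m_def V_def by (rule avg_ball[OF aeq(2) _ r]) simp
    ultimately have "(X c r epowr (1 / q) / ennreal (m powr (1 / q))) * (Y c r epowr (1 / p') / ennreal (m powr (1 / p'))) \<le> ennreal M"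
      using m by (simp add: epowr_divide)
    moreover have "(X c r epowr (1 / q) / ennreal (m powr (1 / q))) * (Y c r epowr (1 / p') / ennreal (m powr (1 / p')))
      = (X c r epowr (1 / q) * Y c r epowr (1 / p')) / ennreal (m powr G)"
    proof -
      have "ennreal (1 / m powr (1 / q)) * ennreal (1 / m powr (1 / p')) = ennreal (1 / m powr G)"
        using m by (subst ennreal_mult[symmetric]) (auto simp: G_def p'(2)[symmetric] powr_add)
      moreover have "A / ennreal (m powr x) = A * ennreal (1 / m powr x)" for A x
        using m by (simp add: divide_ennreal_def inverse_ennreal inverse_eq_divide)
      ultimately show ?thesis by (simp only: ac_simps)
    qed
    ultimately have "X c r epowr (1 / q) * Y c r epowr (1 / p') \<le> ennreal (m powr G) * ennreal M"
      using m by (simp add: ennreal_divide_le_iff')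
    also have "\<dots> = ennreal (M * (V powr G * r powr (DIM('a) * G)))"
      using M V by (subst ennreal_mult[symmetric]) (auto simp: m_def powr_mult powr_powr ac_simps)
    finally show ?thesis .
  qed
  \<comment> \<open>The class condition bounds only the product of the two masses. As neither is
    zero, both are finite; this is where the local integrability of both powers of the weight comes
    from.\<close>
  have fin: "X c r < top" "Y c r < top" for c r
  proof -
    have "X c r < top \<and> Y c r < top"
    proof (cases "0 < r")
      case True
      have "X c r epowr (1 / q) * Y c r epowr (1 / p') < top"
        using main[OF True, of c] by (rule order_le_less_trans) simp
      then show ?thesis
        using pos[OF True, of c] by (auto simp: less_top[symmetric] ennreal_mult_eq_top_iff)
    next
      case False
      then show ?thesis by (simp add: X_def Y_def ball_empty)
    qed
    then show "X c r < top" "Y c r < top" by auto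
  qed
  show ?thesis
  proof (intro exI[of _ "M * V powr G"], unfold_locales)
    show "(v x powr q) powr (1 / q) * (v x powr (- (p / (p - 1)))) powr (1 - 1 / p) = 1" for x
    proof -
      have "- p' * (1 / p') = - 1" using p'(1) by simp
      then have "(v x powr (- p')) powr (1 / p') = v x powr (- 1)" by (simp only: powr_powr)
      then show ?thesis
        using v_pos[of x] q unfolding p'_def[symmetric] p'(2)[symmetric] by (simp add: powr_powr powr_minus)
    qed
    show "emeasure (density lborel (\<lambda>x. ennreal (v x powr q))) (ball c r) < top" for c r
      using fin(1)[of c r] by (simp add: X_def)
    show "emeasure (density lborel (\<lambda>x. ennreal (v x powr - (p / (p - 1))))) (ball c r) < top" for c r
      using fin(2)[of c r] by (simp add: Y_def p'_def)
    fix r :: real and c :: 'a assume r: "0 < r"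
    have "ennreal (measure (density lborel (\<lambda>x. ennreal (v x powr q))) (ball c r) powr (1 / q) *
        measure (density lborel (\<lambda>x. ennreal (v x powr (- p')))) (ball c r) powr (1 / p')) = X c r epowr (1 / q) * Y c r epowr (1 / p')"
      using fin[of c r] by (simp add: X_def Y_def emeasure_eq_ennreal_measure ennreal_mult)
    also have "\<dots> \<le> ennreal (M * (V powr G * r powr (DIM('a) * G)))" by (rule main[OF r])
    finally show "measure (density lborel (\<lambda>x. ennreal (v x powr q))) (ball c r) powr (1 / q) *
        measure (density lborel (\<lambda>x. ennreal (v x powr - (p / (p - 1))))) (ball c r) powr (1 - 1 / p)
        \<le> M * V powr G * r powr (real DIM('a) * (1 / q + (1 - 1 / p)))"
      using M unfolding p'_def[symmetric] p'(2)[symmetric] by (simp add: G_def p'(2)[symmetric] mult.assoc)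
  qed (use p q v_pos less_imp_neq[OF v_pos, symmetric] in auto)
qed

lemma A_class_A1_weight:
  fixes w v :: "'a::euclidean_space \<Rightarrow> real"
  assumes q: "1 < q" and w: "w \<in> A_class 1 q"
    and v [measurable]: "v \<in> borel_measurable borel" and v_pos: "\<And>x. 0 < v x" and wv: "AE x in lborel. w x = v x"
  shows "\<exists>A. A1_weight v q A"
proof -
  define V where "V = unit_ball_vol (real DIM('a))"
  have V: "0 < V" by (simp add: V_def)
  define X where "X c r = emeasure (density lborel (\<lambda>x. ennreal (v x powr q))) (ball c r)" for c r
  define S where "S = (SUP B\<in>balls. (avg B (\<lambda>x. w x powr q)) epowr (1 / q) * esssup (lebesgue_on B) (\<lambda>x. 1 / ennreal (w x)))"
  have "S < top"
    using w unfolding A_class_def S_def by auto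
  then obtain M where M: "S = ennreal M" "0 \<le> M" by (cases S rule: ennreal_cases) auto
  have aeq: "AE x in lborel. w x powr q = v x powr q"
    using wv by (auto elim!: eventually_mono)
  \<comment> \<open>Only \<open>0 \<le> M\<close> is known, and \<open>M + 1\<close> makes
    \<open>A\<close> positive.\<close>
  define A where "A = (M + 1) * V powr (1 / q)"
  have main: "AE x in lborel. x \<in> ball c r \<longrightarrow> X c r epowr (1 / q) \<le> ennreal (A * r powr (DIM('a) / q) * v x)" if r: "0 < r" for c r
  proof -
    define m where "m = V * r powr DIM('a)"
    have m: "0 < m" using V r by (simp add: m_def)
    let ?E = "esssup (lebesgue_on (ball c r)) (\<lambda>x. 1 / ennreal (w x))"
    have "(avg (ball c r) (\<lambda>x. w x powr q)) epowr (1 / q) * ?E \<le> ennreal M"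
      unfolding M(1)[symmetric] S_def using r by (intro SUP_upper) (auto simp: balls_def)
    moreover have "avg (ball c r) (\<lambda>x. w x powr q) = X c r / ennreal m"
      unfolding X_def m_def V_def by (rule avg_ball[OF aeq _ r]) simp
    ultimately have S: "X c r epowr (1 / q) / ennreal (m powr (1 / q)) * ?E \<le> ennreal M"
      using m by (simp add: epowr_divide)
    have "AE x in lebesgue_on (ball c r). 1 / ennreal (w x) \<le> ?E"
      by (rule esssup_AE)
    then have "AE x in lebesgue. x \<in> ball c r \<longrightarrow> 1 / ennreal (w x) \<le> ?E"
      by (subst (asm) AE_restrict_space_iff) auto
    then have "AE x in lborel. x \<in> ball c r \<longrightarrow> 1 / ennreal (w x) \<le> ?E"
      by (simp add: AE_completion_iff)
    then show ?thesis
      using wv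
    proof eventually_elim
      case (elim x)
      show ?case
      proof
        assume "x \<in> ball c r"
        with elim have "1 / ennreal (v x) \<le> ?E" by simp
        then have "X c r epowr (1 / q) / ennreal (m powr (1 / q)) * (1 / ennreal (v x)) \<le> ennreal M"
          using S by (meson mult_left_mono order_trans zero_le)
        also have "X c r epowr (1 / q) / ennreal (m powr (1 / q)) * (1 / ennreal (v x)) = X c r epowr (1 / q) / ennreal (m powr (1 / q)) / ennreal (v x)"
          by (simp add: divide_ennreal_def)
        finally have "X c r epowr (1 / q) \<le> ennreal (m powr (1 / q)) * (ennreal (v x) * ennreal M)"
          using m v_pos[of x] by (simp add: ennreal_divide_le_iff')
        also have "\<dots> = ennreal (M * V powr (1 / q) * r powr (DIM('a) / q) * v x)"
          using M v_pos[of x] V by (simp add: ennreal_mult[symmetric] m_def powr_mult powr_powr)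
        also have "\<dots> \<le> ennreal (A * r powr (DIM('a) / q) * v x)"
          using v_pos[of x] unfolding A_def by (intro ennreal_leI mult_right_mono) auto
        finally show "X c r epowr (1 / q) \<le> ennreal (A * r powr (DIM('a) / q) * v x)" .
      qed
    qed
  qed
  have fin: "X c r < top" for c r
  proof (cases "0 < r")
    case True
    show ?thesis
    \<comment> \<open>An infinite mass would contradict the finite bound \<open>main\<close> at
      almost every point of the ball, which would make the ball a null set.\<close>
    proof (rule ccontr)
      assume "\<not> X c r < top"
      then have "X c r = top" by (simp add: less_top[symmetric])
      with main[OF True, of c] have "AE x in lborel. x \<notin> ball c r"
        by (auto simp: top_unique elim: eventually_mono)
      then have "emeasure lborel (ball c r) = 0"
        by (subst (asm) AE_iff_measurable[of "ball c r"]) auto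
      moreover have "0 < emeasure lborel (ball c r)"
        using True by (simp add: emeasure_ball)
      ultimately show False by simp
    qed
  qed (simp add: X_def ball_empty)
  show ?thesis
  proof (intro exI[of _ A], unfold_locales)
    show "0 < A" using M V by (simp add: A_def)
    show "emeasure (density lborel (\<lambda>x. ennreal (v x powr q))) (ball c r) < top" for c r
      using fin[of c r] by (simp add: X_def)
    fix r :: real and c :: 'a assume r: "0 < r"
    have X: "X c r epowr (1 / q) = ennreal (measure (density lborel (\<lambda>x. ennreal (v x powr q))) (ball c r) powr (1 / q))"
      using fin[of c r] by (simp add: X_def emeasure_eq_ennreal_measure)
    show "AE x in lborel. x \<in> ball c r \<longrightarrow>
      measure (density lborel (\<lambda>x. ennreal (v x powr q))) (ball c r) powr (1 / q) \<le> A * r powr (DIM('a) / q) * v x"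
      using main[OF r, of c] unfolding X
    proof eventually_elim
      case (elim x)
      then show ?case
        using \<open>0 < A\<close> v_pos[of x] by (auto simp: ennreal_le_iff)
    qed
  qed (use q v_pos in auto)
qed

section \<open>The two estimates for the oscillatory operator\<close>

context
  fixes \<alpha> :: real and K :: "real ^ 'n::finite \<Rightarrow> real ^ 'n \<Rightarrow> complex"
  assumes \<alpha>: "0 < \<alpha>" "\<alpha> < real CARD('n)" and SFCZK: "SFCZK \<alpha> K"
begin

lemma osc_op_strong:
  fixes p q k :: real and w :: "real ^ 'n \<Rightarrow> real"
  assumes p: "1 < p" "p < real CARD('n) / \<alpha>" and pq: "1 / q = 1 / p - \<alpha> / real CARD('n)"
    and k: "0 < k" "k < p / q" and w: "w \<in> A_class p q"
  shows "\<exists>C>0. \<forall>P :: 'n poly2. \<forall>f \<in> morrey_space p k (\<lambda>x. w x powr p) (\<lambda>x. w x powr q).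
            osc_defined P K f \<and>
            osc_op P K f \<in> morrey_space q (q * k / p) (\<lambda>x. w x powr q) (\<lambda>x. w x powr q) \<and>
            morrey_norm q (q * k / p) (\<lambda>x. w x powr q) (\<lambda>x. w x powr q) (osc_op P K f)
              \<le> ennreal C * morrey_norm p k (\<lambda>x. w x powr p) (\<lambda>x. w x powr q) f"
proof -
  let ?n = "real CARD('n)"
  have n: "0 < ?n" by simp
  have "\<alpha> / ?n < 1 / p" using p \<alpha> n by (simp add: field_simps)
  then have "0 < 1 / q" using pq by simp
  then have q: "0 < q" by simp
  have "weight w" using w by (simp add: A_class_def)
  then obtain v where v [measurable]: "v \<in> borel_measurable borel" and v_pos: "\<And>x. 0 < v x" and wv: "AE x in lborel. w x = v x"
    using weight_Borel_version by blast
  obtain C0 where dw: "dual_weights (\<lambda>x. v x powr q) (\<lambda>x. v x powr (- (p / (p - 1)))) (1 / q) (1 - 1 / p) C0"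
    using A_class_dual_weights[OF p(1) q w v v_pos wv] by blast
  interpret dual_weights "\<lambda>x. v x powr q" "\<lambda>x. v x powr (- (p / (p - 1)))" "1 / q" "1 - 1 / p" C0
    by (rule dw)
  \<comment> \<open>The root \<open>1 / p\<close> of the power \<open>k\<close> of the mass and the
    root \<open>1 / q\<close> of its power \<open>q * k / p\<close> are the same power \<kappa>, so
    one exponent serves both Morrey norms; \<open>k < p / q\<close> becomes
    \<open>\<kappa> < 1 / q\<close>.\<close>
  define \<kappa> where "\<kappa> = k / p"
  have \<kappa>: "0 < \<kappa>" "\<kappa> < 1 / q" using k p q by (auto simp: \<kappa>_def field_simps)
  have sum: "1 / q + (1 - 1 / p) < 1" using pq \<alpha> n by simp
  have \<beta>: "DIM(real ^ 'n) * (1 / q + (1 - 1 / p)) = ?n - \<alpha>" using pq n by (simp add: field_simps)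
  have pp: "1 - (1 - 1 / p) = 1 / p" "1 / (1 / p) = p" "1 / (1 / q) = q" by auto
  from Riesz_Morrey[OF sum \<kappa>] obtain C1 where C1: "0 < C1" and C1': "\<forall>(F :: real ^ 'n \<Rightarrow> real) N. F \<in> borel_measurable borel \<longrightarrow> (\<forall>y. 0 \<le> F y) \<longrightarrow>
    (\<forall>c r. 0 < r \<longrightarrow> (\<integral>\<^sup>+y\<in>ball c r. ennreal (F y powr p * (v y powr q) powr (1 / q * p)) \<partial>lborel) epowr (1 / p)
        \<le> ennreal (U c r powr \<kappa>) * N) \<longrightarrow>
    (\<forall>c r. 0 < r \<longrightarrow> (\<integral>\<^sup>+x\<in>ball c r. Riesz (?n - \<alpha>) F x epowr q * ennreal (v x powr q) \<partial>lborel) epowr (1 / q)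
        \<le> ennreal (C1 * U c r powr \<kappa>) * N)"
    unfolding \<beta> pp by (elim exE conjE)
  obtain C2 where C2: "0 < C2"
    and C2': "\<And>P f g x. f \<in> borel_measurable lebesgue \<Longrightarrow> g \<in> borel_measurable borel \<Longrightarrow> AE x in lborel. f x = g x \<Longrightarrow>
       ennreal (cmod (osc_op P K f x)) \<le> ennreal C2 * Riesz (?n - \<alpha>) (\<lambda>y. ennreal (cmod (g y))) x"
    and C2'': "\<And>P f g x. f \<in> borel_measurable lebesgue \<Longrightarrow> g \<in> borel_measurable borel \<Longrightarrow> AE x in lborel. f x = g x \<Longrightarrow>
       Riesz (?n - \<alpha>) (\<lambda>y. ennreal (cmod (g y))) x < top \<Longrightarrow> integrable lebesgue (osc_integrand P K f x)"
    by (rule osc_op_le_Riesz[OF \<alpha>(2) SFCZK]) (assumption | blast)+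
  have wm: "wmeasure (\<lambda>x. w x powr q) (ball c r) = ennreal (U c r)" for c r
  proof -
    have "AE x in lborel. w x powr q = v x powr q" using wv by eventually_elim simp
    then show ?thesis unfolding emeasure_u_ball[symmetric] by (rule wmeasure_eq) auto
  qed
  show ?thesis
  proof (intro exI[of _ "C2 * C1"] conjI allI ballI)
    show "0 < C2 * C1" using C1 C2 by simp
    fix P :: "'n poly2" and f
    assume f_in: "f \<in> morrey_space p k (\<lambda>x. w x powr p) (\<lambda>x. w x powr q)"
    then have f: "f \<in> borel_measurable lebesgue" by (simp add: morrey_space_def)
    define N where "N = morrey_norm p k (\<lambda>x. w x powr p) (\<lambda>x. w x powr q) f"
    have N: "N < top" using f_in by (simp add: morrey_space_def N_def)
    obtain g where g [measurable]: "g \<in> borel_measurable borel" and fg: "AE x in lborel. f x = g x"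
      using complex_Borel_version[OF f] by blast
    let ?R = "Riesz (?n - \<alpha>) (\<lambda>y. ennreal (cmod (g y)))"
    have [measurable]: "osc_op P K f \<in> borel_measurable borel"
      by (rule osc_op_measurable[OF \<alpha>(2) SFCZK f g fg])
    have hyp: "(\<integral>\<^sup>+y\<in>ball c r. ennreal (cmod (g y) powr p * (v y powr q) powr (1 / q * p)) \<partial>lborel) epowr (1 / p)
        \<le> ennreal (U c r powr \<kappa>) * N" if r: "0 < r" for c r
    proof -
      let ?I = "\<integral>\<^sup>+x\<in>ball c r. ennreal (cmod (f x) powr p * w x powr p) \<partial>lebesgue"
      have "(?I / (wmeasure (\<lambda>x. w x powr q) (ball c r)) epowr k) epowr (1 / p) \<le> N"
        unfolding N_def morrey_norm_def using r by (intro SUP_upper) (auto simp: balls_def)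
      then have "?I epowr (1 / p) / ennreal (U c r powr \<kappa>) \<le> N"
        using U_pos[OF r, of c] by (simp add: wm epowr_divide powr_powr \<kappa>_def)
      then have "?I epowr (1 / p) \<le> ennreal (U c r powr \<kappa>) * N"
        using U_pos[OF r, of c] by (simp add: ennreal_divide_le_iff')
      moreover have "?I = (\<integral>\<^sup>+y\<in>ball c r. ennreal (cmod (g y) powr p * (v y powr q) powr (1 / q * p)) \<partial>lborel)"
      proof (rule nn_integral_lebesgue_Borel_version)
        show "AE x in lborel. ennreal (cmod (f x) powr p * w x powr p) * indicator (ball c r) x
          = ennreal (cmod (g x) powr p * (v x powr q) powr (1 / q * p)) * indicator (ball c r) x"
          using fg wv by eventually_elim (use q in \<open>simp add: powr_powr\<close>)
      qed
      ultimately show ?thesis by simp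
    qed
    have R_bound: "(\<integral>\<^sup>+x\<in>ball c r. ?R x epowr q * ennreal (v x powr q) \<partial>lborel) epowr (1 / q)
        \<le> ennreal (C1 * U c r powr \<kappa>) * N" if "0 < r" for c r
      using hyp that by (intro C1'[rule_format]) auto
    \<comment> \<open>Existence of the operator: the Morrey bound makes the potential finite almost
      everywhere on each of countably many balls that exhaust the space, and \<open>C2''\<close>
      turns finiteness into integrability.\<close>
    have "AE x in lborel. x \<in> ball 0 (real (Suc i)) \<longrightarrow> ?R x < top" for i
    proof -
      have "(\<integral>\<^sup>+x. ?R x epowr q * ennreal (v x powr q) * indicator (ball 0 (real (Suc i))) x \<partial>lborel) epowr (1 / q) < top"
        using R_bound[of "real (Suc i)" 0] N by (simp add: ennreal_mult_less_top order_le_less_trans)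
      then have "(\<integral>\<^sup>+x. ?R x epowr q * ennreal (v x powr q) * indicator (ball 0 (real (Suc i))) x \<partial>lborel) \<noteq> \<infinity>"
        by (simp add: epowr_less_top_iff less_top)
      then have "AE x in lborel. ?R x epowr q * ennreal (v x powr q) * indicator (ball 0 (real (Suc i))) x \<noteq> \<infinity>"
        by (intro nn_integral_PInf_AE) measurable
      then show ?thesis
      proof eventually_elim
        case (elim x)
        then show ?case
          using v_pos[of x] by (auto simp: less_top[symmetric] ennreal_mult_eq_top_iff less_imp_neq[symmetric])
      qed
    qed
    then have "AE x in lborel. \<forall>i. x \<in> ball 0 (real (Suc i)) \<longrightarrow> ?R x < top"
      by (subst AE_all_countable) blast
    then have "AE x in lborel. integrable lebesgue (osc_integrand P K f x)"
    proof eventually_elim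
      case (elim x)
      obtain i where "norm x < real i" using reals_Archimedean2 by blast
      then have "x \<in> ball 0 (real (Suc i))" by simp
      with elim have "?R x < top" by blast
      then show ?case by (rule C2''[OF f g fg])
    qed
    then show "osc_defined P K f"
      unfolding osc_defined_def by (rule AE_completion)
    have norm_le: "morrey_norm q (q * k / p) (\<lambda>x. w x powr q) (\<lambda>x. w x powr q) (osc_op P K f) \<le> ennreal (C2 * C1) * N"
      unfolding morrey_norm_def
    proof (rule SUP_least)
      fix B :: "(real ^ 'n) set" assume "B \<in> balls"
      then obtain c r where B: "B = ball c r" and r: "0 < r" by (auto simp: balls_def)
      let ?J = "\<integral>\<^sup>+x\<in>B. ennreal (cmod (osc_op P K f x) powr q * w x powr q) \<partial>lebesgue"
      have "?J = (\<integral>\<^sup>+x\<in>ball c r. ennreal (cmod (osc_op P K f x) powr q * v x powr q) \<partial>lborel)"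
      proof (rule nn_integral_lebesgue_Borel_version)
        show "AE x in lborel. ennreal (cmod (osc_op P K f x) powr q * w x powr q) * indicator B x
          = ennreal (cmod (osc_op P K f x) powr q * v x powr q) * indicator (ball c r) x"
          using wv by eventually_elim (simp add: B)
      qed
      also have "\<dots> \<le> (\<integral>\<^sup>+x. ennreal (C2 powr q) * (?R x epowr q * ennreal (v x powr q) * indicator (ball c r) x) \<partial>lborel)"
      proof (intro nn_integral_mono, goal_cases)
        case (1 x)
        have "ennreal (cmod (osc_op P K f x)) epowr q \<le> (ennreal C2 * ?R x) epowr q"
          using q by (intro epowr_mono C2' f g fg) auto
        then have "ennreal (cmod (osc_op P K f x) powr q) \<le> ennreal (C2 powr q) * ?R x epowr q"
          using C2 by (simp add: epowr_mult)
        then have "ennreal (cmod (osc_op P K f x) powr q) * (ennreal (v x powr q) * indicator (ball c r) x) \<le> ennreal (C2 powr q) * ?R x epowr q * (ennreal (v x powr q) * indicator (ball c r) x)"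
          by (intro mult_right_mono) auto
        then show ?case by (simp add: ennreal_mult mult.assoc)
      qed
      also have "\<dots> = ennreal (C2 powr q) * (\<integral>\<^sup>+x\<in>ball c r. ?R x epowr q * ennreal (v x powr q) \<partial>lborel)"
        by (intro nn_integral_cmult) measurable
      finally have "?J epowr (1 / q) \<le> (ennreal (C2 powr q) * (\<integral>\<^sup>+x\<in>ball c r. ?R x epowr q * ennreal (v x powr q) \<partial>lborel)) epowr (1 / q)"
        using q by (intro epowr_mono) auto
      also have "\<dots> = ennreal C2 * (\<integral>\<^sup>+x\<in>ball c r. ?R x epowr q * ennreal (v x powr q) \<partial>lborel) epowr (1 / q)"
        using q C2 by (simp add: epowr_mult powr_powr)
      also have "\<dots> \<le> ennreal C2 * (ennreal (C1 * U c r powr \<kappa>) * N)"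
        by (intro mult_left_mono R_bound r) simp
      also have "\<dots> = ennreal (U c r powr \<kappa>) * (ennreal (C2 * C1) * N)"
        using C1 C2 by (simp add: ennreal_mult ac_simps)
      finally have J: "?J epowr (1 / q) \<le> ennreal (U c r powr \<kappa>) * (ennreal (C2 * C1) * N)" .
      have e: "q * k / p * (1 / q) = \<kappa>" using q by (simp add: \<kappa>_def)
      have "(?J / (wmeasure (\<lambda>x. w x powr q) B) epowr (q * k / p)) epowr (1 / q) = ?J epowr (1 / q) / ennreal (U c r powr \<kappa>)"
        using U_pos[OF r, of c] powr_powr[of "U c r" "q * k / p" "1 / q"] unfolding B e by (simp add: wm epowr_divide)
      also have "\<dots> \<le> ennreal (C2 * C1) * N"
        using J U_pos[OF r, of c] by (simp add: ennreal_divide_le_iff')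
      finally show "(?J / (wmeasure (\<lambda>x. w x powr q) B) epowr (q * k / p)) epowr (1 / q) \<le> ennreal (C2 * C1) * N" .
    qed
    then show "morrey_norm q (q * k / p) (\<lambda>x. w x powr q) (\<lambda>x. w x powr q) (osc_op P K f)
              \<le> ennreal (C2 * C1) * morrey_norm p k (\<lambda>x. w x powr p) (\<lambda>x. w x powr q) f"
      by (simp add: N_def)
    have "osc_op P K f \<in> borel_measurable lebesgue"
      by (intro measurable_completion) simp
    moreover have "ennreal (C2 * C1) * N < top"
      using N by (simp add: ennreal_mult_less_top)
    ultimately show "osc_op P K f \<in> morrey_space q (q * k / p) (\<lambda>x. w x powr q) (\<lambda>x. w x powr q)"
      using norm_le by (auto simp: morrey_space_def intro: order_le_less_trans)
  qed
qed

lemma osc_op_weak: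
  fixes q k :: real and w :: "real ^ 'n \<Rightarrow> real"
  assumes q_def: "q = real CARD('n) / (real CARD('n) - \<alpha>)"
    and k: "0 < k" "k < 1 / q" and w: "w \<in> A_class 1 q"
  shows "\<exists>C>0. \<forall>P :: 'n poly2. \<forall>f \<in> morrey_space 1 k w (\<lambda>x. w x powr q).
          osc_defined P K f \<and> osc_op P K f \<in> borel_measurable lebesgue \<and>
          (\<forall>t>0. \<forall>B\<in>balls.
            wmeasure (\<lambda>x. w x powr q) {x \<in> B. cmod (osc_op P K f x) > t}
              \<le> ennreal (C / t powr q) * (morrey_norm 1 k w (\<lambda>x. w x powr q) f) epowr q
                  * (wmeasure (\<lambda>x. w x powr q) B) epowr (k * q))"
proof -
  let ?n = "real CARD('n)"
  have n: "0 < ?n" by simp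
  have q: "1 < q" using \<alpha> n by (simp add: q_def field_simps)
  have "weight w" using w by (simp add: A_class_def)
  then obtain v where v [measurable]: "v \<in> borel_measurable borel" and v_pos: "\<And>x. 0 < v x" and wv: "AE x in lborel. w x = v x"
    using weight_Borel_version by blast
  obtain A where aw: "A1_weight v q A"
    using A_class_A1_weight[OF q w v v_pos wv] by blast
  interpret A1_weight v q A by (rule aw)
  have \<beta>: "DIM(real ^ 'n) / q = ?n - \<alpha>" using \<alpha> n by (simp add: q_def)
  from Riesz_weak_Morrey[OF k] obtain C1 where C1: "0 < C1" and C1': "\<forall>F N. F \<in> borel_measurable borel \<longrightarrow>
    (\<forall>c r. 0 < r \<longrightarrow> (\<integral>\<^sup>+y\<in>ball c r. F y * ennreal (v y) \<partial>lborel) \<le> ennreal (U c r powr k) * N) \<longrightarrow>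
    (\<forall>c r t. 0 < r \<longrightarrow> 0 < t \<longrightarrow>
       emeasure Mu {x \<in> ball c r. ennreal t < Riesz (?n - \<alpha>) F x} \<le> ennreal (C1 / t powr q * U c r powr (k * q)) * N epowr q)"
    unfolding \<beta> by (elim exE conjE)
  obtain C2 where C2: "0 < C2"
    and C2': "\<And>P f g x. f \<in> borel_measurable lebesgue \<Longrightarrow> g \<in> borel_measurable borel \<Longrightarrow> AE x in lborel. f x = g x \<Longrightarrow>
       ennreal (cmod (osc_op P K f x)) \<le> ennreal C2 * Riesz (?n - \<alpha>) (\<lambda>y. ennreal (cmod (g y))) x"
    and C2'': "\<And>P f g x. f \<in> borel_measurable lebesgue \<Longrightarrow> g \<in> borel_measurable borel \<Longrightarrow> AE x in lborel. f x = g x \<Longrightarrow>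
       Riesz (?n - \<alpha>) (\<lambda>y. ennreal (cmod (g y))) x < top \<Longrightarrow> integrable lebesgue (osc_integrand P K f x)"
    by (rule osc_op_le_Riesz[OF \<alpha>(2) SFCZK]) (assumption | blast)+
  have wm: "wmeasure (\<lambda>x. w x powr q) E = emeasure Mu E" if "E \<in> sets borel" for E
  proof -
    have "AE x in lborel. w x powr q = v x powr q" using wv by eventually_elim simp
    then show ?thesis using that by (intro wmeasure_eq) auto
  qed
  show ?thesis
  proof (intro exI[of _ "C1 * C2 powr q"] conjI allI ballI impI)
    show "0 < C1 * C2 powr q" using C1 C2 by simp
    fix P :: "'n poly2" and f
    assume f_in: "f \<in> morrey_space 1 k w (\<lambda>x. w x powr q)"
    then have f: "f \<in> borel_measurable lebesgue" by (simp add: morrey_space_def)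
    define N where "N = morrey_norm 1 k w (\<lambda>x. w x powr q) f"
    have N: "N < top" using f_in by (simp add: morrey_space_def N_def)
    obtain g where g [measurable]: "g \<in> borel_measurable borel" and fg: "AE x in lborel. f x = g x"
      using complex_Borel_version[OF f] by blast
    let ?R = "Riesz (?n - \<alpha>) (\<lambda>y. ennreal (cmod (g y)))"
    have osc_meas [measurable]: "osc_op P K f \<in> borel_measurable borel"
      by (rule osc_op_measurable[OF \<alpha>(2) SFCZK f g fg])
    then show "osc_op P K f \<in> borel_measurable lebesgue"
      by (intro measurable_completion) simp
    have hyp: "(\<integral>\<^sup>+y\<in>ball c r. ennreal (cmod (g y)) * ennreal (v y) \<partial>lborel) \<le> ennreal (U c r powr k) * N"
      if r: "0 < r" for c r
    proof -
      let ?I = "\<integral>\<^sup>+x\<in>ball c r. ennreal (cmod (f x) powr 1 * w x) \<partial>lebesgue"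
      have "(?I / (wmeasure (\<lambda>x. w x powr q) (ball c r)) epowr k) epowr (1 / 1) \<le> N"
        unfolding N_def morrey_norm_def using r by (intro SUP_upper) (auto simp: balls_def)
      then have "?I / ennreal (U c r powr k) \<le> N"
        by (simp add: wm emeasure_u_ball)
      then have "?I \<le> ennreal (U c r powr k) * N"
        using U_pos[OF r, of c] by (simp add: ennreal_divide_le_iff')
      moreover have "?I = (\<integral>\<^sup>+y\<in>ball c r. ennreal (cmod (g y)) * ennreal (v y) \<partial>lborel)"
      proof (rule nn_integral_lebesgue_Borel_version)
        show "AE x in lborel. ennreal (cmod (f x) powr 1 * w x) * indicator (ball c r) x
          = ennreal (cmod (g x)) * ennreal (v x) * indicator (ball c r) x"
          using fg wv
        proof eventually_elim
          case (elim x)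
          then show ?case using v_pos[of x] by (simp add: ennreal_mult)
        qed
      qed
      ultimately show ?thesis by simp
    qed
    have weak: "emeasure Mu {x \<in> ball c r. ennreal t < ?R x} \<le> ennreal (C1 / t powr q * U c r powr (k * q)) * N epowr q"
      if "0 < r" "0 < t" for c r t
      using hyp that by (intro C1'[rule_format]) auto
    \<comment> \<open>A weak estimate bounds no integral of the potential. Instead, the set where
      the potential is infinite lies in every level set, and the masses of the level sets within a
      ball tend to 0.\<close>
    have "AE x in lborel. x \<in> ball 0 (real (Suc i)) \<longrightarrow> ?R x < top" for i
    proof -
      let ?E = "{x \<in> ball 0 (real (Suc i)). ?R x = top}"
      have [measurable]: "?E \<in> sets borel" by measurable
      obtain N' where N': "N = ennreal N'" "0 \<le> N'" using N by (cases N rule: ennreal_cases) auto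
      define D where "D = C1 * U 0 (real (Suc i)) powr (k * q) * N' powr q"
      have D: "0 \<le> D" using C1 by (simp add: D_def)
      have le: "emeasure Mu ?E \<le> ennreal (D / real (Suc j))" for j
      proof -
        \<comment> \<open>The level is chosen so that
          \<open>t powr q = real (Suc j)\<close>.\<close>
        define t where "t = real (Suc j) powr (1 / q)"
        have t: "0 < t" "t powr q = real (Suc j)" using q by (auto simp: t_def powr_powr)
        have "emeasure Mu ?E \<le> emeasure Mu {x \<in> ball 0 (real (Suc i)). ennreal t < ?R x}"
          by (intro emeasure_mono) auto
        also have "\<dots> \<le> ennreal (C1 / t powr q * U 0 (real (Suc i)) powr (k * q)) * N epowr q"
          using t by (intro weak) auto
        also have "\<dots> = ennreal (D / real (Suc j))"
          using C1 N' t by (simp add: ennreal_mult[symmetric] D_def)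
        finally show ?thesis .
      qed
      have "emeasure Mu ?E = 0"
      proof (rule ccontr)
        assume "emeasure Mu ?E \<noteq> 0"
        moreover have "emeasure Mu ?E < top" using le[of 0] by (rule order_le_less_trans) simp
        ultimately obtain e where e: "emeasure Mu ?E = ennreal e" "0 < e"
          by (cases "emeasure Mu ?E" rule: ennreal_cases) (auto simp: order.order_iff_strict)
        obtain j where "D / e < real j" using reals_Archimedean2 by blast
        then have "D / real (Suc j) < e" using e D by (simp add: field_simps)
        moreover have "e \<le> D / real (Suc j)" using le[of j] e D by (simp add: ennreal_le_iff)
        ultimately show False by simp
      qed
      then have "(\<integral>\<^sup>+x. ennreal (v x powr q) * indicator ?E x \<partial>lborel) = 0"
        by (simp add: emeasure_density)
      then have "AE x in lborel. ennreal (v x powr q) * indicator ?E x = 0"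
        by (subst (asm) nn_integral_0_iff_AE) auto
      then show ?thesis
      proof eventually_elim
        case (elim x)
        then show ?case using v_pos[of x] by (auto simp: less_top[symmetric] split: split_indicator_asm)
      qed
    qed
    then have "AE x in lborel. \<forall>i. x \<in> ball 0 (real (Suc i)) \<longrightarrow> ?R x < top"
      by (subst AE_all_countable) blast
    then have "AE x in lborel. integrable lebesgue (osc_integrand P K f x)"
    proof eventually_elim
      case (elim x)
      obtain i where "norm x < real i" using reals_Archimedean2 by blast
      then have "x \<in> ball 0 (real (Suc i))" by simp
      with elim have "?R x < top" by blast
      then show ?case by (rule C2''[OF f g fg])
    qed
    then show "osc_defined P K f"
      unfolding osc_defined_def by (rule AE_completion)
    fix t :: real and B :: "(real ^ 'n) set" assume t: "0 < t" and "B \<in> balls"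
    then obtain c r where B: "B = ball c r" and r: "0 < r" by (auto simp: balls_def)
    have "{x \<in> B. cmod (osc_op P K f x) > t} \<in> sets borel" unfolding B by measurable
    then have "wmeasure (\<lambda>x. w x powr q) {x \<in> B. cmod (osc_op P K f x) > t} = emeasure Mu {x \<in> B. cmod (osc_op P K f x) > t}"
      by (rule wm)
    \<comment> \<open>The kernel constant \<open>C2\<close> is moved into the level, and therefore
      enters the final constant as \<open>C2 powr q\<close>.\<close>
    also have "\<dots> \<le> emeasure Mu {x \<in> ball c r. ennreal (t / C2) < ?R x}"
    proof (intro emeasure_mono subsetI)
      fix x assume x: "x \<in> {x \<in> B. cmod (osc_op P K f x) > t}"
      have "ennreal (t / C2) < ?R x"
      proof (rule ccontr)
        assume "\<not> ennreal (t / C2) < ?R x"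
        then have "ennreal C2 * ?R x \<le> ennreal C2 * ennreal (t / C2)"
          by (intro mult_left_mono) auto
        also have "\<dots> = ennreal t" using C2 t by (simp add: ennreal_mult[symmetric])
        finally have "ennreal (cmod (osc_op P K f x)) \<le> ennreal t"
          using C2'[OF f g fg, of P x] by (rule order_trans[rotated])
        with x t show False by (simp add: ennreal_le_iff)
      qed
      with x B show "x \<in> {x \<in> ball c r. ennreal (t / C2) < ?R x}" by simp
    qed simp
    also have "\<dots> \<le> ennreal (C1 / (t / C2) powr q * U c r powr (k * q)) * N epowr q"
      using t C2 r by (intro weak) auto
    also have "C1 / (t / C2) powr q = C1 * C2 powr q / t powr q"
      using C2 t by (simp add: powr_divide)
    also have "ennreal (C1 * C2 powr q / t powr q * U c r powr (k * q)) * N epowr q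
      = ennreal (C1 * C2 powr q / t powr q) * N epowr q * (wmeasure (\<lambda>x. w x powr q) B) epowr (k * q)"
    proof -
      have "ennreal (C1 * C2 powr q / t powr q * U c r powr (k * q)) = ennreal (C1 * C2 powr q / t powr q) * ennreal (U c r powr (k * q))"
        using C1 by (intro ennreal_mult) auto
      moreover have "(wmeasure (\<lambda>x. w x powr q) B) epowr (k * q) = ennreal (U c r powr (k * q))"
        by (simp add: B wm emeasure_u_ball)
      ultimately show ?thesis by (simp only: ac_simps)
    qed
    finally show "wmeasure (\<lambda>x. w x powr q) {x \<in> B. cmod (osc_op P K f x) > t}
              \<le> ennreal (C1 * C2 powr q / t powr q) * (morrey_norm 1 k w (\<lambda>x. w x powr q) f) epowr q
                  * (wmeasure (\<lambda>x. w x powr q) B) epowr (k * q)"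
      by (simp add: N_def)
  qed
qed

end

theorem theorem1p3:
  fixes \<alpha> :: real and K :: "real ^ 'n::finite \<Rightarrow> real ^ 'n \<Rightarrow> complex"
  assumes "0 < \<alpha>" and "\<alpha> < real CARD('n)" and "SFCZK \<alpha> K"
  shows
    "(\<forall>(p::real) (q::real) (k::real) (w :: real ^ 'n \<Rightarrow> real) (d::nat).
        1 < p \<and> p < real CARD('n) / \<alpha> \<and> 1 / q = 1 / p - \<alpha> / real CARD('n) \<and>
        0 < k \<and> k < p / q \<and> w \<in> A_class p q \<longrightarrow>
        (\<exists>C>0. \<forall>P :: 'n poly2. total_degree P = d \<longrightarrow>
          (\<forall>f \<in> morrey_space p k (\<lambda>x. w x powr p) (\<lambda>x. w x powr q).
            osc_defined P K f \<and>
            osc_op P K f \<in> morrey_space q (q * k / p) (\<lambda>x. w x powr q) (\<lambda>x. w x powr q) \<and>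
            morrey_norm q (q * k / p) (\<lambda>x. w x powr q) (\<lambda>x. w x powr q) (osc_op P K f)
              \<le> ennreal C * morrey_norm p k (\<lambda>x. w x powr p) (\<lambda>x. w x powr q) f)))
     \<and>
     (\<forall>(q::real) (k::real) (w :: real ^ 'n \<Rightarrow> real) (P :: 'n poly2).
        q = real CARD('n) / (real CARD('n) - \<alpha>) \<and> 0 < k \<and> k < 1 / q \<and> w \<in> A_class 1 q \<longrightarrow>
        (\<exists>C>0. \<forall>f \<in> morrey_space 1 k w (\<lambda>x. w x powr q).
          osc_defined P K f \<and> osc_op P K f \<in> borel_measurable lebesgue \<and>
          (\<forall>t>0. \<forall>B\<in>balls.
            wmeasure (\<lambda>x. w x powr q) {x \<in> B. cmod (osc_op P K f x) > t}
              \<le> ennreal (C / t powr q) * (morrey_norm 1 k w (\<lambda>x. w x powr q) f) epowr q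
                  * (wmeasure (\<lambda>x. w x powr q) B) epowr (k * q))))"
proof (intro conjI allI impI, goal_cases)
  case (1 p q k w d)
  then have "1 < p" "p < real CARD('n) / \<alpha>" "1 / q = 1 / p - \<alpha> / real CARD('n)" "0 < k" "k < p / q" "w \<in> A_class p q"
    by auto
  from osc_op_strong[OF assms this] show ?case by blast
next
  case (2 q k w P)
  then have "q = real CARD('n) / (real CARD('n) - \<alpha>)" "0 < k" "k < 1 / q" "w \<in> A_class 1 q"
    by auto
  from osc_op_weak[OF assms this] show ?case by blast
qed

end
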